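(* For surfaces of constant Gauss curvature $K=1$ and $\beta\in\mathbb{C}\setminus\{in\pi:n\in\mathbb{Z}\}$, the Bianchi-Bäcklund transformation with spectral parameter $\beta$ is the following combination of Bonnet transformations with the Bianchi-Bäcklund transformation with spectral parameter $i\pi/2$: $$\mathbf{BB}_\beta=\mathbf{S}_{\beta+i\pi/2}^{-1}\circ\mathbf{BB}_{i\pi/2}\circ\mathbf{S}_{\beta+i\pi/2}.$$
   Context: Surfaces. Let $F:\mathbb{C}\to\mathbb{R}^3$ be a surface of constant Gauss curvature $K=1$ without umbilic points whose Gauss map $\varphi:\mathbb{C}\to S^2$ is harmonic and everywhere non-conformal. Let $z=x+iy$ be a curvature line coordinate with $\mathrm{I}_F=\cosh^2\omega\,dx^2+\sinh^2\omega\,dy^2$ and $\mathrm{II}_F=-\sinh\omega\cosh\omega(dx^2+dy^2)$, where $\omega$ solves the $\sinh$-Gordon equation $\triangle\omega+\sinh\omega\cosh\omega=0$. The transformation $\mathbf{S}_\sigma$. If $\omega$ solves the $\sinh$-Gordon equation, then so does $\omega^\lambda(z,\bar z)=\omega(\lambda z,\lambda^{-1}\bar z)$ for each $\lambda\in\mathbb{C}^*$ (an extension of an invariance observed by Bonnet). Hence $F$ has an associated $\mathbb{C}^*$-family of surfaces $F^\lambda$ of constant Gauss curvature $K=1$, in general complex when $\lambda\notin S^1$. For $\sigma\in\mathbb{C}$ one writes $\mathbf{S}_\sigma(F)=F^\lambda$ with $\lambda=e^{-i\sigma}$. In terms of extended framings: identify $\mathbb{C}^3$ with $\mathfrak{so}(3,\mathbb{C})$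 by $u\mapsto\xi_u$, $\xi_u(v)=u\times v$. Let $e_1^0,e_2^0,e_3^0$ be the canonical basis, let $\mathfrak{k}$ be spanned by $\xi_{e_1^0}$ and $\mathfrak{m}$ by $\xi_{e_2^0},\xi_{e_3^0}$. Let $\psi:\mathbb{C}\to\mathrm{SO}(3,\mathbb{R})$ be a lift of $\varphi$ (i.e. $\varphi=\psi e_1^0$), write $\psi^{-1}d\psi=\alpha_{\mathfrak{k}}+\alpha'_{\mathfrak{m}}+\alpha''_{\mathfrak{m}}$, where $\alpha'_{\mathfrak m}$ and $\alpha''_{\mathfrak m}$ are the $(1,0)$- and $(0,1)$-parts of the $\mathfrak{m}$-component, and let $\Phi_\lambda$ (an extended framing of $\varphi$) satisfy $\Phi_\lambda^{-1}d\Phi_\lambda=\lambda^{-1}\alpha'_{\mathfrak{m}}+\alpha_{\mathfrak{k}}+\lambda\alpha''_{\mathfrak{m}}$. Then $F^\lambda=-i\lambda\frac{\partial\Phi}{\partial\lambda}\Phi_\lambda^{-1}$, with normal $\varphi^\lambda=\Phi_\lambda\xi_{e_1^0}\Phi_\lambda^{-1}$. Bianchi-Bäcklund transforms. A complex surface $\tilde F:\mathbb{C}\to\mathbb{C}^3$ with Gauss map $\tilde\varphi$ is a Bianchi-Bäcklund transform of $F$ if: $z$ is a curvature line coordinate with respect to both $F$ and $\tilde F$; $(\tilde F-F,\varphi)=(\tilde F-F,\tilde\varphi)=0$; $\tilde F-F$ has constant length; and the normals $\varphi,\tilde\varphi$ make a constant angle $\sigma'$ with each other. With $e_1=F_x/\cosh\omega$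 and $e_2=F_y/\sinh\omega$, such transforms have the form $$\tilde F=F+\frac{1}{\sinh\beta}(\cosh\theta\,e_1+i\sinh\theta\,e_2),$$ where $\beta\in\mathbb{C}\setminus\{in\pi:n\in\mathbb{Z}\}$ is a constant (the spectral parameter), $\cot\sigma'=-i\cosh\beta$, and $\theta:\mathbb{C}\to\mathbb{C}$ solves $$\theta_x+i\omega_y=\sinh\beta\sinh\theta\cosh\omega+\cosh\beta\cosh\theta\sinh\omega,$$ $$i\theta_y+\omega_x=-\sinh\beta\cosh\theta\sinh\omega-\cosh\beta\sinh\theta\cosh\omega.$$ $\mathbf{BB}_\beta(F)$ denotes the family of Bianchi-Bäcklund transforms of $F$ with spectral parameter $\beta$; the notation is used in the same way for the (possibly complex) surfaces $F^\lambda$. For $\beta=i\pi/2$ the tangent planes at corresponding points of $F$ and $\tilde F$ are orthogonal.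
   Formalization: S_σ(F) is taken as F^λ with λ = e^{-σ} instead of e^{-iσ}, because with e^{-iσ} the formula fails (β = iπ/2 gives λ = e^π and the constant distance changes); F^λ and the equality of transformations are understood up to rigid motions of C^3. *)

theory Defs
  imports "HOL-Analysis.Analysis"
begin

section \<open>Smooth maps on the plane and Wirtinger derivatives\<close>

definition pdx :: "(complex \<Rightarrow> 'a::real_normed_vector) \<Rightarrow> complex \<Rightarrow> 'a" where
  "pdx f z = frechet_derivative f (at z) 1"

definition pdy :: "(complex \<Rightarrow> 'a::real_normed_vector) \<Rightarrow> complex \<Rightarrow> 'a" where
  "pdy f z = frechet_derivative f (at z) \<i>"

primrec Ck :: "nat \<Rightarrow> (complex \<Rightarrow> 'a::real_normed_vector) \<Rightarrow> bool" where
  "Ck 0 f \<longleftrightarrow> continuous_on UNIV f"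
| "Ck (Suc k) f \<longleftrightarrow> (\<forall>z. f differentiable (at z)) \<and> Ck k (pdx f) \<and> Ck k (pdy f)"

definition smooth :: "(complex \<Rightarrow> 'a::real_normed_vector) \<Rightarrow> bool" where
  "smooth f \<longleftrightarrow> (\<forall>k. Ck k f)"

definition wz :: "(complex \<Rightarrow> complex) \<Rightarrow> complex \<Rightarrow> complex" where
  "wz f z = (pdx f z - \<i> * pdy f z) / 2"

definition wzb :: "(complex \<Rightarrow> complex) \<Rightarrow> complex \<Rightarrow> complex" where
  "wzb f z = (pdx f z + \<i> * pdy f z) / 2"

text \<open>
  If \<open>\<omega>\<close> is attached to \<open>F\<close>, then \<open>(z, zbar) \<mapsto> \<omega>(\<lambda>z, \<lambda>\<inverse>zbar)\<close> is attached to
  the associated surface \<open>F\<^sup>\<lambda>\<close>; for \<open>\<bar>\<lambda>\<bar> \<noteq> 1\<close> this is a substitution in which \<open>z\<close> and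
  \<open>zbar\<close> are independent variables, and it need not make sense on all of the plane.  The
  Sym formula, on the other hand, gives \<open>F\<^sup>\<lambda>\<close> globally, but in the original
  variable, that is, without the substitution.  We therefore keep \<open>F\<^sup>\<lambda>\<close> in the original
  variable and transport the coordinate vector fields instead: the substituted coordinate is
  \<open>w = \<mu>\<inverse>z\<close>, \<open>wbar = \<mu> zbar\<close> with \<open>\<mu> = \<lambda>\<close>, so that \<open>\<partial>\<^sub>w = \<mu> \<partial>\<^sub>z\<close> and
  \<open>\<partial>\<^sub>w\<^sub>b\<^sub>a\<^sub>r = \<mu>\<inverse> \<partial>\<^sub>z\<^sub>b\<^sub>a\<^sub>r\<close>.  Writing formally \<open>w = x + iy\<close>, \<open>wbar = x - iy\<close>, the operators
  \<open>Dx \<mu>\<close> and \<open>Dy \<mu>\<close> are \<open>\<partial>\<^sub>x\<close> and \<open>\<partial>\<^sub>y\<close>.  For \<open>\<mu> = 1\<close> they are the usual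
  partial derivatives, and for \<open>\<bar>\<mu>\<bar> = 1\<close> those in the rotated coordinate \<open>w\<close>.
\<close>

definition Dx :: "complex \<Rightarrow> (complex \<Rightarrow> complex) \<Rightarrow> complex \<Rightarrow> complex" where
  "Dx \<mu> f z = \<mu> * wz f z + inverse \<mu> * wzb f z"

definition Dy :: "complex \<Rightarrow> (complex \<Rightarrow> complex) \<Rightarrow> complex \<Rightarrow> complex" where
  "Dy \<mu> f z = \<i> * (\<mu> * wz f z - inverse \<mu> * wzb f z)"

definition vDx :: "complex \<Rightarrow> (complex \<Rightarrow> complex^3) \<Rightarrow> complex \<Rightarrow> complex^3" where
  "vDx \<mu> F z = (\<chi> i. Dx \<mu> (\<lambda>w. F w $ i) z)"

definition vDy :: "complex \<Rightarrow> (complex \<Rightarrow> complex^3) \<Rightarrow> complex \<Rightarrow> complex^3" where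
  "vDy \<mu> F z = (\<chi> i. Dy \<mu> (\<lambda>w. F w $ i) z)"

definition mwz :: "(complex \<Rightarrow> complex^3^3) \<Rightarrow> complex \<Rightarrow> complex^3^3" where
  "mwz M z = (\<chi> i j. wz (\<lambda>w. M w $ i $ j) z)"

definition mwzb :: "(complex \<Rightarrow> complex^3^3) \<Rightarrow> complex \<Rightarrow> complex^3^3" where
  "mwzb M z = (\<chi> i j. wzb (\<lambda>w. M w $ i $ j) z)"


section \<open>Complex Euclidean 3-space\<close>

text \<open>The complex bilinear (not Hermitian) extension of the Euclidean inner product.\<close>

definition cdot :: "complex^3 \<Rightarrow> complex^3 \<Rightarrow> complex" where
  "cdot u v = (\<Sum>i\<in>UNIV. u $ i * v $ i)"

definition ccross :: "complex^3 \<Rightarrow> complex^3 \<Rightarrow> complex^3" where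
  "ccross u v = vector [u$2 * v$3 - u$3 * v$2, u$3 * v$1 - u$1 * v$3, u$1 * v$2 - u$2 * v$1]"

definition SO3 :: "(complex^3^3) set" where
  "SO3 = {A. orthogonal_matrix A \<and> det A = 1}"

definition xi :: "complex^3 \<Rightarrow> complex^3^3" where
  "xi u = matrix (ccross u)"

definition scaleM :: "complex \<Rightarrow> complex^3^3 \<Rightarrow> complex^3^3" where
  "scaleM c A = (\<chi> i j. c * A $ i $ j)"

text \<open>
  Components with respect to \<open>so(3) = \<kk> \<oplus> \<mm>\<close>.  \<open>inv xi\<close> is the identification of
  \<open>so(3)\<close>, the range of the injective map \<open>xi\<close>, with 3-space.
\<close>

definition kpart :: "complex^3^3 \<Rightarrow> complex^3^3" where
  "kpart A = xi (axis 1 (inv xi A $ 1))"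

definition mpart :: "complex^3^3 \<Rightarrow> complex^3^3" where
  "mpart A = xi (axis 2 (inv xi A $ 2) + axis 3 (inv xi A $ 3))"


section \<open>Surfaces of constant Gauss curvature 1\<close>

text \<open>
  A complex surface with its Gauss map and the parameter \<open>\<mu>\<close> above, which says
  in which coordinate \<open>w\<close> the surface is considered.
\<close>

datatype csurface =
  CSurface (pos: "complex \<Rightarrow> complex^3") (nrm: "complex \<Rightarrow> complex^3") (scl: complex)

abbreviation Px :: "csurface \<Rightarrow> complex \<Rightarrow> complex^3" where "Px X \<equiv> vDx (scl X) (pos X)"
abbreviation Py :: "csurface \<Rightarrow> complex \<Rightarrow> complex^3" where "Py X \<equiv> vDy (scl X) (pos X)"
abbreviation Nx :: "csurface \<Rightarrow> complex \<Rightarrow> complex^3" where "Nx X \<equiv> vDx (scl X) (nrm X)"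
abbreviation Ny :: "csurface \<Rightarrow> complex \<Rightarrow> complex^3" where "Ny X \<equiv> vDy (scl X) (nrm X)"

definition with_gauss_map :: "csurface \<Rightarrow> bool" where
  "with_gauss_map X \<longleftrightarrow> scl X \<noteq> 0 \<and> smooth (pos X) \<and> smooth (nrm X) \<and>
     (\<forall>z. cdot (nrm X z) (nrm X z) = 1 \<and> cdot (Px X z) (nrm X z) = 0 \<and> cdot (Py X z) (nrm X z) = 0)"

text \<open>The first and the second fundamental form are diagonal in the coordinate \<open>w\<close>.\<close>

definition curvature_line_coordinate :: "csurface \<Rightarrow> bool" where
  "curvature_line_coordinate X \<longleftrightarrow>
     (\<forall>z. cdot (Px X z) (Py X z) = 0 \<and> cdot (Px X z) (Ny X z) = 0 \<and> cdot (Py X z) (Nx X z) = 0)"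

text \<open>
  \<open>I = cosh\<^sup>2 \<omega> dx\<^sup>2 + sinh\<^sup>2 \<omega> dy\<^sup>2\<close> and \<open>II = - (dF, d\<phi>) = - sinh \<omega> cosh \<omega> (dx\<^sup>2 + dy\<^sup>2)\<close>.
  Where \<open>sinh \<omega> cosh \<omega> \<noteq> 0\<close> these imply the last line, \<open>III = sinh\<^sup>2 \<omega> dx\<^sup>2 + cosh\<^sup>2 \<omega> dy\<^sup>2\<close>.
  Zeros must be allowed: a real solution of the sinh-Gordon equation on the whole plane that does
  not vanish anywhere would, up to sign, be a positive superharmonic function, hence constant,
  hence 0.  At the zeros \<open>F\<close> is not immersed, \<open>\<phi>\<close> is not determined by \<open>F\<close>, and III is what
  remains of the normalization of the curvature line coordinate.
\<close>

definition spherical_surface :: "csurface \<Rightarrow> (complex \<Rightarrow> complex) \<Rightarrow> bool" where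
  "spherical_surface X \<omega> \<longleftrightarrow> with_gauss_map X \<and> smooth \<omega> \<and>
     (\<forall>z. pdx (pdx \<omega>) z + pdy (pdy \<omega>) z + sinh (\<omega> z) * cosh (\<omega> z) = 0) \<and>
     (\<forall>z. cdot (Px X z) (Px X z) = (cosh (\<omega> z))\<^sup>2 \<and> cdot (Px X z) (Py X z) = 0 \<and>
          cdot (Py X z) (Py X z) = (sinh (\<omega> z))\<^sup>2) \<and>
     (\<forall>z. - cdot (Px X z) (Nx X z) = - sinh (\<omega> z) * cosh (\<omega> z) \<and>
          - cdot (Px X z) (Ny X z) = 0 \<and> - cdot (Py X z) (Nx X z) = 0 \<and>
          - cdot (Py X z) (Ny X z) = - sinh (\<omega> z) * cosh (\<omega> z)) \<and>
     (\<forall>z. cdot (Nx X z) (Nx X z) = (sinh (\<omega> z))\<^sup>2 \<and> cdot (Nx X z) (Ny X z) = 0 \<and>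
          cdot (Ny X z) (Ny X z) = (cosh (\<omega> z))\<^sup>2)"

definition complexify :: "(complex \<Rightarrow> real^3) \<Rightarrow> complex \<Rightarrow> complex^3" where
  "complexify F z = (\<chi> i. complex_of_real (F z $ i))"

definition real_surface :: "(complex \<Rightarrow> real^3) \<Rightarrow> (complex \<Rightarrow> real^3) \<Rightarrow> csurface" where
  "real_surface F \<phi> = CSurface (complexify F) (complexify \<phi>) 1"

text \<open>The Laplacian is minus the energy density times \<open>\<phi>\<close>: harmonicity for maps into the sphere.\<close>

definition harmonic_into_sphere :: "(complex \<Rightarrow> real^3) \<Rightarrow> bool" where
  "harmonic_into_sphere \<phi> \<longleftrightarrow> smooth \<phi> \<and> (\<forall>z. norm (\<phi> z) = 1 \<and>
     pdx (pdx \<phi>) z + pdy (pdy \<phi>) z = - ((norm (pdx \<phi> z))\<^sup>2 + (norm (pdy \<phi> z))\<^sup>2) *\<^sub>R \<phi> z)"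

definition nowhere_conformal :: "(complex \<Rightarrow> real^3) \<Rightarrow> bool" where
  "nowhere_conformal \<phi> \<longleftrightarrow>
     (\<forall>z. \<not> (norm (pdx \<phi> z) = norm (pdy \<phi> z) \<and> inner (pdx \<phi> z) (pdy \<phi> z) = 0))"


section \<open>Extended framings and the associated family\<close>

text \<open>
  \<open>\<Phi>\<^sub>\<lambda>\<inverse> d\<Phi>\<^sub>\<lambda> = \<lambda>\<inverse> \<alpha>'\<^sub>\<mm> + \<alpha>\<^sub>\<kk> + \<lambda> \<alpha>''\<^sub>\<mm>\<close>, split into the
  coefficients of \<open>dz\<close> and of \<open>dzbar\<close>.  A complex surface need not have a real
  lift, so \<open>\<psi>\<close> takes values in the complex group.
\<close>

definition extended_framing ::
  "(complex \<Rightarrow> complex^3) \<Rightarrow> (complex \<Rightarrow> complex \<Rightarrow> complex^3^3) \<Rightarrow> bool" where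
  "extended_framing \<phi> \<Phi> \<longleftrightarrow>
     (\<exists>\<psi>. smooth \<psi> \<and> (\<forall>z. \<psi> z \<in> SO3 \<and> \<psi> z *v axis 1 1 = \<phi> z) \<and>
       (\<forall>l. l \<noteq> 0 \<longrightarrow> smooth (\<Phi> l) \<and> (\<forall>z. \<Phi> l z \<in> SO3 \<and>
          (let A = matrix_inv (\<psi> z) ** mwz \<psi> z; B = matrix_inv (\<psi> z) ** mwzb \<psi> z in
             matrix_inv (\<Phi> l z) ** mwz (\<Phi> l) z = scaleM (inverse l) (mpart A) + kpart A \<and>
             matrix_inv (\<Phi> l z) ** mwzb (\<Phi> l) z = kpart B + scaleM l (mpart B))))) \<and>
     continuous_on ((- {0}) \<times> UNIV) (\<lambda>(l, z). \<Phi> l z) \<and>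
     (\<forall>z i j. (\<lambda>l. \<Phi> l z $ i $ j) holomorphic_on - {0})"

definition sym_pos :: "(complex \<Rightarrow> complex \<Rightarrow> complex^3^3) \<Rightarrow> complex \<Rightarrow> complex \<Rightarrow> complex^3" where
  "sym_pos \<Phi> l z =
     inv xi (scaleM (- \<i> * l) ((\<chi> i j. deriv (\<lambda>k. \<Phi> k z $ i $ j) l) ** matrix_inv (\<Phi> l z)))"

definition sym_nrm :: "(complex \<Rightarrow> complex \<Rightarrow> complex^3^3) \<Rightarrow> complex \<Rightarrow> complex \<Rightarrow> complex^3" where
  "sym_nrm \<Phi> l z = inv xi (\<Phi> l z ** xi (axis 1 1) ** matrix_inv (\<Phi> l z))"

text \<open>Equality up to proper rigid motions of complex Euclidean 3-space.\<close>

definition congruent :: "csurface \<Rightarrow> csurface \<Rightarrow> bool" where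
  "congruent X Y \<longleftrightarrow> scl X = scl Y \<and>
     (\<exists>A\<in>SO3. \<exists>c. \<forall>z. pos Y z = A *v pos X z + c \<and> nrm Y z = A *v nrm X z)"

text \<open>
  \<open>Y\<close> is \<open>X\<^sup>\<lambda>\<close>.  The extended framing is unique only up to left multiplication by a
  matrix depending on \<open>\<lambda>\<close>, so \<open>X\<^sup>\<lambda>\<close> is unique only up to rigid motion, and the associated family
  is a relation.  The sign \<open>\<epsilon>\<close>: at \<open>\<lambda> = 1\<close> the Sym formula yields the
  surface with \<open>F\<^sub>x = \<phi> \<times> \<phi>\<^sub>y\<close>, whereas I and II leave open whether
  \<open>F\<^sub>x = \<phi> \<times> \<phi>\<^sub>y\<close> (\<open>\<epsilon> = 1\<close>) or \<open>F\<^sub>x = - \<phi> \<times> \<phi>\<^sub>y\<close> (\<open>\<epsilon> = -1\<close>, the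
  point reflection of a surface of the first kind).
\<close>

definition associated :: "complex \<Rightarrow> csurface \<Rightarrow> csurface \<Rightarrow> bool" where
  "associated l X Y \<longleftrightarrow> l \<noteq> 0 \<and>
     (\<exists>\<Phi> \<epsilon>. extended_framing (nrm X) \<Phi> \<and> \<epsilon> \<in> {1, -1} \<and>
        congruent X (CSurface (\<lambda>z. \<epsilon> *s sym_pos \<Phi> 1 z) (sym_nrm \<Phi> 1) (scl X)) \<and>
        congruent Y (CSurface (\<lambda>z. \<epsilon> *s sym_pos \<Phi> l z) (sym_nrm \<Phi> l) (l * scl X)))"

text \<open>
  The Bonnet transformation \<open>S\<^sub>\<sigma>\<close> is \<open>F \<mapsto> F\<^sup>\<lambda>\<close> with \<open>\<lambda> = exp (-\<sigma>)\<close>.  Thus \<open>\<sigma>\<close> is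
  measured on the same scale as the spectral parameter \<open>\<beta>\<close>, and the Bonnet rotation through a
  real angle \<open>\<tau>\<close>, \<open>\<lambda> = exp (-i\<tau>)\<close>, is \<open>S\<^sub>\<sigma>\<close> with \<open>\<sigma> = i\<tau>\<close>.  (With
  \<open>\<lambda> = exp (-i\<sigma>)\<close> for complex \<open>\<sigma>\<close> the factorization of \<open>BB\<^sub>\<beta>\<close> through \<open>S\<^sub>\<sigma>\<close>,
  \<open>\<sigma> = \<beta> + i\<pi>/2\<close>, fails.  The equations for \<open>\<theta>\<close> are equivalent to
  \<open>(\<theta> - \<omega>)\<^sub>w = e\<^sup>\<beta> sinh (\<theta> + \<omega>) / 2\<close> and
  \<open>(\<theta> + \<omega>)\<^sub>w\<^sub>b\<^sub>a\<^sub>r = - e\<^sup>-\<^sup>\<beta> sinh (\<theta> - \<omega>) / 2\<close>, so passing from \<open>F\<close> to \<open>F\<^sup>\<lambda>\<close> replaces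
  \<open>e\<^sup>\<beta>\<close> by \<open>\<lambda> e\<^sup>\<beta>\<close>, where \<open>\<beta>\<close> and \<open>\<beta> + i\<pi>\<close> give the same transforms; hence
  \<open>\<lambda> e\<^sup>\<beta>\<close> has to be \<open>\<plusminus> i\<close>.)
\<close>

definition bonnet :: "complex \<Rightarrow> csurface \<Rightarrow> csurface \<Rightarrow> bool" where
  "bonnet \<sigma> = associated (exp (- \<sigma>))"


section \<open>Bianchi-Baecklund transforms\<close>

text \<open>\<open>\<sigma>'\<close> is the constant angle between the normals.\<close>

definition bianchi_baecklund_transform :: "complex \<Rightarrow> csurface \<Rightarrow> csurface \<Rightarrow> bool" where
  "bianchi_baecklund_transform \<sigma>' X Y \<longleftrightarrow> with_gauss_map X \<and> with_gauss_map Y \<and> scl Y = scl X \<and>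
     curvature_line_coordinate X \<and> curvature_line_coordinate Y \<and>
     (\<forall>z. cdot (pos Y z - pos X z) (nrm X z) = 0 \<and> cdot (pos Y z - pos X z) (nrm Y z) = 0) \<and>
     (\<exists>d. \<forall>z. cdot (pos Y z - pos X z) (pos Y z - pos X z) = d\<^sup>2) \<and>
     (\<forall>z. cdot (nrm X z) (nrm Y z) = cos \<sigma>')"

text \<open>
  The frame \<open>e\<^sub>1 = F\<^sub>x / cosh \<omega>\<close>, \<open>e\<^sub>2 = F\<^sub>y / sinh \<omega>\<close>.  The equations for the derivatives of the
  Gauss map are consequences of I, II, III and determine \<open>e\<^sub>1\<close>, \<open>e\<^sub>2\<close> where a
  denominator vanishes.
\<close>

definition curvature_frame ::
  "csurface \<Rightarrow> (complex \<Rightarrow> complex) \<Rightarrow> (complex \<Rightarrow> complex^3) \<Rightarrow> (complex \<Rightarrow> complex^3) \<Rightarrow> bool" where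
  "curvature_frame X \<omega> e1 e2 \<longleftrightarrow>
     (\<forall>z. Px X z = cosh (\<omega> z) *s e1 z \<and> Py X z = sinh (\<omega> z) *s e2 z \<and>
          Nx X z = sinh (\<omega> z) *s e1 z \<and> Ny X z = cosh (\<omega> z) *s e2 z)"

definition BB :: "complex \<Rightarrow> csurface \<Rightarrow> csurface \<Rightarrow> bool" where
  "BB \<beta> X Y \<longleftrightarrow>
     (\<exists>\<sigma>'. sin \<sigma>' \<noteq> 0 \<and> cot \<sigma>' = - \<i> * cosh \<beta> \<and> bianchi_baecklund_transform \<sigma>' X Y) \<and>
     (\<exists>\<omega> e1 e2 \<theta>. spherical_surface X \<omega> \<and> curvature_frame X \<omega> e1 e2 \<and> smooth \<theta> \<and>
        (\<forall>z. Dx (scl X) \<theta> z + \<i> * Dy (scl X) \<omega> z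
               = sinh \<beta> * sinh (\<theta> z) * cosh (\<omega> z) + cosh \<beta> * cosh (\<theta> z) * sinh (\<omega> z)) \<and>
        (\<forall>z. \<i> * Dy (scl X) \<theta> z + Dx (scl X) \<omega> z
               = - sinh \<beta> * cosh (\<theta> z) * sinh (\<omega> z) - cosh \<beta> * sinh (\<theta> z) * cosh (\<omega> z)) \<and>
        (\<forall>z. pos Y z = pos X z
               + (1 / sinh \<beta>) *s (cosh (\<theta> z) *s e1 z + (\<i> * sinh (\<theta> z)) *s e2 z)))"

end

theory Submission
  imports Defs "HOL-Complex_Analysis.Cauchy_Integral_Formula"
begin

text \<open>
  The frame \<open>(\<phi>, e2, \<epsilon> e1)\<close> of a surface is a map into \<open>SO(3, \<complex>)\<close> whose linear system depends only
  on \<open>\<omega>\<close> and on the scale \<open>\<mu>\<close> of the coordinate. Hence surfaces with the same \<open>\<omega>\<close>, \<open>\<epsilon>\<close> and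
  scale are congruent, and by the Sym formula two surfaces are associated exactly if, up to scale, they
  have the same \<open>\<omega>\<close>. In the frame of the surface, a Bianchi-Baecklund transform amounts to a
  solution \<open>\<theta>\<close> of the two first order equations, which is the \<open>\<omega>\<close> of the transform. In the
  derivatives \<open>wz \<theta>\<close>, \<open>wzb \<theta>\<close> along the two characteristic directions these equations involve
  \<open>\<beta>\<close> and \<open>\<mu>\<close> only through \<open>e\<^sup>\<beta> / \<mu>\<close>, so that a change of \<open>\<beta>\<close> is the same as a change of \<open>\<mu>\<close>.
\<close>

section \<open>Calculus in the plane\<close>

text \<open>For \<lambda> = exp (-(\<beta> + i \<pi>/2)) one has exp \<beta> * \<lambda> = -i, which
  is minus exp (i \<pi>/2). The sign is absorbed by replacing \<theta> with \<theta> + i \<pi>: this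
  negates sinh \<theta> and cosh \<theta>, which amounts to a half-turn of the transformed frame
  about its normal and leaves the surface alone. Two obstacles shape the proof. First, for
  |\<lambda>| \<noteq> 1 the surface cannot be obtained by a substitution, so a frame on the whole
  plane that is holomorphic in \<lambda> has to be constructed. Its flatness for all \<lambda> is
  the sinh-Gordon equation, and it is integrated along the rays from 0. Second, the normal of a
  transform is fixed only up to signs, because cot \<sigma>' gives the angle modulo \<pi>. One sign,
  \<open>s\<close>, is carried through both sides, the transform having s \<theta> in place of
  \<omega>. A mismatch of the other is harmless if cosh \<beta> = 0, as for i \<pi>/2; for general
  \<beta> it forces a degenerate surface, because cosh \<omega> has no zeros for real
  \<omega>.\<close>

lemma pdx_eqI: "(f has_derivative D) (at z) \<Longrightarrow> pdx f z = D 1"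
  and pdy_eqI: "(f has_derivative D) (at z) \<Longrightarrow> pdy f z = D \<i>"
  by (auto simp: pdx_def pdy_def dest!: frechet_derivative_at)

lemma Ck_Suc_imp: "Ck (Suc k) f \<Longrightarrow> Ck k f"
proof (induction k arbitrary: f)
  case 0
  then show ?case
    by (auto intro!: continuous_at_imp_continuous_on differentiable_imp_continuous_within)
next
  case (Suc k)
  then show ?case by (metis Ck.simps(2))
qed

lemma smooth_imp_differentiable: "smooth f \<Longrightarrow> f differentiable (at z)"
  using Ck.simps(2)[of 0 f] unfolding smooth_def by blast

lemma smooth_pdx: "smooth f \<Longrightarrow> smooth (pdx f)"
  and smooth_pdy: "smooth f \<Longrightarrow> smooth (pdy f)"
  unfolding smooth_def using Ck.simps(2)[of _ f] by blast+

lemma smooth_imp_continuous_on: "smooth f \<Longrightarrow> continuous_on S f"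
  using Ck.simps(1)[of f] continuous_on_subset[of UNIV f S] unfolding smooth_def by blast

lemma differentiable_has_derivative_pd:
  assumes "f differentiable (at z)"
  shows "(f has_derivative (\<lambda>h. Re h *\<^sub>R pdx f z + Im h *\<^sub>R pdy f z)) (at z)"
proof -
  obtain D where D: "(f has_derivative D) (at z)" using assms by (auto simp: differentiable_def)
  interpret linear D using D has_derivative_linear by blast
  have "D h = Re h *\<^sub>R D 1 + Im h *\<^sub>R D \<i>" for h
  proof -
    have "h = Re h *\<^sub>R 1 + Im h *\<^sub>R \<i>" by (simp add: complex_eq_iff)
    then show ?thesis by (metis add scaleR)
  qed
  then have "D = (\<lambda>h. Re h *\<^sub>R pdx f z + Im h *\<^sub>R pdy f z)"
    unfolding pdx_eqI[OF D] pdy_eqI[OF D] by blast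
  with D show ?thesis by simp
qed

lemmas smooth_has_derivative =
  differentiable_has_derivative_pd[OF smooth_imp_differentiable]

section \<open>Closure properties of smooth maps\<close>

lemma Ck_const: "Ck k (\<lambda>z. c)"
proof (induction k arbitrary: c)
  case (Suc k)
  have "pdx (\<lambda>z. c) = (\<lambda>z. 0)" "pdy (\<lambda>z. c) = (\<lambda>z. 0)"
    by (auto simp: pdx_def pdy_def)
  then show ?case using Suc by simp
qed simp

lemma Ck_linear:
  assumes "bounded_linear L"
  shows "Ck k f \<Longrightarrow> Ck k (\<lambda>z. L (f z))"
proof (induction k arbitrary: f)
  case 0
  then show ?case using bounded_linear.continuous_on[OF assms] by auto
next
  case (Suc k)
  have D: "((\<lambda>z. L (f z)) has_derivative (\<lambda>h. L (Re h *\<^sub>R pdx f z + Im h *\<^sub>R pdy f z))) (at z)" for z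
    using Suc.prems by (intro bounded_linear.has_derivative[OF assms] differentiable_has_derivative_pd) simp
  have "pdx (\<lambda>z. L (f z)) = (\<lambda>z. L (pdx f z))" "pdy (\<lambda>z. L (f z)) = (\<lambda>z. L (pdy f z))"
    using pdx_eqI[OF D] pdy_eqI[OF D] by auto
  with Suc D show ?case by (auto simp: differentiable_def)
qed

lemma Ck_add: "Ck k f \<Longrightarrow> Ck k g \<Longrightarrow> Ck k (\<lambda>z. f z + g z)"
proof (induction k arbitrary: f g)
  case 0
  then show ?case by (auto intro: continuous_intros)
next
  case (Suc k)
  have D: "((\<lambda>z. f z + g z) has_derivative (\<lambda>h. (Re h *\<^sub>R pdx f z + Im h *\<^sub>R pdy f z) +
      (Re h *\<^sub>R pdx g z + Im h *\<^sub>R pdy g z))) (at z)" for z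
    using Suc.prems by (intro has_derivative_add differentiable_has_derivative_pd) auto
  have "pdx (\<lambda>z. f z + g z) = (\<lambda>z. pdx f z + pdx g z)" "pdy (\<lambda>z. f z + g z) = (\<lambda>z. pdy f z + pdy g z)"
    using pdx_eqI[OF D] pdy_eqI[OF D] by auto
  with Suc D show ?case by (auto simp: differentiable_def)
qed

text \<open>An arbitrary bounded bilinear product is allowed so that the rule serves both for
  scalars and for the matrix product in linear systems.\<close>

lemma (in bounded_bilinear) Ck_bilinear: "Ck k f \<Longrightarrow> Ck k g \<Longrightarrow> Ck k (\<lambda>z. prod (f z) (g z))"
proof (induction k arbitrary: f g)
  case 0
  then show ?case by (auto intro: continuous_on)
next
  case (Suc k)
  have D: "((\<lambda>z. prod (f z) (g z)) has_derivative (\<lambda>h. prod (f z) (Re h *\<^sub>R pdx g z + Im h *\<^sub>R pdy g z) +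
      prod (Re h *\<^sub>R pdx f z + Im h *\<^sub>R pdy f z) (g z))) (at z)" for z
    using Suc.prems by (intro FDERIV differentiable_has_derivative_pd) auto
  have "pdx (\<lambda>z. prod (f z) (g z)) = (\<lambda>z. prod (f z) (pdx g z) + prod (pdx f z) (g z))"
       "pdy (\<lambda>z. prod (f z) (g z)) = (\<lambda>z. prod (f z) (pdy g z) + prod (pdy f z) (g z))"
    using pdx_eqI[OF D] pdy_eqI[OF D] by auto
  moreover have "Ck k f" "Ck k g" using Suc.prems Ck_Suc_imp by blast+
  ultimately show ?case using Suc D by (auto simp: differentiable_def intro!: Ck_add)
qed

lemma smooth_const [intro, simp]: "smooth (\<lambda>z. c)"
  by (simp add: smooth_def Ck_const)

lemma smooth_linear: "bounded_linear L \<Longrightarrow> smooth f \<Longrightarrow> smooth (\<lambda>z. L (f z))"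
  by (simp add: smooth_def Ck_linear)

lemma smooth_add [intro]: "smooth f \<Longrightarrow> smooth g \<Longrightarrow> smooth (\<lambda>z. f z + g z)"
  by (simp add: smooth_def Ck_add)

lemma smooth_uminus [intro]: "smooth f \<Longrightarrow> smooth (\<lambda>z. - f z)"
  by (rule smooth_linear[OF bounded_linear_minus[OF bounded_linear_ident]])

lemma smooth_diff [intro]: "smooth f \<Longrightarrow> smooth g \<Longrightarrow> smooth (\<lambda>z. f z - g z)"
  using smooth_add[OF _ smooth_uminus, of f g] by simp

lemma smooth_mult [intro]:
  "smooth f \<Longrightarrow> smooth g \<Longrightarrow> smooth (\<lambda>z. f z * g z :: 'a::real_normed_algebra)"
  by (simp add: smooth_def bounded_bilinear.Ck_bilinear[OF bounded_bilinear_mult])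

lemma smooth_divide_const [intro]: "smooth f \<Longrightarrow> smooth (\<lambda>z. f z / c :: complex)"
  unfolding divide_inverse by (intro smooth_mult smooth_const)

lemma smooth_nth [intro]: "smooth f \<Longrightarrow> smooth (\<lambda>z. f z $ i)"
  by (rule smooth_linear[OF bounded_linear_vec_nth])

lemma smooth_sum [intro]: "(\<And>i. i \<in> I \<Longrightarrow> smooth (f i)) \<Longrightarrow> smooth (\<lambda>z. \<Sum>i\<in>I. f i z)"
  by (induction I rule: infinite_finite_induct) auto

text \<open>Together with \<open>vec_eq_sum_axis\<close> this reduces smoothness and
  differentiability of vector-valued maps to their components.\<close>

lemma bounded_linear_axis: "bounded_linear (axis i :: 'a::real_normed_vector \<Rightarrow> 'a^'n)"
proof (rule bounded_linear_intro[where K=1])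
  show "norm (axis i x :: 'a^'n) \<le> norm x * 1" for x
  proof -
    have "norm (axis i x :: 'a^'n) \<le> (\<Sum>j\<in>UNIV. norm ((axis i x :: 'a^'n) $ j))"
      unfolding norm_vec_def by (rule L2_set_le_sum) simp
    also have "\<dots> = (\<Sum>j\<in>UNIV. if j = i then norm x else 0)"
      by (rule sum.cong) (auto simp: axis_def)
    finally show ?thesis by simp
  qed
qed (auto simp: axis_def vec_eq_iff)

lemma vec_eq_sum_axis: "v = (\<Sum>i\<in>UNIV. axis i (v $ i))" for v :: "'a::comm_monoid_add^'n"
  by (simp add: vec_eq_iff axis_def if_distrib sum.delta cong: if_cong)

lemma smooth_vec: "(\<And>i. smooth (\<lambda>z. f z $ i)) \<Longrightarrow> smooth f"
proof -
  assume "\<And>i. smooth (\<lambda>z. f z $ i)"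
  then have "smooth (\<lambda>z. \<Sum>i\<in>UNIV. axis i (f z $ i))"
    by (intro smooth_sum smooth_linear[OF bounded_linear_axis]) auto
  then show ?thesis by (simp add: vec_eq_sum_axis[symmetric])
qed

lemma has_derivative_sinh: "(f has_derivative D) (at z) \<Longrightarrow>
    ((\<lambda>z. sinh (f z)) has_derivative (\<lambda>h. cosh (f z) * D h)) (at z)"
  and has_derivative_cosh: "(f has_derivative D) (at z) \<Longrightarrow>
    ((\<lambda>z. cosh (f z)) has_derivative (\<lambda>h. sinh (f z) * D h)) (at z)"
  for f :: "complex \<Rightarrow> complex"
proof -
  assume f: "(f has_derivative D) (at z)"
  have "(sinh has_derivative (*) (cosh (f z))) (at (f z))" "(cosh has_derivative (*) (sinh (f z))) (at (f z))"
    using has_field_derivative_sinh[OF DERIV_ident, of "f z" UNIV] has_field_derivative_cosh[OF DERIV_ident, of "f z" UNIV]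
    unfolding has_field_derivative_def by simp_all
  then show "((\<lambda>z. sinh (f z)) has_derivative (\<lambda>h. cosh (f z) * D h)) (at z)"
    "((\<lambda>z. cosh (f z)) has_derivative (\<lambda>h. sinh (f z) * D h)) (at z)"
    using has_derivative_compose[OF f] by blast+
qed

lemma pd_sinh_cosh:
  fixes f :: "complex \<Rightarrow> complex"
  assumes "f differentiable (at z)"
  shows "pdx (\<lambda>z. sinh (f z)) z = cosh (f z) * pdx f z" "pdy (\<lambda>z. sinh (f z)) z = cosh (f z) * pdy f z"
    "pdx (\<lambda>z. cosh (f z)) z = sinh (f z) * pdx f z" "pdy (\<lambda>z. cosh (f z)) z = sinh (f z) * pdy f z"
  using pdx_eqI[OF has_derivative_sinh[OF differentiable_has_derivative_pd[OF assms]]]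
    pdy_eqI[OF has_derivative_sinh[OF differentiable_has_derivative_pd[OF assms]]]
    pdx_eqI[OF has_derivative_cosh[OF differentiable_has_derivative_pd[OF assms]]]
    pdy_eqI[OF has_derivative_cosh[OF differentiable_has_derivative_pd[OF assms]]]
  by simp_all

text \<open>Differentiation exchanges sinh and cosh, so neither induction closes without the
  other.\<close>

lemma Ck_sinh_cosh:
  fixes f :: "complex \<Rightarrow> complex"
  assumes "smooth f"
  shows "Ck k (\<lambda>z. sinh (f z)) \<and> Ck k (\<lambda>z. cosh (f z))"
proof (induction k)
  case 0
  then show ?case using smooth_imp_continuous_on[OF assms]
    by (auto intro!: continuous_intros)
next
  case (Suc k)
  have d: "f differentiable (at z)" for z using assms smooth_imp_differentiable by blast
  have "(\<lambda>z. sinh (f z)) differentiable (at z)" "(\<lambda>z. cosh (f z)) differentiable (at z)" for z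
    using has_derivative_sinh has_derivative_cosh d unfolding differentiable_def by blast+
  moreover have "pdx (\<lambda>z. sinh (f z)) = (\<lambda>z. cosh (f z) * pdx f z)" "pdy (\<lambda>z. sinh (f z)) = (\<lambda>z. cosh (f z) * pdy f z)"
    "pdx (\<lambda>z. cosh (f z)) = (\<lambda>z. sinh (f z) * pdx f z)" "pdy (\<lambda>z. cosh (f z)) = (\<lambda>z. sinh (f z) * pdy f z)"
    using pd_sinh_cosh[OF d] by auto
  moreover have "Ck k (pdx f)" "Ck k (pdy f)" using assms smooth_pdx smooth_pdy unfolding smooth_def by blast+
  ultimately show ?case using Suc
    by (auto intro!: bounded_bilinear.Ck_bilinear[OF bounded_bilinear_mult])
qed

lemma smooth_sinh [intro]: "smooth f \<Longrightarrow> smooth (\<lambda>z. sinh (f z))"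
  and smooth_cosh [intro]: "smooth f \<Longrightarrow> smooth (\<lambda>z. cosh (f z))"
  for f :: "complex \<Rightarrow> complex"
  using Ck_sinh_cosh unfolding smooth_def by blast+

section \<open>Restriction to coordinate lines and symmetry of second derivatives\<close>

lemma pdx_line:
  assumes "f differentiable (at (z + of_real x))"
  shows "((\<lambda>x. f (z + of_real x)) has_vector_derivative pdx f (z + of_real x)) (at x within S)"
proof -
  have "((\<lambda>x. z + of_real x) has_derivative (\<lambda>h. of_real h)) (at x within S)"
    by (auto intro!: derivative_eq_intros)
  from has_derivative_compose[OF this differentiable_has_derivative_pd[OF assms]]
  show ?thesis by (simp add: has_vector_derivative_def)
qed

lemma pdy_line:
  assumes "f differentiable (at (z + \<i> * of_real y))"
  shows "((\<lambda>y. f (z + \<i> * of_real y)) has_vector_derivative pdy f (z + \<i> * of_real y)) (at y within S)"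
proof -
  have "((\<lambda>y. z + \<i> * of_real y) has_derivative (\<lambda>h. \<i> * of_real h)) (at y within S)"
    by (auto intro!: derivative_eq_intros)
  from has_derivative_compose[OF this differentiable_has_derivative_pd[OF assms]]
  show ?thesis by (simp add: has_vector_derivative_def)
qed

text \<open>Write the increment of f in the y-direction as an integral of \<open>pdy f\<close>,
  differentiate under the integral sign in x, and then differentiate in the upper limit.\<close>

lemma pdx_pdy_commute:
  fixes f :: "complex \<Rightarrow> 'a::banach"
  assumes f: "smooth f"
  shows "pdx (pdy f) z = pdy (pdx f) z"
proof -
  note diff = smooth_imp_differentiable
  have cyx: "continuous_on UNIV (pdx (pdy f))" and cy: "continuous_on UNIV (pdy f)"
    using f smooth_pdx smooth_pdy smooth_imp_continuous_on by blast+
  have eq: "pdx f (z + \<i> * of_real t) - pdx f z = integral {0..t} (\<lambda>s. pdx (pdy f) (z + \<i> * of_real s))"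
    if "t \<in> {0..1}" for t
  proof -
    have FTC: "f (z + of_real x + \<i> * of_real t) - f (z + of_real x) =
        integral (cbox 0 t) (\<lambda>s. pdy f (z + of_real x + \<i> * of_real s))" for x
      using fundamental_theorem_of_calculus[of 0 t "\<lambda>s. f (z + of_real x + \<i> * of_real s)"] that
        pdy_line[OF diff[OF f], of "z + of_real x"]
      by (intro integral_unique[symmetric]) auto
    have "((\<lambda>x. integral (cbox 0 t) (\<lambda>s. pdy f (z + of_real x + \<i> * of_real s))) has_vector_derivative
         integral (cbox 0 t) (\<lambda>s. pdx (pdy f) (z + of_real 0 + \<i> * of_real s))) (at 0 within UNIV)"
    proof (rule leibniz_rule_vector_derivative)
      show "((\<lambda>x. pdy f (z + of_real x + \<i> * of_real s)) has_vector_derivative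
          pdx (pdy f) (z + of_real x + \<i> * of_real s)) (at x within UNIV)" for x s
        using pdx_line[OF diff[OF smooth_pdy[OF f]], of "z + \<i> * of_real s" x UNIV]
        by (simp add: algebra_simps)
    qed (auto intro!: integrable_continuous_interval continuous_intros continuous_on_compose2[OF cy] continuous_on_compose2[OF cyx]
          simp: split_beta)
    then have "((\<lambda>x. f (z + of_real x + \<i> * of_real t) - f (z + of_real x)) has_vector_derivative
         integral {0..t} (\<lambda>s. pdx (pdy f) (z + \<i> * of_real s))) (at 0)"
      using FTC by simp
    moreover have "((\<lambda>x. f (z + of_real x + \<i> * of_real t) - f (z + of_real x)) has_vector_derivative
         pdx f (z + \<i> * of_real t) - pdx f z) (at 0)"
      using has_vector_derivative_diff[OF pdx_line[OF diff[OF f], of "z + \<i> * of_real t" 0 UNIV] pdx_line[OF diff[OF f], of z 0 UNIV]]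
      by (simp add: algebra_simps)
    ultimately show ?thesis by (rule vector_derivative_unique_at[symmetric])
  qed
  \<comment> \<open>Both sides of \<open>eq\<close> are differentiated at t = 0. A one-sided
    derivative is enough, as it is unique within the interval.\<close>
  have "((\<lambda>t. integral {0..t} (\<lambda>s. pdx (pdy f) (z + \<i> * of_real s))) has_vector_derivative
      pdx (pdy f) (z + \<i> * of_real 0)) (at 0 within {0..1})"
    by (intro integral_has_vector_derivative) (auto intro!: continuous_intros continuous_on_compose2[OF cyx])
  then have "((\<lambda>t. pdx f (z + \<i> * of_real t) - pdx f z) has_vector_derivative
      pdx (pdy f) z) (at 0 within {0..1})"
    using has_vector_derivative_transform[of 0 "{0..1}" "\<lambda>t. pdx f (z + \<i> * of_real t) - pdx f z"] eq by simp
  moreover have "((\<lambda>t. pdx f (z + \<i> * of_real t) - pdx f z) has_vector_derivative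
      pdy (pdx f) z) (at 0 within {0..1})"
    using has_vector_derivative_diff[OF pdy_line[OF diff[OF smooth_pdx[OF f]], of z 0 "{0..1}"] has_vector_derivative_const[of "pdx f z"]]
    by simp
  ultimately show ?thesis
    using vector_derivative_unique_within_closed_interval[of 0 1 0] by fastforce
qed

text \<open>
  \<open>wz\<close>, \<open>wzb\<close>, \<open>Dx \<mu>\<close> and \<open>Dy \<mu>\<close> are all of the form \<open>dd a b\<close>.
\<close>

definition dd :: "complex \<Rightarrow> complex \<Rightarrow> (complex \<Rightarrow> complex) \<Rightarrow> complex \<Rightarrow> complex" where
  "dd a b f z = a * pdx f z + b * pdy f z"

lemma wz_eq_dd: "wz = dd (1/2) (- \<i> / 2)" and wzb_eq_dd: "wzb = dd (1/2) (\<i> / 2)"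
  by (auto simp: wz_def wzb_def dd_def fun_eq_iff field_simps)

lemma Dx_eq_dd: "Dx \<mu> = dd ((\<mu> + inverse \<mu>) / 2) (\<i> * (inverse \<mu> - \<mu>) / 2)"
  and Dy_eq_dd: "Dy \<mu> = dd (\<i> * (\<mu> - inverse \<mu>) / 2) ((\<mu> + inverse \<mu>) / 2)"
  by (auto simp: Dx_def Dy_def wz_def wzb_def dd_def fun_eq_iff algebra_simps add_divide_distrib diff_divide_distrib)

lemma smooth_dd [intro]: "smooth f \<Longrightarrow> smooth (dd a b f)"
  unfolding dd_def[abs_def]
  by (intro smooth_add smooth_mult smooth_const smooth_pdx smooth_pdy)

lemma dd_const [simp]: "dd a b (\<lambda>z. k) z = 0"
  by (simp add: dd_def pdx_def pdy_def)

lemma dd_eqI: "(f has_derivative D) (at z) \<Longrightarrow> dd a b f z = a * D 1 + b * D \<i>"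
  by (simp add: dd_def pdx_eqI pdy_eqI)

lemma dd_add: "smooth f \<Longrightarrow> smooth g \<Longrightarrow> dd a b (\<lambda>z. f z + g z) z = dd a b f z + dd a b g z"
  by (subst dd_eqI[OF has_derivative_add[OF smooth_has_derivative smooth_has_derivative]])
     (simp_all add: dd_def algebra_simps)

lemma dd_diff: "smooth f \<Longrightarrow> smooth g \<Longrightarrow> dd a b (\<lambda>z. f z - g z) z = dd a b f z - dd a b g z"
  by (subst dd_eqI[OF has_derivative_diff[OF smooth_has_derivative smooth_has_derivative]])
     (simp_all add: dd_def algebra_simps)

lemma dd_uminus: "smooth f \<Longrightarrow> dd a b (\<lambda>z. - f z) z = - dd a b f z"
  using dd_diff[of "\<lambda>z. 0" f] by simp

lemma dd_mult:
  "smooth f \<Longrightarrow> smooth g \<Longrightarrow> dd a b (\<lambda>z. f z * g z) z = dd a b f z * g z + f z * dd a b g z"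
  by (subst dd_eqI[OF has_derivative_mult[OF smooth_has_derivative smooth_has_derivative]])
     (simp_all add: dd_def algebra_simps)

lemma dd_cmult: "smooth f \<Longrightarrow> dd a b (\<lambda>z. k * f z) z = k * dd a b f z"
  using dd_mult[of "\<lambda>z. k" f] by simp

lemma dd_sinh: "smooth f \<Longrightarrow> dd a b (\<lambda>z. sinh (f z)) z = cosh (f z) * dd a b f z"
  and dd_cosh: "smooth f \<Longrightarrow> dd a b (\<lambda>z. cosh (f z)) z = sinh (f z) * dd a b f z"
  by (simp_all add: dd_def pd_sinh_cosh smooth_imp_differentiable algebra_simps)

lemmas dd_rules = dd_add dd_diff dd_uminus dd_mult dd_sinh dd_cosh

lemma pd_dd:
  assumes "smooth f"
  shows "pdx (dd a b f) z = a * pdx (pdx f) z + b * pdx (pdy f) z"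
    "pdy (dd a b f) z = a * pdy (pdx f) z + b * pdy (pdy f) z"
proof -
  have D: "((\<lambda>z. a * pdx f z + b * pdy f z) has_derivative
     (\<lambda>h. a * (Re h *\<^sub>R pdx (pdx f) z + Im h *\<^sub>R pdy (pdx f) z) +
       b * (Re h *\<^sub>R pdx (pdy f) z + Im h *\<^sub>R pdy (pdy f) z))) (at z)"
    using assms by (intro has_derivative_add has_derivative_mult_right smooth_has_derivative smooth_pdx smooth_pdy)
  show "pdx (dd a b f) z = a * pdx (pdx f) z + b * pdx (pdy f) z"
    "pdy (dd a b f) z = a * pdy (pdx f) z + b * pdy (pdy f) z"
    using pdx_eqI[OF D] pdy_eqI[OF D] by (simp_all add: dd_def[abs_def])
qed

lemma dd_commute: "smooth f \<Longrightarrow> dd a b (dd c d f) z = dd c d (dd a b f) z"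
  by (simp add: dd_def[of _ _ "dd _ _ _"] pd_dd pdx_pdy_commute algebra_simps)

text \<open>The Laplacian is four times the product of the two Wirtinger derivatives, in which the
  factors \<mu> and 1/\<mu> cancel. So the sinh-Gordon equation is the same in every coordinate
  w.\<close>

lemma laplace_eq_Dx_Dy:
  assumes "smooth f" "\<mu> \<noteq> 0"
  shows "pdx (pdx f) z + pdy (pdy f) z = Dx \<mu> (Dx \<mu> f) z + Dy \<mu> (Dy \<mu> f) z"
proof -
  have "Dx \<mu> (Dx \<mu> f) z + Dy \<mu> (Dy \<mu> f) z =
      \<mu> * inverse \<mu> * (pdx (pdx f) z + pdy (pdy f) z)"
    using assms(1)
    by (simp add: Dx_eq_dd Dy_eq_dd dd_def[of _ _ "dd _ _ _"] pd_dd pdx_pdy_commute algebra_simps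
      add_divide_distrib diff_divide_distrib)
  then show ?thesis using assms by simp
qed

lemma pd_eq_wz: "pdx f z = wz f z + wzb f z" "pdy f z = \<i> * (wz f z - wzb f z)"
  by (simp_all add: wz_def wzb_def field_simps)

lemma dd_eq_wz: "dd a b f z = (a + \<i> * b) * wz f z + (a - \<i> * b) * wzb f z"
  by (simp add: dd_def pd_eq_wz algebra_simps)

lemma smooth_wz [intro]: "smooth f \<Longrightarrow> smooth (wz f)" and smooth_wzb [intro]: "smooth f \<Longrightarrow> smooth (wzb f)"
  by (auto simp: wz_eq_dd wzb_eq_dd)

lemma wz_wzb_zero_imp_constant:
  assumes f: "smooth f" and z: "\<And>z. wz f z = 0" "\<And>z. wzb f z = 0"
  shows "f z = f w"
proof -
  have "(f has_derivative (\<lambda>h. 0)) (at z)" for z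
    using smooth_has_derivative[OF f, of z] by (simp add: pd_eq_wz z)
  then have "\<exists>c. \<forall>x\<in>UNIV. f x = c" by (intro has_derivative_zero_constant) auto
  then show ?thesis by auto
qed

lemma wz_eq_Dx_Dy: "\<mu> \<noteq> 0 \<Longrightarrow> wz f z = (Dx \<mu> f z - \<i> * Dy \<mu> f z) / (2 * \<mu>)"
  and wzb_eq_Dx_Dy: "\<mu> \<noteq> 0 \<Longrightarrow> wzb f z = \<mu> * (Dx \<mu> f z + \<i> * Dy \<mu> f z) / 2"
  by (simp_all add: Dx_def Dy_def field_simps)

text \<open>The image is finite and connected. This fixes the determinant of an orthogonal frame
  and, later, the sign of the normal of a transform.\<close>

lemma sign_constant:
  fixes f :: "'a::topological_space \<Rightarrow> complex"
  assumes "continuous_on S f" "connected S" "\<And>z. z \<in> S \<Longrightarrow> f z = c \<or> f z = - c" "z \<in> S" "w \<in> S"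
  shows "f z = f w"
proof -
  have "f ` S \<subseteq> {c, -c}" using assms(3) by auto
  then have "finite (f ` S)" by (rule finite_subset) simp
  moreover have "connected (f ` S)" using assms connected_continuous_image by blast
  ultimately have "f ` S = {} \<or> (\<exists>x. f ` S = {x})" using connected_finite_iff_sing by blast
  then show ?thesis using assms(4,5) by (metis emptyE imageI singletonD)
qed

section \<open>Complex Euclidean 3-space\<close>

declare transpose_matrix_vector [simp del]

lemma vec3_eq_iff: "u = v \<longleftrightarrow> u $ 1 = v $ 1 \<and> u $ 2 = v $ 2 \<and> u $ 3 = v $ 3" for u v :: "'a^3"
  by (simp add: vec_eq_iff forall_3)

lemma matrix_mult_nth3: "(A ** B) $ i $ j = A $ i $ 1 * B $ 1 $ j + A $ i $ 2 * B $ 2 $ j + A $ i $ 3 * B $ 3 $ j"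
  for A B :: "complex^3^3"
  by (simp add: matrix_matrix_mult_def sum_3)

lemma matrix_vec_nth3: "(A *v u) $ i = A $ i $ 1 * u $ 1 + A $ i $ 2 * u $ 2 + A $ i $ 3 * u $ 3"
  for A :: "complex^3^3"
  by (simp add: matrix_vector_mult_def sum_3)

lemma transpose_nth: "transpose A $ i $ j = A $ j $ i"
  by (simp add: transpose_def)

lemma axis_nth3:
  "axis 1 x $ (1::3) = x" "axis 1 x $ (2::3) = 0" "axis 1 x $ (3::3) = 0"
  "axis 2 x $ (1::3) = 0" "axis 2 x $ (2::3) = x" "axis 2 x $ (3::3) = 0"
  "axis 3 x $ (1::3) = 0" "axis 3 x $ (2::3) = 0" "axis 3 x $ (3::3) = x"
  by (simp_all add: axis_def)

lemma mat_nth3: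
  "mat x $ (1::3) $ 1 = x" "mat x $ (1::3) $ 2 = 0" "mat x $ (1::3) $ 3 = 0"
  "mat x $ (2::3) $ 1 = 0" "mat x $ (2::3) $ 2 = x" "mat x $ (2::3) $ 3 = 0"
  "mat x $ (3::3) $ 1 = 0" "mat x $ (3::3) $ 2 = 0" "mat x $ (3::3) $ 3 = x"
  by (simp_all add: mat_def)

lemma cdot_3: "cdot u v = u $ 1 * v $ 1 + u $ 2 * v $ 2 + u $ 3 * v $ 3"
  by (simp add: cdot_def sum_3)

lemma xi_nth:
  "xi u $ 1 $ 1 = 0" "xi u $ 1 $ 2 = - u $ 3" "xi u $ 1 $ 3 = u $ 2"
  "xi u $ 2 $ 1 = u $ 3" "xi u $ 2 $ 2 = 0" "xi u $ 2 $ 3 = - u $ 1"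
  "xi u $ 3 $ 1 = - u $ 2" "xi u $ 3 $ 2 = u $ 1" "xi u $ 3 $ 3 = 0"
  by (simp_all add: xi_def matrix_def ccross_def axis_nth3)

lemmas mat3_simps = vec3_eq_iff matrix_mult_nth3 matrix_vec_nth3 transpose_nth axis_nth3 mat_nth3 xi_nth

lemma inj_xi: "inj xi"
  by (rule injI) (metis vec3_eq_iff xi_nth(3,4,8))

lemma inv_xi [simp]: "inv xi (xi u) = u"
  using inj_xi by (rule inv_f_f)

text \<open>\<open>inv xi\<close> is meaningful only on the range of \<open>xi\<close>; antisymmetry
  is what puts a matrix into that range.\<close>

lemma xi_inv_antisym:
  assumes "transpose A = - A"
  shows "xi (inv xi A) = A"
proof -
  have "A $ j $ i = - A $ i $ j" for i j
    using arg_cong[OF assms, of "\<lambda>M. M $ i $ j"] by (simp add: transpose_nth)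
  from this[of 1 1] this[of 2 2] this[of 3 3] this[of 1 2] this[of 1 3] this[of 2 3]
  have "A = xi (vector [A $ 3 $ 2, A $ 1 $ 3, A $ 2 $ 1])"
    by (simp add: mat3_simps vector_3)
  then show ?thesis using inv_xi by metis
qed

lemma transpose_xi: "transpose (xi u) = - xi u"
  by (simp add: mat3_simps)

lemma xi_add: "xi (u + v) = xi u + xi v"
  and xi_smult: "xi (c *s u) = scaleM c (xi u)"
  by (simp_all add: mat3_simps scaleM_def)

lemma kpart_xi: "kpart (xi u) = xi (vector [u $ 1, 0, 0])"
  and mpart_xi: "mpart (xi u) = xi (vector [0, u $ 2, u $ 3])"
  by (simp_all add: kpart_def mpart_def mat3_simps vector_3)

lemma SO3_transpose_mult: "A \<in> SO3 \<Longrightarrow> transpose A ** A = mat 1"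
  and SO3_mult_transpose: "A \<in> SO3 \<Longrightarrow> A ** transpose A = mat 1"
  by (auto simp: SO3_def orthogonal_matrix_def)

lemma SO3_transpose: "A \<in> SO3 \<Longrightarrow> transpose A \<in> SO3"
  by (auto simp: SO3_def orthogonal_matrix_def)

lemma SO3_mult: "A \<in> SO3 \<Longrightarrow> B \<in> SO3 \<Longrightarrow> A ** B \<in> SO3"
  unfolding SO3_def orthogonal_matrix_def mem_Collect_eq det_mul matrix_transpose_mul
  by (metis (no_types, lifting) matrix_mul_assoc matrix_mul_lid mult_1)

lemma SO3_matrix_inv: "A \<in> SO3 \<Longrightarrow> matrix_inv A = transpose A"
  unfolding matrix_inv_def
proof (rule some_equality)
  fix B assume "A \<in> SO3" "A ** B = mat 1 \<and> B ** A = mat 1"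
  then show "B = transpose A"
    by (metis SO3_transpose_mult matrix_mul_assoc matrix_mul_lid matrix_mul_rid)
qed (simp add: SO3_transpose_mult SO3_mult_transpose)

lemma SO3_cancel: 
  assumes "A \<in> SO3"
  shows "transpose A ** (A ** B) = B" "A ** (transpose A ** B) = B"
    "B ** A ** transpose A = B" "B ** transpose A ** A = B"
    "transpose A *v (A *v u) = u" "A *v (transpose A *v u) = u"
  using assms
  by (simp_all add: matrix_mul_assoc SO3_transpose_mult SO3_mult_transpose matrix_vector_mul_assoc)
     (simp_all add: matrix_mul_assoc[symmetric] SO3_transpose_mult SO3_mult_transpose)

lemma SO3I:
  assumes "transpose A ** A = mat 1" "det A = 1"
  shows "A \<in> SO3"
  using assms matrix_left_right_inverse[of "transpose A" A] by (simp add: SO3_def orthogonal_matrix_def)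

lemma cdot_SO3:
  assumes "A \<in> SO3" shows "cdot (A *v u) (A *v v) = cdot u v"
proof -
  have "cdot (A *v u) (A *v v) = cdot u (transpose A ** A *v v)"
    unfolding cdot_3 by (simp add: mat3_simps algebra_simps)
  then show ?thesis using assms by (simp add: SO3_transpose_mult)
qed

text \<open>For every matrix, transpose A ** xi (A *v u) ** A equals det A times xi u: pairing with
  two vectors, both sides are the triple product of their images under A. Orthogonality then moves A
  to the other side.\<close>

lemma xi_SO3:
  assumes "A \<in> SO3" shows "xi (A *v u) = A ** xi u ** transpose A"
proof -
  have "transpose A ** xi (A *v u) ** A = scaleM (det A) (xi u)"
    unfolding det_3 scaleM_def by (simp add: mat3_simps algebra_simps)
  also have "\<dots> = xi u" using assms by (simp add: SO3_def scaleM_def vec_eq_iff)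
  finally have "A ** (transpose A ** xi (A *v u) ** A) ** transpose A = A ** xi u ** transpose A" by simp
  then show ?thesis using assms by (simp add: matrix_mul_assoc SO3_cancel SO3_mult_transpose)
qed

section \<open>Derivatives of vectors and matrices\<close>

definition vdd :: "complex \<Rightarrow> complex \<Rightarrow> (complex \<Rightarrow> complex^3) \<Rightarrow> complex \<Rightarrow> complex^3" where
  "vdd a b F z = (\<chi> i. dd a b (\<lambda>w. F w $ i) z)"

definition mdd :: "complex \<Rightarrow> complex \<Rightarrow> (complex \<Rightarrow> complex^3^3) \<Rightarrow> complex \<Rightarrow> complex^3^3" where
  "mdd a b M z = (\<chi> i j. dd a b (\<lambda>w. M w $ i $ j) z)"

definition mDx :: "complex \<Rightarrow> (complex \<Rightarrow> complex^3^3) \<Rightarrow> complex \<Rightarrow> complex^3^3" where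
  "mDx \<mu> = mdd ((\<mu> + inverse \<mu>) / 2) (\<i> * (inverse \<mu> - \<mu>) / 2)"

definition mDy :: "complex \<Rightarrow> (complex \<Rightarrow> complex^3^3) \<Rightarrow> complex \<Rightarrow> complex^3^3" where
  "mDy \<mu> = mdd (\<i> * (\<mu> - inverse \<mu>) / 2) ((\<mu> + inverse \<mu>) / 2)"

lemma mwz_eq_mdd: "mwz = mdd (1/2) (- \<i> / 2)" and mwzb_eq_mdd: "mwzb = mdd (1/2) (\<i> / 2)"
  by (simp_all add: fun_eq_iff mwz_def mwzb_def mdd_def wz_eq_dd wzb_eq_dd)

lemma vDx_eq_vdd: "vDx \<mu> = vdd ((\<mu> + inverse \<mu>) / 2) (\<i> * (inverse \<mu> - \<mu>) / 2)"
  and vDy_eq_vdd: "vDy \<mu> = vdd (\<i> * (\<mu> - inverse \<mu>) / 2) ((\<mu> + inverse \<mu>) / 2)"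
  by (simp_all add: fun_eq_iff vDx_def vDy_def vdd_def Dx_eq_dd Dy_eq_dd)

lemma smooth_mat: "(\<And>i j. smooth (\<lambda>z. M z $ i $ j)) \<Longrightarrow> smooth M"
  for M :: "complex \<Rightarrow> complex^'n^'m"
  by (intro smooth_vec)

lemma smooth_mat_nth: "smooth M \<Longrightarrow> smooth (\<lambda>z. M z $ i $ j)"
  for M :: "complex \<Rightarrow> complex^'n^'m"
  by (intro smooth_nth)

lemma smooth_matrix_mult: "smooth M \<Longrightarrow> smooth N \<Longrightarrow> smooth (\<lambda>z. M z ** N z)"
  for M N :: "complex \<Rightarrow> complex^3^3"
  by (intro smooth_mat) (auto simp: matrix_mult_nth3 intro!: smooth_add smooth_mult smooth_mat_nth)

lemma smooth_matrix_vec: "smooth M \<Longrightarrow> smooth v \<Longrightarrow> smooth (\<lambda>z. M z *v v z)"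
  for M :: "complex \<Rightarrow> complex^3^3"
  by (intro smooth_vec) (auto simp: matrix_vec_nth3 intro!: smooth_add smooth_mult smooth_mat_nth smooth_nth)

lemma smooth_transpose: "smooth M \<Longrightarrow> smooth (\<lambda>z. transpose (M z))"
  for M :: "complex \<Rightarrow> complex^3^3"
  by (intro smooth_mat) (auto simp: transpose_nth intro!: smooth_mat_nth)

lemma smooth_smult: "smooth f \<Longrightarrow> smooth v \<Longrightarrow> smooth (\<lambda>z. f z *s v z)"
  for v :: "complex \<Rightarrow> complex^3"
  by (intro smooth_vec) (auto intro!: smooth_mult smooth_nth)

lemma smooth_vector3: "smooth f \<Longrightarrow> smooth g \<Longrightarrow> smooth h \<Longrightarrow> smooth (\<lambda>z. vector [f z, g z, h z] :: complex^3)"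
proof (rule smooth_vec)
  fix i :: 3 assume "smooth f" "smooth g" "smooth h"
  then show "smooth (\<lambda>z. (vector [f z, g z, h z] :: complex^3) $ i)"
    using exhaust_3[of i] by (elim disjE) (simp_all add: vector_3)
qed

lemma smooth_xi: "smooth v \<Longrightarrow> smooth (\<lambda>z. xi (v z))"
proof (rule smooth_mat)
  fix i j :: 3 assume v: "smooth v"
  show "smooth (\<lambda>z. xi (v z) $ i $ j)"
    using exhaust_3[of i] exhaust_3[of j]
    by (elim disjE) (simp_all add: xi_nth smooth_uminus smooth_nth[OF v])
qed

lemma smooth_vdd: "smooth F \<Longrightarrow> smooth (vdd a b F)"
  by (rule smooth_vec) (auto simp: vdd_def smooth_dd[OF smooth_nth])

lemma vdd_const [simp]: "vdd a b (\<lambda>z. c) z = 0" and mdd_const [simp]: "mdd a b (\<lambda>z. M) z = 0"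
  by (simp_all add: vdd_def mdd_def vec_eq_iff)

lemma vdd_add: "smooth F \<Longrightarrow> smooth G \<Longrightarrow> vdd a b (\<lambda>z. F z + G z) z = vdd a b F z + vdd a b G z"
  by (simp add: vdd_def vec_eq_iff dd_add smooth_nth)

lemma vdd_diff: "smooth F \<Longrightarrow> smooth G \<Longrightarrow> vdd a b (\<lambda>z. F z - G z) z = vdd a b F z - vdd a b G z"
  by (simp add: vdd_def vec_eq_iff dd_diff smooth_nth)

lemma vdd_smult: "smooth f \<Longrightarrow> smooth F \<Longrightarrow>
    vdd a b (\<lambda>z. f z *s F z) z = dd a b f z *s F z + f z *s vdd a b F z"
  by (simp add: vdd_def vec_eq_iff dd_mult smooth_nth)

lemma vdd_vector3: "vdd a b (\<lambda>z. vector [f z, g z, h z]) z = vector [dd a b f z, dd a b g z, dd a b h z]"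
  by (simp add: vdd_def vec3_eq_iff vector_3)

lemma mdd_mult: "smooth M \<Longrightarrow> smooth N \<Longrightarrow>
    mdd a b (\<lambda>z. M z ** N z) z = mdd a b M z ** N z + M z ** mdd a b N z"
  by (simp add: mdd_def vec_eq_iff matrix_mult_nth3 dd_add dd_mult smooth_mat_nth smooth_add smooth_mult)

lemma mdd_transpose: "mdd a b (\<lambda>z. transpose (M z)) z = transpose (mdd a b M z)"
  by (simp add: mdd_def vec_eq_iff transpose_nth)

lemma vdd_matrix_vec: "smooth M \<Longrightarrow> smooth v \<Longrightarrow>
    vdd a b (\<lambda>z. M z *v v z) z = mdd a b M z *v v z + M z *v vdd a b v z"
  by (simp add: mdd_def vdd_def vec_eq_iff matrix_vec_nth3 dd_add dd_mult smooth_mat_nth smooth_nth smooth_add smooth_mult)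

lemma dd_cdot: "smooth u \<Longrightarrow> smooth v \<Longrightarrow>
    dd a b (\<lambda>z. cdot (u z) (v z)) z = cdot (vdd a b u z) (v z) + cdot (u z) (vdd a b v z)"
  by (simp add: cdot_3 vdd_def dd_add dd_mult smooth_nth smooth_add smooth_mult)

lemma vdd_commute: "smooth F \<Longrightarrow> vdd a b (vdd c d F) z = vdd c d (vdd a b F) z"
  by (simp add: vdd_def vec_eq_iff dd_commute[OF smooth_nth])

lemma mdd_eq_mwz: "mdd a b M z = scaleM (a + \<i> * b) (mwz M z) + scaleM (a - \<i> * b) (mwzb M z)"
  by (simp add: mdd_def scaleM_def mwz_def mwzb_def vec_eq_iff dd_eq_wz)

lemma mdd_zero_imp_constant:
  assumes "smooth M" "\<And>z. mwz M z = 0" "\<And>z. mwzb M z = 0"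
  shows "M z = M w"
proof -
  have "M z $ i $ j = M w $ i $ j" for i j
    by (rule wz_wzb_zero_imp_constant[where f="\<lambda>z. M z $ i $ j"])
       (use assms in \<open>auto simp: mwz_def mwzb_def vec_eq_iff smooth_mat_nth\<close>)
  then show ?thesis by (simp add: vec_eq_iff)
qed

text \<open>Differentiating transpose M ** M = mat 1 shows that the Maurer-Cartan form of M is
  antisymmetric.\<close>

lemma SO3_mdd_antisym:
  assumes "smooth M" "\<And>z. M z \<in> SO3"
  obtains u where "mdd a b M z = M z ** xi u"
proof -
  have "mdd a b (\<lambda>z. transpose (M z) ** M z) z = 0"
    using assms by (simp add: SO3_transpose_mult)
  then have "transpose (mdd a b M z) ** M z + transpose (M z) ** mdd a b M z = 0"
    using assms by (simp add: mdd_mult smooth_transpose mdd_transpose)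
  then have "transpose (transpose (M z) ** mdd a b M z) = - (transpose (M z) ** mdd a b M z)"
    by (simp add: matrix_transpose_mul eq_neg_iff_add_eq_0)
  then have "xi (inv xi (transpose (M z) ** mdd a b M z)) = transpose (M z) ** mdd a b M z"
    by (rule xi_inv_antisym)
  then have "mdd a b M z = M z ** xi (inv xi (transpose (M z) ** mdd a b M z))"
    using assms by (simp add: SO3_cancel)
  then show ?thesis by (rule that)
qed

text \<open>H ** transpose G has derivative zero when G and H have the same Maurer-Cartan
  form.\<close>

lemma SO3_congruent:
  assumes G: "smooth G" "\<And>z. G z \<in> SO3" "\<And>z. mwz G z = G z ** xi (u z)" "\<And>z. mwzb G z = G z ** xi (v z)"
    and H: "smooth H" "\<And>z. H z \<in> SO3" "\<And>z. mwz H z = H z ** xi (u z)" "\<And>z. mwzb H z = H z ** xi (v z)"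
  obtains C where "C \<in> SO3" "\<And>z. H z = C ** G z"
proof -
  define C where "C z = H z ** transpose (G z)" for z
  have d: "mdd a b C z = mdd a b H z ** transpose (G z) + H z ** transpose (mdd a b G z)" for a b z
    unfolding C_def using G H by (simp add: mdd_mult smooth_transpose mdd_transpose)
  have *: "H z ** xi w ** transpose (G z) + H z ** transpose (G z ** xi w) = 0" for w z
    unfolding matrix_transpose_mul transpose_xi by (simp add: mat3_simps algebra_simps)
  have "mwz C z = 0" "mwzb C z = 0" for z
    using d[of "1/2" "-\<i>/2" z] d[of "1/2" "\<i>/2" z] G(3,4)[of z] H(3,4)[of z] *
    by (simp_all add: mwz_eq_mdd mwzb_eq_mdd)
  moreover have "smooth C" unfolding C_def using G H by (intro smooth_matrix_mult smooth_transpose)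
  ultimately have const: "C z = C 0" for z by (intro mdd_zero_imp_constant)
  have "C 0 \<in> SO3" unfolding C_def using G H by (intro SO3_mult SO3_transpose)
  moreover have "H z = C 0 ** G z" for z
    using const[of z] SO3_cancel(4)[OF G(2), of "H z" z] by (simp add: C_def)
  ultimately show ?thesis by (rule that)
qed

section \<open>Linear differential equations with parameters\<close>

text \<open>The majorant M makes the series of derivatives converge uniformly, which is what
  termwise differentiation requires.\<close>

lemma has_vector_derivative_suminf:
  fixes f :: "nat \<Rightarrow> real \<Rightarrow> 'e::banach"
  assumes "convex S" "\<And>n x. x \<in> S \<Longrightarrow> (f n has_vector_derivative f' n x) (at x within S)"
    and M: "\<And>n x. x \<in> S \<Longrightarrow> norm (f' n x) \<le> M n" "summable M"
    and s: "\<And>x. x \<in> S \<Longrightarrow> summable (\<lambda>n. f n x)" and x: "x \<in> S"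
  shows "((\<lambda>x. \<Sum>n. f n x) has_vector_derivative (\<Sum>n. f' n x)) (at x within S)"
proof -
  have ul: "uniform_limit S (\<lambda>n x. \<Sum>i<n. f' i x) (\<lambda>x. \<Sum>i. f' i x) sequentially"
    by (rule Weierstrass_m_test) (use M in auto)
  have "\<exists>g. \<forall>x\<in>S. (\<lambda>n. f n x) sums g x \<and> (g has_derivative (\<lambda>h. h *\<^sub>R (\<Sum>n. f' n x))) (at x within S)"
  proof (rule has_derivative_series[where f'="\<lambda>n x h. h *\<^sub>R f' n x"])
    fix e :: real assume "e > 0"
    then have "\<forall>\<^sub>F n in sequentially. \<forall>x\<in>S. dist (\<Sum>i<n. f' i x) (\<Sum>i. f' i x) < e"
      using ul by (auto simp: uniform_limit_iff)
    then show "\<forall>\<^sub>F n in sequentially. \<forall>x\<in>S. \<forall>h. norm ((\<Sum>i<n. h *\<^sub>R f' i x) - h *\<^sub>R (\<Sum>i. f' i x)) \<le> e * norm h"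
    proof eventually_elim
      case (elim n)
      show ?case
      proof (intro ballI allI)
        fix x and h :: real assume "x \<in> S"
        then have "\<bar>h\<bar> * norm ((\<Sum>i<n. f' i x) - (\<Sum>i. f' i x)) \<le> \<bar>h\<bar> * e"
          using elim by (intro mult_left_mono) (auto simp: dist_norm less_imp_le)
        then show "norm ((\<Sum>i<n. h *\<^sub>R f' i x) - h *\<^sub>R (\<Sum>i. f' i x)) \<le> e * norm h"
          by (simp add: scaleR_sum_right[symmetric] scaleR_diff_right[symmetric] mult.commute)
      qed
    qed
  next
    show "(\<lambda>n. f n x) sums (\<Sum>n. f n x)" using s[OF x] by (rule summable_sums)
  qed (use assms(1,2) x in \<open>auto simp: has_vector_derivative_def\<close>)
  then obtain g where g: "\<And>x. x \<in> S \<Longrightarrow> (\<lambda>n. f n x) sums g x"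
    "\<And>x. x \<in> S \<Longrightarrow> (g has_derivative (\<lambda>h. h *\<^sub>R (\<Sum>n. f' n x))) (at x within S)" by blast
  have "(g has_vector_derivative (\<Sum>n. f' n x)) (at x within S)"
    using g(2)[OF x] by (simp add: has_vector_derivative_def)
  then show ?thesis
    by (rule has_vector_derivative_transform[rotated 2]) (use x g(1) in \<open>auto simp: sums_iff\<close>)
qed

text \<open>
  Picard iteration for \<open>u' = m u (a p t)\<close>, \<open>u 0 = u0\<close> on the unit interval, depending on a
  parameter \<open>p\<close>.  The integral over \<open>{0..t}\<close> is written over \<open>{0..1}\<close> to keep its domain fixed.
\<close>

primrec picard :: "('e::banach \<Rightarrow> 'f \<Rightarrow> 'e) \<Rightarrow> ('p \<Rightarrow> real \<Rightarrow> 'f) \<Rightarrow> 'e \<Rightarrow> nat \<Rightarrow> 'p \<Rightarrow> real \<Rightarrow> 'e" where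
  "picard m a u0 0 p t = u0"
| "picard m a u0 (Suc n) p t =
     t *\<^sub>R integral {0..1} (\<lambda>s. m (picard m a u0 n p (t * s)) (a p (t * s)))"

definition lin_sol :: "('e::banach \<Rightarrow> 'f \<Rightarrow> 'e) \<Rightarrow> ('p \<Rightarrow> real \<Rightarrow> 'f) \<Rightarrow> 'e \<Rightarrow> 'p \<Rightarrow> real \<Rightarrow> 'e" where
  "lin_sol m a u0 p t = (\<Sum>n. picard m a u0 n p t)"

text \<open>The parameter space is Euclidean so that a point of the open set D has a compact ball
  around it in D; uniform convergence of the iteration is available on compact sets of
  parameters.\<close>

locale linear_ode = bounded_bilinear prod
  for prod :: "'e::banach \<Rightarrow> 'f::real_normed_vector \<Rightarrow> 'e" +
  fixes a :: "'p::euclidean_space \<Rightarrow> real \<Rightarrow> 'f" and u0 :: 'e and D :: "'p set"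
  assumes cont: "continuous_on (D \<times> {0..1}) (\<lambda>(p, t). a p t)" and D: "open D"
begin

abbreviation "pic \<equiv> picard prod a u0"
abbreviation "sol \<equiv> lin_sol prod a u0"

lemma continuous_on_integrand:
  assumes "continuous_on (D \<times> {0..1}) (\<lambda>(p, t). f p t)"
  shows "continuous_on ((D \<times> {0..1}) \<times> cbox 0 1) (\<lambda>(x, s). prod (f (fst x) (snd x * s)) (a (fst x) (snd x * s)))"
proof -
  have "continuous_on ((D \<times> {0..1}) \<times> cbox 0 1) (\<lambda>x. f (fst (fst x)) (snd (fst x) * snd x))"
    by (rule continuous_on_compose2[OF assms, of _ "\<lambda>x. (fst (fst x), snd (fst x) * snd x)", simplified])
       (auto intro!: continuous_intros mult_le_one)
  moreover have "continuous_on ((D \<times> {0..1}) \<times> cbox 0 1) (\<lambda>x. a (fst (fst x)) (snd (fst x) * snd x))"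
    by (rule continuous_on_compose2[OF cont, of _ "\<lambda>x. (fst (fst x), snd (fst x) * snd x)", simplified])
       (auto intro!: continuous_intros mult_le_one)
  ultimately show ?thesis
    by (auto simp: split_beta intro!: continuous_on)
qed

lemma continuous_on_pic: "continuous_on (D \<times> {0..1}) (\<lambda>(p, t). pic n p t)"
proof (induction n)
  case (Suc n)
  have "continuous_on (D \<times> {0..1}) (\<lambda>x. integral (cbox 0 1)
      (\<lambda>s. prod (pic n (fst x) (snd x * s)) (a (fst x) (snd x * s))))"
    by (rule integral_continuous_on_param[OF continuous_on_integrand[OF Suc]])
  then show ?case by (auto simp: split_beta intro!: continuous_intros)
qed simp

lemma continuous_on_pic': "p \<in> D \<Longrightarrow> continuous_on {0..1} (pic n p)"
  by (rule continuous_on_compose2[OF continuous_on_pic[of n], of "{0..1}" "\<lambda>t. (p, t)", simplified])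
     (auto intro!: continuous_intros)

lemma continuous_on_a: "p \<in> D \<Longrightarrow> continuous_on {0..1} (a p)"
  by (rule continuous_on_compose2[OF cont, of "{0..1}" "\<lambda>t. (p, t)", simplified])
     (auto intro!: continuous_intros)

lemma continuous_on_scaled:
  fixes g :: "real \<Rightarrow> 'c::topological_space"
  assumes "continuous_on {0..1} g" "t \<in> {0..1}"
  shows "continuous_on {0..1} (\<lambda>s. g (t * s))"
proof (rule continuous_on_compose2[OF assms(1)])
  show "continuous_on {0..1} (\<lambda>s. t * s)" by (intro continuous_intros)
  show "(\<lambda>s. t * s) ` {0..1} \<subseteq> {0..1}"
    using assms(2) by (auto intro: mult_nonneg_nonneg mult_le_one)
qed

lemma integrand_integrable:
  assumes "p \<in> D" "t \<in> {0..1}"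
  shows "(\<lambda>s. prod (pic n p (t * s)) (a p (t * s))) integrable_on {0..1}"
  using assms
  by (intro integrable_continuous_interval continuous_on)
     (auto intro!: continuous_on_scaled[OF continuous_on_pic'] continuous_on_scaled[OF continuous_on_a])

text \<open>C bounds multiplication by the coefficient over the compact set. Each iteration
  integrates a power of s and so contributes one factor of the factorial.\<close>

lemma pic_bound:
  assumes "K \<subseteq> D" "compact K"
  obtains C where "C \<ge> 0" "\<And>n p t. p \<in> K \<Longrightarrow> t \<in> {0..1} \<Longrightarrow> norm (pic n p t) \<le> norm u0 * (C * t) ^ n / fact n"
    "\<And>p t x. p \<in> K \<Longrightarrow> t \<in> {0..1} \<Longrightarrow> norm (prod x (a p t)) \<le> C * norm x"
proof -
  have "compact ((\<lambda>(p, t). a p t) ` (K \<times> {0..1}))"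
    by (rule compact_continuous_image[OF continuous_on_subset[OF cont]]) (use assms in \<open>auto intro: compact_Times\<close>)
  then have "bounded ((\<lambda>(p, t). a p t) ` (K \<times> {0..1}))" by (rule compact_imp_bounded)
  then obtain A where A: "A > 0" "\<And>p t. p \<in> K \<Longrightarrow> t \<in> {0..1} \<Longrightarrow> norm (a p t) \<le> A"
    unfolding bounded_pos by fastforce
  obtain B where B: "B > 0" "\<And>x y. norm (prod x y) \<le> norm x * norm y * B"
    using pos_bounded by blast
  define C where "C = A * B"
  have C: "norm (prod x (a p t)) \<le> C * norm x" if "p \<in> K" "t \<in> {0..1}" for p t x
  proof -
    have "norm (prod x (a p t)) \<le> norm x * norm (a p t) * B" by (rule B)
    also have "\<dots> \<le> norm x * A * B" using A that B by (intro mult_mono) auto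
    finally show ?thesis by (simp add: C_def mult_ac)
  qed
  have C0: "C \<ge> 0" using A B by (simp add: C_def)
  have "norm (pic n p t) \<le> norm u0 * (C * t) ^ n / fact n" if "p \<in> K" "t \<in> {0..1}" for n p t
    using that
  proof (induction n arbitrary: t)
    case (Suc n)
    define k where "k = C * norm u0 * (C * t) ^ n / fact n"
    have "((\<lambda>s. s ^ n) has_integral (1 ^ Suc n / real (Suc n) - 0 ^ Suc n / real (Suc n))) {0..1::real}"
      by (rule fundamental_theorem_of_calculus)
         (auto intro!: derivative_eq_intros simp: has_real_derivative_iff_has_vector_derivative[symmetric] field_simps
            simp del: of_nat_Suc power_Suc)
    then have I: "((\<lambda>s. k * s ^ n) has_integral (k / real (Suc n))) {0..1::real}"
      using has_integral_mult_right[of "\<lambda>s. s ^ n" "1 / real (Suc n)" "{0..1}" k] by simp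
    have "norm (integral {0..1} (\<lambda>s. prod (pic n p (t * s)) (a p (t * s)))) \<le> integral {0..1} (\<lambda>s. k * s ^ n)"
    proof (rule integral_norm_bound_integral)
      show "(\<lambda>s. prod (pic n p (t * s)) (a p (t * s))) integrable_on {0..1}"
        using Suc.prems assms by (intro integrand_integrable) auto
      show "(\<lambda>s. k * s ^ n) integrable_on {0..1}" using I by blast
      fix s :: real assume s: "s \<in> {0..1}"
      then have ts: "t * s \<in> {0..1}" using Suc.prems by (auto intro: mult_le_one)
      have "norm (prod (pic n p (t * s)) (a p (t * s))) \<le> C * norm (pic n p (t * s))"
        using C Suc.prems ts by blast
      also have "\<dots> \<le> C * (norm u0 * (C * (t * s)) ^ n / fact n)"
        using Suc.IH[OF Suc.prems(1) ts] C0 by (intro mult_left_mono)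
      finally show "norm (prod (pic n p (t * s)) (a p (t * s))) \<le> k * s ^ n"
        by (simp add: k_def power_mult_distrib mult_ac)
    qed
    also have "\<dots> = k / real (Suc n)" using I by (rule integral_unique)
    finally have "t * norm (integral {0..1} (\<lambda>s. prod (pic n p (t * s)) (a p (t * s)))) \<le> t * (k / real (Suc n))"
      by (rule mult_left_mono) (use Suc.prems in auto)
    then have "norm (pic (Suc n) p t) \<le> t * (k / real (Suc n))"
      using Suc.prems by simp
    then show ?case by (simp add: k_def mult_ac)
  qed simp
  with C C0 that show ?thesis by blast
qed

lemma summable_bound: "summable (\<lambda>n. c * C ^ n / fact n :: real)"
  using summable_mult[OF summable_exp, of c C] by (simp add: field_simps)

text \<open>Putting t = 1 in the factorial estimate gives a majorant that is uniform in t as well,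
  as the Weierstrass test needs.\<close>

lemma pic_bound':
  assumes "K \<subseteq> D" "compact K"
  obtains C M where "C \<ge> 0" "summable M" "\<And>n p t. p \<in> K \<Longrightarrow> t \<in> {0..1} \<Longrightarrow> norm (pic n p t) \<le> M n"
    "\<And>p t x. p \<in> K \<Longrightarrow> t \<in> {0..1} \<Longrightarrow> norm (prod x (a p t)) \<le> C * norm x"
proof -
  obtain C where C: "C \<ge> 0" "\<And>n p t. p \<in> K \<Longrightarrow> t \<in> {0..1} \<Longrightarrow> norm (pic n p t) \<le> norm u0 * (C * t) ^ n / fact n"
    "\<And>p t x. p \<in> K \<Longrightarrow> t \<in> {0..1} \<Longrightarrow> norm (prod x (a p t)) \<le> C * norm x"
    using pic_bound[OF assms] by blast
  have "norm (pic n p t) \<le> norm u0 * C ^ n / fact n" if "p \<in> K" "t \<in> {0..1}" for n p t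
  proof -
    have "(C * t) ^ n \<le> C ^ n" using C(1) that(2) by (intro power_mono) (auto simp: mult_left_le)
    then have "norm u0 * (C * t) ^ n / fact n \<le> norm u0 * C ^ n / fact n"
      by (intro divide_right_mono mult_left_mono) auto
    with C(2)[OF that] show ?thesis by (rule order_trans)
  qed
  then show ?thesis using that[OF C(1) summable_bound _ C(3)] by blast
qed

lemma summable_pic:
  assumes "p \<in> D" "t \<in> {0..1}"
  shows "summable (\<lambda>n. pic n p t)"
proof -
  have "{p} \<subseteq> D" "compact {p}" using assms by auto
  then obtain M where M: "summable M" "\<And>n p' t. p' \<in> {p} \<Longrightarrow> t \<in> {0..1} \<Longrightarrow> norm (pic n p' t) \<le> M n"
    by (rule pic_bound') (rule that)
  show ?thesis
    by (rule summable_comparison_test'[OF M(1), of 0]) (use M(2)[of p t] assms(2) in simp)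
qed

lemma uniform_limit_sol:
  assumes "K \<subseteq> D" "compact K"
  shows "uniform_limit (K \<times> {0..1}) (\<lambda>N (p, t). \<Sum>n<N. pic n p t) (\<lambda>(p, t). sol p t) sequentially"
proof -
  obtain M where "summable M" "\<And>n p t. p \<in> K \<Longrightarrow> t \<in> {0..1} \<Longrightarrow> norm (pic n p t) \<le> M n"
    by (rule pic_bound'[OF assms]) (rule that)
  then have "uniform_limit (K \<times> {0..1}) (\<lambda>N x. \<Sum>n<N. pic n (fst x) (snd x)) (\<lambda>x. \<Sum>n. pic n (fst x) (snd x)) sequentially"
    by (intro Weierstrass_m_test[of _ _ M]) auto
  then show ?thesis by (simp add: lin_sol_def case_prod_unfold)
qed

lemma continuous_on_sol: "continuous_on (D \<times> {0..1}) (\<lambda>(p, t). sol p t)"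
proof (rule continuous_on_eq_continuous_within[THEN iffD2, rule_format])
  fix x assume x: "x \<in> D \<times> {0..1::real}"
  then obtain e where e: "e > 0" "cball (fst x) e \<subseteq> D" using D open_contains_cball by (metis SigmaE fst_conv)
  have "continuous_on (cball (fst x) e \<times> {0..1}) (\<lambda>(p, t). sol p t)"
  proof (rule uniform_limit_theorem[OF _ uniform_limit_sol])
    show "\<forall>\<^sub>F N in sequentially. continuous_on (cball (fst x) e \<times> {0..1}) (\<lambda>(p, t). \<Sum>n<N. pic n p t)"
    proof (intro always_eventually allI)
      show "continuous_on (cball (fst x) e \<times> {0..1}) (\<lambda>(p, t). \<Sum>n<N. pic n p t)" for N
        unfolding split_beta
        using continuous_on_subset[OF continuous_on_pic, of "cball (fst x) e \<times> {0..1}"] e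
        by (intro continuous_on_sum) (auto simp: split_beta)
    qed
  qed (use e in auto)
  moreover have "x \<in> cball (fst x) e \<times> {0..1}" using x e by (auto simp: mem_Times_iff)
  ultimately have "continuous (at x within cball (fst x) e \<times> {0..1}) (\<lambda>(p, t). sol p t)"
    using continuous_on_eq_continuous_within by blast
  \<comment> \<open>Continuity is a local property, and near x the two domains agree.\<close>
  moreover have "at x within cball (fst x) e \<times> {0..1} = at x within D \<times> {0..1}"
  proof (rule at_within_nhd[of x "ball (fst x) e \<times> UNIV"])
    show "cball (fst x) e \<times> {0..1} \<inter> ball (fst x) e \<times> UNIV - {x} = D \<times> {0..1} \<inter> ball (fst x) e \<times> UNIV - {x}"
      using e(2) by auto
  qed (use e in \<open>auto simp: mem_Times_iff open_Times\<close>)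
  ultimately show "continuous (at x within D \<times> {0..1}) (\<lambda>(p, t). sol p t)" by simp
qed

lemma sol_0: "sol p 0 = u0"
proof -
  have "pic n p 0 = (if n = 0 then u0 else 0)" for n by (cases n) auto
  then show ?thesis
    unfolding lin_sol_def using sums_unique[OF sums_single[of 0 "\<lambda>_. u0"]] by simp
qed

text \<open>Stretching the fixed domain {0..1} back to {0..t} turns the iterate into an ordinary
  indefinite integral. The stretching needs t > 0; at t = 0 both sides vanish.\<close>

lemma pic_Suc_derivative:
  assumes "p \<in> D" "t \<in> {0..1}"
  shows "(pic (Suc n) p has_vector_derivative prod (pic n p t) (a p t)) (at t within {0..1})"
proof -
  let ?g = "\<lambda>s. prod (pic n p s) (a p s)"
  have g: "continuous_on {0..1} ?g"
    using assms by (intro continuous_on continuous_on_pic' continuous_on_a)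
  have eq: "pic (Suc n) p t = integral {0..t} ?g" if t: "t \<in> {0..1}" for t
  proof (cases "t = 0")
    case False
    then have "t > 0" using t by auto
    have "?g integrable_on {0..t}"
      using t by (intro integrable_continuous_interval continuous_on_subset[OF g]) auto
    then have "integral ((\<lambda>x. x / t) ` {0..t}) (\<lambda>x. ?g (t * x)) = (1 / \<bar>t\<bar>) *\<^sub>R integral {0..t} ?g"
      using integral_stretch_real[of t 0 t ?g] \<open>t > 0\<close> by simp
    moreover have "(\<lambda>x. x / t) ` {0..t} = {0..1}"
      using \<open>t > 0\<close> by (auto simp: image_iff intro!: bexI[of _ "t * _"])
    ultimately show ?thesis using \<open>t > 0\<close> by simp
  qed simp
  have "((\<lambda>t. integral {0..t} ?g) has_vector_derivative ?g t) (at t within {0..1})"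
    using g assms by (intro integral_has_vector_derivative)
  then show ?thesis
    by (rule has_vector_derivative_transform[rotated 2]) (use eq assms in auto)
qed

lemma sol_ode:
  assumes "p \<in> D" "t \<in> {0..1}"
  shows "(sol p has_vector_derivative prod (sol p t) (a p t)) (at t within {0..1})"
proof -
  \<comment> \<open>The derivative of an iterate involves the preceding one, hence the shift of the
    index; the initial iterate is constant.\<close>
  define f' where "f' n t = (case n of 0 \<Rightarrow> 0 | Suc m \<Rightarrow> prod (pic m p t) (a p t))" for n t
  have p: "{p} \<subseteq> D" "compact {p}" using assms by auto
  obtain C M where C: "C \<ge> 0" "summable M" "\<And>n p' t. p' \<in> {p} \<Longrightarrow> t \<in> {0..1} \<Longrightarrow> norm (pic n p' t) \<le> M n"
    "\<And>p' t x. p' \<in> {p} \<Longrightarrow> t \<in> {0..1} \<Longrightarrow> norm (prod x (a p' t)) \<le> C * norm x"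
    by (rule pic_bound'[OF p]) (rule that)
  have "((\<lambda>t. \<Sum>n. pic n p t) has_vector_derivative (\<Sum>n. f' n t)) (at t within {0..1})"
  proof (rule has_vector_derivative_suminf[where M="\<lambda>n. case n of 0 \<Rightarrow> 0 | Suc m \<Rightarrow> C * M m"])
    show "(pic n p has_vector_derivative f' n t) (at t within {0..1})" if "t \<in> {0..1}" for n t
    proof (cases n)
      case 0
      have "pic 0 p = (\<lambda>t. u0)" by (rule ext) simp
      then show ?thesis by (simp add: 0 f'_def)
    next
      case (Suc m)
      then show ?thesis using pic_Suc_derivative[OF assms(1) that, of m] by (simp add: f'_def del: picard.simps)
    qed
    show "norm (f' n t) \<le> (case n of 0 \<Rightarrow> 0 | Suc m \<Rightarrow> C * M m)" if t: "t \<in> {0..1}" for n t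
    proof (cases n)
      case (Suc m)
      have "norm (prod (pic m p t) (a p t)) \<le> C * norm (pic m p t)" using C t by auto
      also have "\<dots> \<le> C * M m" using C t by (intro mult_left_mono) auto
      finally show ?thesis using Suc by (simp add: f'_def)
    qed (simp add: f'_def)
    have "summable (\<lambda>n. C * M n)" using C by (intro summable_mult)
    then show "summable (\<lambda>n. case n of 0 \<Rightarrow> 0 | Suc m \<Rightarrow> C * M m)"
      using summable_Suc_iff[of "\<lambda>n. case n of 0 \<Rightarrow> 0 | Suc m \<Rightarrow> C * M m"] by simp
  qed (use assms summable_pic in auto)
  moreover have "(\<Sum>n. f' n t) = prod (sol p t) (a p t)"
  proof -
    have s: "(\<lambda>n. prod (pic n p t) (a p t)) sums prod (sol p t) (a p t)"
      unfolding lin_sol_def using summable_pic[OF assms]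
      by (intro bounded_linear.sums[OF bounded_linear_left] summable_sums)
    have "(\<lambda>n. f' n t) sums (prod (sol p t) (a p t) + f' 0 t)"
      using s by (intro sums_Suc) (simp add: f'_def)
    then show ?thesis by (simp add: sums_iff f'_def)
  qed
  ultimately show ?thesis by (simp add: lin_sol_def[abs_def])
qed

end

text \<open>
  Differentiation with respect to the parameter: the derivative of the solution is the second
  component of the solution of the same equation over the dual numbers.
\<close>

definition dual_mult :: "('e \<Rightarrow> 'f \<Rightarrow> 'e) \<Rightarrow> 'e::real_normed_vector \<times> 'e \<Rightarrow> 'f \<times> 'f \<Rightarrow> 'e \<times> 'e" where
  "dual_mult m = (\<lambda>u x. (m (fst u) (fst x), m (fst u) (snd x) + m (snd u) (fst x)))"

lemma snd_dual_mult: "snd (dual_mult m u x) = m (fst u) (snd x) + m (snd u) (fst x)"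
  by (simp_all add: dual_mult_def)

lemma bounded_bilinear_dual_mult:
  fixes m :: "'e::real_normed_vector \<Rightarrow> 'f::real_normed_vector \<Rightarrow> 'e"
  assumes "bounded_bilinear m"
  shows "bounded_bilinear (dual_mult m)"
proof -
  interpret bounded_bilinear m by fact
  show ?thesis
proof
  obtain B where B: "B > 0" "\<And>x y. norm (m x y) \<le> norm x * norm y * B"
    using pos_bounded by blast
  show "\<exists>K. \<forall>u x. norm (dual_mult m u x) \<le> norm u * norm x * K"
  proof (intro exI allI)
    fix u :: "'e \<times> 'e" and x :: "'f \<times> 'f"
    have n: "norm (fst u) \<le> norm u" "norm (snd u) \<le> norm u" "norm (fst x) \<le> norm x" "norm (snd x) \<le> norm x"
      by (metis norm_fst_le norm_snd_le prod.collapse)+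
    have le: "norm (m p q) \<le> norm u * norm x * B" if "norm p \<le> norm u" "norm q \<le> norm x" for p q
    proof -
      have "norm (m p q) \<le> norm p * norm q * B" by (rule B)
      also have "\<dots> \<le> norm u * norm x * B" using that B by (intro mult_right_mono mult_mono) auto
      finally show ?thesis .
    qed
    have "norm (dual_mult m u x) \<le> norm (m (fst u) (fst x)) + norm (m (fst u) (snd x) + m (snd u) (fst x))"
      unfolding dual_mult_def by (rule norm_Pair_le)
    also have "\<dots> \<le> norm (m (fst u) (fst x)) + (norm (m (fst u) (snd x)) + norm (m (snd u) (fst x)))"
      by (intro add_left_mono norm_triangle_ineq)
    also have "\<dots> \<le> norm u * norm x * B + (norm u * norm x * B + norm u * norm x * B)"
      using n by (intro add_mono le)
    finally show "norm (dual_mult m u x) \<le> norm u * norm x * (3 * B)" by (simp add: algebra_simps)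
  qed
qed (auto simp: dual_mult_def add_left add_right scaleR_left scaleR_right algebra_simps)
qed

text \<open>\<open>inv\<close> keeps the whole line in direction d inside D. It holds in the
  application, where d moves only the point z and every z is allowed.\<close>

locale linear_ode_deriv = linear_ode prod a u0 D
  for prod :: "'e::banach \<Rightarrow> 'f::real_normed_vector \<Rightarrow> 'e" and a :: "'p::euclidean_space \<Rightarrow> real \<Rightarrow> 'f" and u0 D +
  fixes a' :: "'p \<Rightarrow> real \<Rightarrow> 'f" and d :: 'p
  assumes cont': "continuous_on (D \<times> {0..1}) (\<lambda>(p, t). a' p t)"
    and inv: "\<And>p r. p \<in> D \<Longrightarrow> p + r *\<^sub>R d \<in> D"
    and deriv: "\<And>p t. p \<in> D \<Longrightarrow> t \<in> {0..1} \<Longrightarrow> ((\<lambda>r. a (p + r *\<^sub>R d) t) has_vector_derivative a' p t) (at 0)"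
begin

text \<open>The second component starts at 0 because the initial value u0 does not depend on the
  parameter.\<close>

sublocale dual: linear_ode "dual_mult prod" "\<lambda>p t. (a p t, a' p t)" "(u0, 0)" D
proof (intro linear_ode.intro bounded_bilinear_dual_mult bounded_bilinear_axioms linear_ode_axioms.intro)
  show "continuous_on (D \<times> {0..1}) (\<lambda>(p, t). (a p t, a' p t))"
    using continuous_on_Pair[OF cont cont'] by (simp add: case_prod_unfold)
qed (rule D)

lemma deriv_at:
  assumes "p \<in> D" "t \<in> {0..1}"
  shows "((\<lambda>r. a (p + r *\<^sub>R d) t) has_vector_derivative a' (p + r *\<^sub>R d) t) (at r)"
proof -
  have "((\<lambda>s. a (p + r *\<^sub>R d + s *\<^sub>R d) t) has_vector_derivative a' (p + r *\<^sub>R d) t) (at (r - r))"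
    using deriv[OF inv[OF assms(1)] assms(2)] by simp
  then have "((\<lambda>s. a (p + r *\<^sub>R d + s *\<^sub>R d) t) \<circ> (\<lambda>s. s - r) has_vector_derivative 1 *\<^sub>R a' (p + r *\<^sub>R d) t) (at r)"
    by (intro vector_diff_chain_at) (auto intro!: derivative_eq_intros)
  then show ?thesis by (simp add: o_def algebra_simps)
qed

lemma fst_dual_pic: "p \<in> D \<Longrightarrow> t \<in> {0..1} \<Longrightarrow> fst (dual.pic n p t) = pic n p t"
proof (induction n arbitrary: t)
  case (Suc n)
  let ?g = "\<lambda>s. dual_mult prod (dual.pic n p (t * s)) (a p (t * s), a' p (t * s))"
  have "fst (integral {0..1} ?g) = integral {0..1} (fst \<circ> ?g)"
    using dual.integrand_integrable[OF Suc.prems] by (intro integral_linear[symmetric] bounded_linear_fst)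
  also have "\<dots> = integral {0..1} (\<lambda>s. prod (pic n p (t * s)) (a p (t * s)))"
  proof (rule integral_cong)
    fix s :: real assume "s \<in> {0..1}"
    then have "t * s \<in> {0..1}" using Suc.prems by (auto intro: mult_nonneg_nonneg mult_le_one)
    then show "(fst \<circ> ?g) s = prod (pic n p (t * s)) (a p (t * s))"
      using Suc.IH[OF Suc.prems(1)] by (simp add: dual_mult_def)
  qed
  finally show ?case by simp
qed simp

text \<open>Differentiating the Picard recursion under the integral sign gives the product rule,
  which is the multiplication of dual numbers.\<close>

lemma pic_param_derivative:
  assumes p: "p \<in> D"
  shows "t \<in> {0..1} \<Longrightarrow> ((\<lambda>r. pic n (p + r *\<^sub>R d) t) has_vector_derivative snd (dual.pic n (p + r *\<^sub>R d) t)) (at r)"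
proof (induction n arbitrary: t r)
  case (Suc n)
  have ts: "t * s \<in> {0..1}" if "s \<in> {0..1}" for s
    using Suc.prems that by (auto intro: mult_nonneg_nonneg mult_le_one)
  let ?f = "\<lambda>r s. prod (pic n (p + r *\<^sub>R d) (t * s)) (a (p + r *\<^sub>R d) (t * s))"
  let ?g = "\<lambda>r s. dual_mult prod (dual.pic n (p + r *\<^sub>R d) (t * s)) (a (p + r *\<^sub>R d) (t * s), a' (p + r *\<^sub>R d) (t * s))"
  have "((\<lambda>r. integral (cbox 0 1) (?f r)) has_vector_derivative integral (cbox 0 1) (\<lambda>s. snd (?g r s))) (at r within UNIV)"
  proof (rule leibniz_rule_vector_derivative)
    fix r s :: real assume "s \<in> cbox 0 1"
    then have s: "t * s \<in> {0..1}" by (intro ts) simp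
    show "((\<lambda>r. ?f r s) has_vector_derivative snd (?g r s)) (at r within UNIV)"
      using bounded_bilinear.has_vector_derivative[OF bounded_bilinear_axioms Suc.IH[OF s] deriv_at[OF p s]]
        fst_dual_pic[OF inv[OF p] s]
      by (simp add: dual_mult_def)
  next
    show "?f r integrable_on cbox 0 1" for r
      using integrand_integrable[OF inv[OF p] Suc.prems] by simp
    show "continuous_on (UNIV \<times> cbox 0 1) (\<lambda>(r, s). snd (?g r s))"
      unfolding case_prod_unfold
      by (rule continuous_on_snd, rule continuous_on_compose2[OF dual.continuous_on_integrand[OF dual.continuous_on_pic[of n]],
            of _ "\<lambda>x. ((p + fst x *\<^sub>R d, t), snd x)", unfolded case_prod_unfold, simplified])
         (use Suc.prems inv[OF p] in \<open>auto intro!: continuous_intros\<close>)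
  qed auto
  then have "((\<lambda>r. t *\<^sub>R integral {0..1} (?f r)) has_vector_derivative t *\<^sub>R integral {0..1} (\<lambda>s. snd (?g r s))) (at r)"
    using bounded_linear.has_vector_derivative[OF bounded_linear_scaleR_right] by fastforce
  moreover have "snd (integral {0..1} (?g r)) = integral {0..1} (\<lambda>s. snd (?g r s))"
    using integral_linear[OF dual.integrand_integrable[OF inv[OF p] Suc.prems] bounded_linear_snd, symmetric]
    by (simp add: o_def)
  ultimately show ?case by simp
qed simp

lemma fst_dual_sol:
  assumes "p \<in> D" "t \<in> {0..1}"
  shows "fst (dual.sol p t) = sol p t"
proof -
  have "(\<lambda>n. dual.pic n p t) sums dual.sol p t"
    unfolding lin_sol_def by (intro summable_sums dual.summable_pic assms)
  then have "(\<lambda>n. fst (dual.pic n p t)) sums fst (dual.sol p t)"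
    by (rule bounded_linear.sums[OF bounded_linear_fst])
  then show ?thesis by (simp add: fst_dual_pic[OF assms] lin_sol_def sums_iff)
qed

lemma sol_param_derivative:
  assumes p: "p \<in> D" and t: "t \<in> {0..1}"
  shows "((\<lambda>r. sol (p + r *\<^sub>R d) t) has_vector_derivative snd (dual.sol p t)) (at 0)"
proof -
  \<comment> \<open>A compact segment around p supplies one majorant for all difference quotients.
    Since 0 is interior to {-1..1}, the derivative within it is the full derivative.\<close>
  have K: "(\<lambda>r. p + r *\<^sub>R d) ` {-1..1} \<subseteq> D" "compact ((\<lambda>r. p + r *\<^sub>R d) ` {-1..1})"
    using inv[OF p] by (auto intro!: compact_continuous_image continuous_intros)
  obtain M where M: "summable M" "\<And>n q t. q \<in> (\<lambda>r. p + r *\<^sub>R d) ` {-1..1} \<Longrightarrow> t \<in> {0..1} \<Longrightarrow> norm (dual.pic n q t) \<le> M n"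
    by (rule dual.pic_bound'[OF K]) (rule that)
  have "((\<lambda>r. \<Sum>n. pic n (p + r *\<^sub>R d) t) has_vector_derivative (\<Sum>n. snd (dual.pic n (p + 0 *\<^sub>R d) t))) (at 0 within {-1..1})"
  proof (rule has_vector_derivative_suminf[where M=M])
    show "((\<lambda>r. pic n (p + r *\<^sub>R d) t) has_vector_derivative snd (dual.pic n (p + r *\<^sub>R d) t)) (at r within {-1..1})" for n r
      using pic_param_derivative[OF p t] by (rule has_vector_derivative_at_within)
    show "norm (snd (dual.pic n (p + r *\<^sub>R d) t)) \<le> M n" if "r \<in> {-1..1}" for n r
    proof -
      have "norm (snd (dual.pic n (p + r *\<^sub>R d) t)) \<le> norm (dual.pic n (p + r *\<^sub>R d) t)"
        using norm_snd_le[of "snd (dual.pic n (p + r *\<^sub>R d) t)" "fst (dual.pic n (p + r *\<^sub>R d) t)"]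
        by (simp del: picard.simps)
      also have "\<dots> \<le> M n" using that t by (intro M(2)) auto
      finally show ?thesis .
    qed
    show "summable (\<lambda>n. pic n (p + r *\<^sub>R d) t)" for r by (intro summable_pic inv p t)
  qed (use M in auto)
  then have "((\<lambda>r. sol (p + r *\<^sub>R d) t) has_vector_derivative (\<Sum>n. snd (dual.pic n p t))) (at 0)"
    using at_within_Icc_at[of "-1" 0 "1::real"] by (simp add: lin_sol_def)
  moreover have "(\<Sum>n. snd (dual.pic n p t)) = snd (dual.sol p t)"
  proof -
    have "(\<lambda>n. dual.pic n p t) sums dual.sol p t"
      unfolding lin_sol_def by (intro summable_sums dual.summable_pic p t)
    from bounded_linear.sums[OF bounded_linear_snd this] show ?thesis by (simp add: sums_iff)
  qed
  ultimately show ?thesis by simp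
qed

text \<open>The variational equation of the linear system.\<close>

lemma dual_sol_ode:
  assumes "p \<in> D" "t \<in> {0..1}"
  shows "((\<lambda>t. snd (dual.sol p t)) has_vector_derivative
    prod (sol p t) (a' p t) + prod (snd (dual.sol p t)) (a p t)) (at t within {0..1})"
  using bounded_linear.has_vector_derivative[OF bounded_linear_snd dual.sol_ode[OF assms]]
  by (simp add: snd_dual_mult fst_dual_sol[OF assms])

end

text \<open>Along the segment from z to w the derivative differs from its value at z by at most the
  oscillation of A and B, so their continuity controls the linearization error.\<close>

lemma has_derivative_if_directional:
  fixes f :: "complex \<Rightarrow> 'a::real_normed_vector"
  assumes d: "\<And>z h. ((\<lambda>r. f (z + r *\<^sub>R h)) has_vector_derivative (Re h *\<^sub>R A z + Im h *\<^sub>R B z)) (at 0)"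
    and A: "continuous_on UNIV A" and B: "continuous_on UNIV B"
  shows "(f has_derivative (\<lambda>h. Re h *\<^sub>R A z + Im h *\<^sub>R B z)) (at z)"
  unfolding has_derivative_at_alt
proof (intro conjI allI impI)
  show "bounded_linear (\<lambda>h. Re h *\<^sub>R A z + Im h *\<^sub>R B z)"
    by (intro bounded_linear_add bounded_linear_compose[OF bounded_linear_scaleR_left] bounded_linear_Re bounded_linear_Im)
  fix e :: real assume "e > 0"
  then obtain r1 r2 where r: "r1 > 0" "\<And>w. dist w z < r1 \<Longrightarrow> dist (A w) (A z) < e / 2"
    "r2 > 0" "\<And>w. dist w z < r2 \<Longrightarrow> dist (B w) (B z) < e / 2"
    using A B unfolding continuous_on_iff by (metis UNIV_I half_gt_zero)
  show "\<exists>r>0. \<forall>w. norm (w - z) < r \<longrightarrow>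
      norm (f w - f z - (Re (w - z) *\<^sub>R A z + Im (w - z) *\<^sub>R B z)) \<le> e * norm (w - z)"
  proof (intro exI[of _ "min r1 r2"] conjI allI impI)
    fix w assume w: "norm (w - z) < min r1 r2"
    define h where "h = w - z"
    define g' where "g' s = Re h *\<^sub>R A (z + s *\<^sub>R h) + Im h *\<^sub>R B (z + s *\<^sub>R h)" for s :: real
    have g: "((\<lambda>s. f (z + s *\<^sub>R h)) has_vector_derivative g' s) (at s within {0..1})" for s
    proof -
      have "((\<lambda>r. f (z + s *\<^sub>R h + r *\<^sub>R h)) has_vector_derivative g' s) (at (s - s))"
        using d[of "z + s *\<^sub>R h" h] by (simp add: g'_def)
      then have "((\<lambda>r. f (z + s *\<^sub>R h + r *\<^sub>R h)) \<circ> (\<lambda>r. r - s) has_vector_derivative 1 *\<^sub>R g' s) (at s)"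
        by (intro vector_diff_chain_at) (auto intro!: derivative_eq_intros)
      then show ?thesis by (auto simp: o_def algebra_simps intro: has_vector_derivative_at_within)
    qed
    have bound: "norm (g' s - g' 0) \<le> e * norm h" if "s \<in> {0..1}" for s
    proof -
      have "norm (s *\<^sub>R h) \<le> norm h" using that by (simp add: mult_left_le_one_le)
      then have "dist (z + s *\<^sub>R h) z < r1" "dist (z + s *\<^sub>R h) z < r2"
        using w by (auto simp: dist_norm h_def)
      then have AB: "norm (A (z + s *\<^sub>R h) - A z) \<le> e / 2" "norm (B (z + s *\<^sub>R h) - B z) \<le> e / 2"
        using r by (auto simp: dist_norm less_imp_le)
      have "g' s - g' 0 = Re h *\<^sub>R (A (z + s *\<^sub>R h) - A z) + Im h *\<^sub>R (B (z + s *\<^sub>R h) - B z)"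
        by (simp add: g'_def algebra_simps)
      also have "norm \<dots> \<le> \<bar>Re h\<bar> * norm (A (z + s *\<^sub>R h) - A z) + \<bar>Im h\<bar> * norm (B (z + s *\<^sub>R h) - B z)"
        by (rule order_trans[OF norm_triangle_ineq]) simp
      also have "\<dots> \<le> norm h * (e / 2) + norm h * (e / 2)"
        using AB abs_Re_le_cmod abs_Im_le_cmod by (intro add_mono mult_mono) auto
      finally show ?thesis by (simp add: algebra_simps)
    qed
    have "norm (f (z + 1 *\<^sub>R h) - f (z + 0 *\<^sub>R h) - (1 - 0) *\<^sub>R g' 0) \<le> norm (1 - 0 :: real) * (e * norm h)"
      by (rule vector_differentiable_bound_linearization[OF g])
         (use bound in \<open>auto simp: closed_segment_eq_real_ivl\<close>)
    then show "norm (f w - f z - (Re (w - z) *\<^sub>R A z + Im (w - z) *\<^sub>R B z)) \<le> e * norm (w - z)"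
      by (simp add: h_def g'_def)
  qed (use r in auto)
qed

section \<open>Flat connections depending on a complex parameter\<close>

lemma bounded_bilinear_matrix_mult: "bounded_bilinear ((**) :: complex^3^3 \<Rightarrow> complex^3^3 \<Rightarrow> complex^3^3)"
proof -
  have "bilinear ((**) :: complex^3^3 \<Rightarrow> complex^3^3 \<Rightarrow> complex^3^3)"
    unfolding bilinear_def
    by (auto intro!: linearI simp: vec_eq_iff matrix_mult_nth3 algebra_simps)
  then show ?thesis by (simp add: bilinear_conv_bounded_bilinear)
qed

lemma bounded_linear_transpose: "bounded_linear (transpose :: complex^3^3 \<Rightarrow> complex^3^3)"
  by (auto intro!: linear_conv_bounded_linear[THEN iffD1] linearI simp: vec_eq_iff transpose_nth)

interpretation matrix_mult: bounded_bilinear "(**) :: complex^3^3 \<Rightarrow> complex^3^3 \<Rightarrow> complex^3^3"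
  by (rule bounded_bilinear_matrix_mult)

text \<open>The left side is the derivative of W ** transpose U when both W and U are multiplied by
  A on the right under differentiation.\<close>

lemma transpose_mult_antisym:
  fixes U A W :: "complex^3^3"
  assumes "transpose A = - A"
  shows "W ** transpose (U ** A) + W ** A ** transpose U = 0"
  by (simp add: matrix_transpose_mul assms matrix_mult.minus_left matrix_mult.minus_right matrix_mul_assoc)

text \<open>U ** transpose U is constant, and the determinant, being 1 or -1, cannot jump along the
  interval.\<close>

lemma antisym_ode_SO3:
  fixes U :: "real \<Rightarrow> complex^3^3"
  assumes U: "\<And>t. t \<in> {0..1} \<Longrightarrow> (U has_vector_derivative U t ** A t) (at t within {0..1})"
    and A: "\<And>t. transpose (A t) = - A t" and U0: "U 0 = mat 1" and t: "t \<in> {0..1}"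
  shows "U t \<in> SO3"
proof -
  have UT: "((\<lambda>t. transpose (U t)) has_vector_derivative transpose (U t ** A t)) (at t within {0..1})"
    if "t \<in> {0..1}" for t
    by (rule bounded_linear.has_vector_derivative[OF bounded_linear_transpose U[OF that]])
  have "((\<lambda>t. U t ** transpose (U t)) has_vector_derivative 0) (at t within {0..1})" if "t \<in> {0..1}" for t
    using matrix_mult.has_vector_derivative[OF U[OF that] UT[OF that]] transpose_mult_antisym[OF A, of "U t" "U t" t]
    by simp
  then obtain C where "\<And>t. t \<in> {0..1} \<Longrightarrow> U t ** transpose (U t) = C"
    using has_vector_derivative_zero_constant[of "{0..1}" "\<lambda>t. U t ** transpose (U t)"] by auto
  from this[of 0] this have UUT: "U t ** transpose (U t) = mat 1" if "t \<in> {0..1}" for t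
    using that by (simp add: U0 transpose_mat)
  have "det (U t) = det (U 0)"
  proof (rule sign_constant[of "{0..1}" "\<lambda>t. det (U t)" 1])
    have "continuous_on {0..1} U"
      unfolding continuous_on_eq_continuous_within using has_vector_derivative_continuous[OF U] by blast
    then show "continuous_on {0..1} (\<lambda>t. det (U t))"
      unfolding det_3 by (intro continuous_intros)
    show "det (U t) = 1 \<or> det (U t) = - 1" if "t \<in> {0..1}" for t
    proof -
      have "det (U t) * det (U t) = 1"
        using arg_cong[OF UUT[OF that], of det] by (simp add: det_mul det_transpose)
      then show ?thesis by (simp add: square_eq_1_iff)
    qed
  qed (use t in auto)
  moreover have "transpose (U t) ** U t = mat 1"
    using UUT[OF t] matrix_left_right_inverse[of "U t" "transpose (U t)"] by simp
  ultimately show ?thesis by (intro SO3I) (auto simp: U0)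
qed

text \<open>Uniqueness by comparison with an invertible solution: W ** transpose U is constant, and
  it vanishes at 0.\<close>

lemma antisym_ode_unique:
  fixes U W :: "real \<Rightarrow> complex^3^3"
  assumes U: "\<And>t. t \<in> {0..1} \<Longrightarrow> (U has_vector_derivative U t ** A t) (at t within {0..1})"
    and W: "\<And>t. t \<in> {0..1} \<Longrightarrow> (W has_vector_derivative W t ** A t) (at t within {0..1})"
    and A: "\<And>t. transpose (A t) = - A t" and U0: "U 0 = mat 1" and W0: "W 0 = 0" and t: "t \<in> {0..1}"
  shows "W t = 0"
proof -
  have UT: "((\<lambda>t. transpose (U t)) has_vector_derivative transpose (U t ** A t)) (at t within {0..1})"
    if "t \<in> {0..1}" for t
    by (rule bounded_linear.has_vector_derivative[OF bounded_linear_transpose U[OF that]])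
  have "((\<lambda>t. W t ** transpose (U t)) has_vector_derivative 0) (at t within {0..1})" if "t \<in> {0..1}" for t
    using matrix_mult.has_vector_derivative[OF W[OF that] UT[OF that]] transpose_mult_antisym[OF A, of "W t" "U t" t]
    by simp
  then obtain C where "\<And>t. t \<in> {0..1} \<Longrightarrow> W t ** transpose (U t) = C"
    using has_vector_derivative_zero_constant[of "{0..1}" "\<lambda>t. W t ** transpose (U t)"] by auto
  from this[of 0] this[OF t] have "W t ** transpose (U t) = 0" by (simp add: W0 matrix_mult.zero_left)
  then have "W t ** transpose (U t) ** U t = 0" by (simp add: matrix_mult.zero_left)
  then show ?thesis using SO3_cancel(4)[OF antisym_ode_SO3[OF U A U0 t]] by simp
qed

text \<open>Differentiation under the integral requires the l-derivative to be jointly continuous in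
  l and s. Cauchy's formula expresses it as an integral of f over a fixed circle, which reduces this
  to the joint continuity of f.\<close>

lemma holomorphic_on_integral_param:
  fixes f :: "complex \<Rightarrow> real \<Rightarrow> complex"
  assumes U: "open U" and cont: "continuous_on (U \<times> {0..1}) (\<lambda>(l, s). f l s)"
    and hol: "\<And>s. s \<in> {0..1} \<Longrightarrow> (\<lambda>l. f l s) holomorphic_on U"
  shows "(\<lambda>l. integral {0..1} (f l)) holomorphic_on U"
  unfolding holomorphic_on_open[OF U]
proof
  have cont2: "continuous_on (U \<times> {0..1}) (\<lambda>x. f (fst x) (snd x))"
    using cont by (simp add: case_prod_unfold)
  fix l0 assume "l0 \<in> U"
  then obtain r where r: "r > 0" "cball l0 r \<subseteq> U" using U open_contains_cball by blast
  define f' where "f' l s = 1 / (2 * of_real pi * \<i>) * contour_integral (circlepath l0 r) (\<lambda>u. f u s / (u - l)\<^sup>2)" for l s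
  have d: "((\<lambda>l. f l s) has_field_derivative f' l s) (at l)" if "l \<in> ball l0 r" "s \<in> {0..1}" for l s
    unfolding f'_def
  proof (rule Cauchy_derivative_integral_circlepath(2))
    show "continuous_on (cball l0 r) (\<lambda>l. f l s)"
      using hol[OF that(2)] r(2) by (meson holomorphic_on_imp_continuous_on continuous_on_subset)
    show "(\<lambda>l. f l s) holomorphic_on ball l0 r"
      using hol[OF that(2)] r(2) by (meson ball_subset_cball holomorphic_on_subset subset_trans)
  qed (rule that)
  have circ: "circlepath l0 r t \<in> sphere l0 r" if "t \<in> {0..1}" for t
    using that r(1) by (metis abs_of_pos path_image_circlepath path_image_def image_eqI)
  have "continuous_on (ball l0 r \<times> {0..1}) (\<lambda>x. integral (cbox 0 1) (\<lambda>t. f (circlepath l0 r t) (snd x) /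
      (circlepath l0 r t - fst x)\<^sup>2 * (2 * of_real pi * \<i> * of_real r * exp (2 * of_real pi * \<i> * of_real t))))"
  proof (rule integral_continuous_on_param)
    have "continuous_on ((ball l0 r \<times> {0..1}) \<times> cbox 0 1) (\<lambda>x. f (circlepath l0 r (snd x)) (snd (fst x)))"
    proof (rule continuous_on_compose2[OF cont2, of _ "\<lambda>x. (circlepath l0 r (snd x), snd (fst x))", unfolded fst_conv snd_conv])
      show "continuous_on ((ball l0 r \<times> {0..1}) \<times> cbox 0 1) (\<lambda>x. (circlepath l0 r (snd x), snd (fst x)))"
        unfolding circlepath by (intro continuous_intros)
      show "(\<lambda>x. (circlepath l0 r (snd x), snd (fst x))) ` ((ball l0 r \<times> {0..1}) \<times> cbox 0 1) \<subseteq> U \<times> {0..1}"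
        using circ r(2) by (fastforce simp: subset_iff)
    qed
    moreover have "circlepath l0 r (snd x) - fst (fst x) \<noteq> 0" if "x \<in> (ball l0 r \<times> {0..1::real}) \<times> cbox 0 1" for x
    proof -
      have "fst (fst x) \<in> ball l0 r" "circlepath l0 r (snd x) \<in> sphere l0 r" using that circ by auto
      then show ?thesis by auto
    qed
    moreover have "continuous_on ((ball l0 r \<times> {0..1::real}) \<times> cbox 0 1) (\<lambda>x. circlepath l0 r (snd x))"
      unfolding circlepath by (intro continuous_intros)
    ultimately show "continuous_on ((ball l0 r \<times> {0..1}) \<times> cbox 0 1) (\<lambda>(x, t). f (circlepath l0 r t) (snd x) /
      (circlepath l0 r t - fst x)\<^sup>2 * (2 * of_real pi * \<i> * of_real r * exp (2 * of_real pi * \<i> * of_real t)))"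
      unfolding case_prod_unfold by (intro continuous_intros) auto
  qed
  then have cf: "continuous_on (ball l0 r \<times> cbox 0 1) (\<lambda>(l, s). f' l s)"
    unfolding f'_def case_prod_unfold
    by (auto simp: contour_integral_integral vector_derivative_circlepath intro!: continuous_on_divide)
  have "(\<lambda>l. integral (cbox 0 1) (f l)) holomorphic_on ball l0 r"
  proof (rule leibniz_rule_holomorphic[OF _ _ cf])
    show "((\<lambda>l. f l s) has_field_derivative f' l s) (at l within ball l0 r)" if "l \<in> ball l0 r" "s \<in> cbox 0 1" for l s
      using d[of l s] that by (auto intro: has_field_derivative_at_within)
    show "f l integrable_on cbox 0 1" if "l \<in> ball l0 r" for l
      using that r(2) by (intro integrable_continuous)
        (auto intro!: continuous_on_compose2[OF cont, of _ "\<lambda>s. (l, s)", simplified] continuous_intros)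
  qed auto
  then show "\<exists>f'. ((\<lambda>l. integral {0..1} (f l)) has_field_derivative f') (at l0)"
    using r(1) by (auto simp: holomorphic_on_open)
qed

text \<open>Bootstrapping: the equation expresses the derivatives of f by f itself and smooth data.
  The inhomogeneous terms R and T are there for the derivative of a frame in the spectral
  parameter.\<close>

lemma smooth_if_linear_equation:
  fixes f P Q R T :: "complex \<Rightarrow> complex^3^3"
  assumes d: "\<And>z. (f has_derivative (\<lambda>h. Re h *\<^sub>R (f z ** P z + R z) + Im h *\<^sub>R (f z ** Q z + T z))) (at z)"
    and "smooth P" "smooth Q" "smooth R" "smooth T"
  shows "smooth f"
  unfolding smooth_def
proof
  fix k
  have pd: "pdx f = (\<lambda>z. f z ** P z + R z)" "pdy f = (\<lambda>z. f z ** Q z + T z)"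
    using pdx_eqI[OF d] pdy_eqI[OF d] by auto
  show "Ck k f"
  proof (induction k)
    case 0
    then show ?case using d by (auto intro!: continuous_at_imp_continuous_on has_derivative_continuous)
  next
    case (Suc k)
    have "Ck k P" "Ck k Q" "Ck k R" "Ck k T" using assms by (auto simp: smooth_def)
    with Suc have "Ck k (pdx f)" "Ck k (pdy f)"
      unfolding pd by (auto intro!: matrix_mult.Ck_bilinear Ck_add)
    then show ?case using d by (auto simp: differentiable_def)
  qed
qed

text \<open>\<open>flat\<close> is the compatibility condition of the equations U_x = U P and U_y =
  U Q, obtained by equating mixed derivatives. Joint continuity of the derivatives of P and Q
  permits differentiation of parallel transport with respect to its end point.\<close>

locale flat_connection =
  fixes P Q :: "complex \<Rightarrow> complex \<Rightarrow> complex^3^3"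
  assumes smP: "\<And>l. l \<noteq> 0 \<Longrightarrow> smooth (P l)" and smQ: "\<And>l. l \<noteq> 0 \<Longrightarrow> smooth (Q l)"
    and contP: "continuous_on ((- {0}) \<times> UNIV) (\<lambda>(l, z). P l z)"
    and contQ: "continuous_on ((- {0}) \<times> UNIV) (\<lambda>(l, z). Q l z)"
    and contPx: "continuous_on ((- {0}) \<times> UNIV) (\<lambda>(l, z). pdx (P l) z)"
    and contPy: "continuous_on ((- {0}) \<times> UNIV) (\<lambda>(l, z). pdy (P l) z)"
    and contQx: "continuous_on ((- {0}) \<times> UNIV) (\<lambda>(l, z). pdx (Q l) z)"
    and contQy: "continuous_on ((- {0}) \<times> UNIV) (\<lambda>(l, z). pdy (Q l) z)"
    and antiP: "\<And>l z. transpose (P l z) = - P l z" and antiQ: "\<And>l z. transpose (Q l z) = - Q l z"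
    and flat: "\<And>l z. l \<noteq> 0 \<Longrightarrow> pdy (P l) z - pdx (Q l) z = P l z ** Q l z - Q l z ** P l z"
    and holP: "\<And>z i j. (\<lambda>l. P l z $ i $ j) holomorphic_on - {0}"
    and holQ: "\<And>z i j. (\<lambda>l. Q l z $ i $ j) holomorphic_on - {0}"
begin

text \<open>The connection form at the point t z, where p = (l, z), evaluated on the tangent vector
  h. In \<open>dcon p t k h\<close> the form applied to k is differentiated in the direction
  h.\<close>

definition con :: "complex \<times> complex \<Rightarrow> real \<Rightarrow> complex \<Rightarrow> complex^3^3" where
  "con p t h = Re h *\<^sub>R P (fst p) (t *\<^sub>R snd p) + Im h *\<^sub>R Q (fst p) (t *\<^sub>R snd p)"

definition dcon :: "complex \<times> complex \<Rightarrow> real \<Rightarrow> complex \<Rightarrow> complex \<Rightarrow> complex^3^3" where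
  "dcon p t k h = Re k *\<^sub>R (Re h *\<^sub>R pdx (P (fst p)) (t *\<^sub>R snd p) + Im h *\<^sub>R pdy (P (fst p)) (t *\<^sub>R snd p))
     + Im k *\<^sub>R (Re h *\<^sub>R pdx (Q (fst p)) (t *\<^sub>R snd p) + Im h *\<^sub>R pdy (Q (fst p)) (t *\<^sub>R snd p))"

lemma transpose_con: "transpose (con p t h) = - con p t h"
proof -
  have "transpose (c *\<^sub>R A + e *\<^sub>R B) = c *\<^sub>R transpose A + e *\<^sub>R transpose B" for c e and A B :: "complex^3^3"
    by (simp add: vec_eq_iff transpose_nth)
  then show ?thesis unfolding con_def by (simp add: antiP antiQ)
qed

lemma cont_scaled:
  fixes F :: "complex \<Rightarrow> complex \<Rightarrow> complex^3^3"
  assumes "continuous_on ((- {0}) \<times> UNIV) (\<lambda>(l, z). F l z)"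
  shows "continuous_on (((- {0}) \<times> UNIV) \<times> {0..1}) (\<lambda>x. F (fst (fst x)) (snd x *\<^sub>R snd (fst x)))"
proof -
  have c: "continuous_on ((- {0}) \<times> UNIV) (\<lambda>x. F (fst x) (snd x))"
    using assms by (simp add: case_prod_unfold)
  show ?thesis
    by (rule continuous_on_compose2[OF c, of _ "\<lambda>x. (fst (fst x), snd x *\<^sub>R snd (fst x))", unfolded fst_conv snd_conv])
       (auto intro!: continuous_intros)
qed

lemma along_line:
  assumes F: "smooth F"
  shows "((\<lambda>r. F (t *\<^sub>R (z + r *\<^sub>R h))) has_vector_derivative
    t *\<^sub>R (Re h *\<^sub>R pdx F (t *\<^sub>R z) + Im h *\<^sub>R pdy F (t *\<^sub>R z))) (at 0)"
proof -
  have "((\<lambda>r. t *\<^sub>R (z + r *\<^sub>R h)) has_derivative (\<lambda>s. t *\<^sub>R s *\<^sub>R h)) (at (0::real))"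
    by (auto intro!: derivative_eq_intros)
  moreover have "(F has_derivative (\<lambda>k. Re k *\<^sub>R pdx F (t *\<^sub>R z) + Im k *\<^sub>R pdy F (t *\<^sub>R z))) (at (t *\<^sub>R (z + 0 *\<^sub>R h)))"
    using smooth_has_derivative[OF F, of "t *\<^sub>R z"] by simp
  ultimately have "((\<lambda>r. F (t *\<^sub>R (z + r *\<^sub>R h))) has_derivative (\<lambda>s. Re (t *\<^sub>R s *\<^sub>R h) *\<^sub>R pdx F (t *\<^sub>R z) +
      Im (t *\<^sub>R s *\<^sub>R h) *\<^sub>R pdy F (t *\<^sub>R z))) (at 0)"
    by (rule has_derivative_compose)
  then show ?thesis by (simp add: has_vector_derivative_def algebra_simps)
qed

lemma linear_ode_con: "linear_ode ((**) :: complex^3^3 \<Rightarrow> complex^3^3 \<Rightarrow> complex^3^3) (\<lambda>p t. con p t (snd p)) ((- {0}) \<times> UNIV)"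
proof (intro linear_ode.intro bounded_bilinear_matrix_mult linear_ode_axioms.intro)
  show "continuous_on (((- {0}) \<times> UNIV) \<times> {0..1}) (\<lambda>(p, t). con p t (snd p))"
    unfolding con_def case_prod_unfold
    by (intro continuous_intros cont_scaled contP contQ)
qed (auto intro: open_Times)

sublocale L: linear_ode "(**)" "\<lambda>p t. con p t (snd p)" "mat 1" "(- {0}) \<times> UNIV"
  by (rule linear_ode_con)

text \<open>The point z enters the coefficient twice: as tangent vector of the ray, which gives the
  first term, and as end point whose multiple t z is the base point, which gives the second term
  with its factor t.\<close>

lemma linear_ode_deriv_con:
  "linear_ode_deriv ((**) :: complex^3^3 \<Rightarrow> complex^3^3 \<Rightarrow> complex^3^3) (\<lambda>p t. con p t (snd p)) ((- {0}) \<times> UNIV)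
     (\<lambda>p t. con p t h + t *\<^sub>R dcon p t (snd p) h) (0, h)"
proof (intro linear_ode_deriv.intro linear_ode_con linear_ode_deriv_axioms.intro)
  show "continuous_on (((- {0}) \<times> UNIV) \<times> {0..1}) (\<lambda>(p, t). con p t h + t *\<^sub>R dcon p t (snd p) h)"
    unfolding con_def dcon_def case_prod_unfold
    by (intro continuous_intros cont_scaled contP contQ contPx contPy contQx contQy)
  show "p + r *\<^sub>R (0, h) \<in> (- {0}) \<times> UNIV" if "p \<in> (- {0}) \<times> UNIV" for p :: "complex \<times> complex" and r
    using that by (cases p) auto
  show "((\<lambda>r. con (p + r *\<^sub>R (0, h)) t (snd (p + r *\<^sub>R (0, h)))) has_vector_derivative
      con p t h + t *\<^sub>R dcon p t (snd p) h) (at 0)" if p: "p \<in> (- {0}) \<times> UNIV" for p t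
  proof -
    obtain l z where lz: "p = (l, z)" by (cases p)
    then have "l \<noteq> 0" using p by auto
    note P' = along_line[OF smP[OF this], of t z h] and Q' = along_line[OF smQ[OF this], of t z h]
    have R: "((\<lambda>r. Re (z + r *\<^sub>R h)) has_field_derivative Re h) (at 0)" "((\<lambda>r. Im (z + r *\<^sub>R h)) has_field_derivative Im h) (at 0)"
      by (auto intro!: derivative_eq_intros)
    show ?thesis
      unfolding lz con_def dcon_def
      using has_vector_derivative_add[OF has_vector_derivative_scaleR[OF R(1) P'] has_vector_derivative_scaleR[OF R(2) Q']]
      by (simp add: algebra_simps)
  qed
qed

text \<open>The curvature evaluated on h and z. By antisymmetry only the factor Re h * Im z - Im h *
  Re z survives, and it multiplies the expression in \<open>flat\<close>.\<close>

lemma flat_con: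
  assumes "l \<noteq> 0"
  shows "con (l, z) t h ** con (l, z) t z - con (l, z) t z ** con (l, z) t h + dcon (l, z) t z h - dcon (l, z) t h z = 0"
proof -
  define A B where "A = P l (t *\<^sub>R z)" and "B = Q l (t *\<^sub>R z)"
  have 1: "con (l, z) t h ** con (l, z) t z - con (l, z) t z ** con (l, z) t h
      = (Re h * Im z - Im h * Re z) *\<^sub>R (A ** B - B ** A)"
    unfolding con_def A_def[symmetric] B_def[symmetric] fst_conv snd_conv
    by (simp add: matrix_mult.add_left matrix_mult.add_right matrix_mult.scaleR_left matrix_mult.scaleR_right algebra_simps)
  have 2: "dcon (l, z) t z h - dcon (l, z) t h z
      = (Re z * Im h - Re h * Im z) *\<^sub>R (pdy (P l) (t *\<^sub>R z) - pdx (Q l) (t *\<^sub>R z))"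
    unfolding dcon_def fst_conv snd_conv by (simp add: algebra_simps)
  have "con (l, z) t h ** con (l, z) t z - con (l, z) t z ** con (l, z) t h + dcon (l, z) t z h - dcon (l, z) t h z
      = (con (l, z) t h ** con (l, z) t z - con (l, z) t z ** con (l, z) t h) + (dcon (l, z) t z h - dcon (l, z) t h z)"
    by simp
  also have "\<dots> = ((Re h * Im z - Im h * Re z) + (Re z * Im h - Re h * Im z)) *\<^sub>R (A ** B - B ** A)"
    unfolding 1 2 flat[OF assms, of "t *\<^sub>R z", folded A_def B_def] by (rule scaleR_left_distrib[symmetric])
  finally show ?thesis by simp
qed

text \<open>Parallel transport along the segment from 0 to z, starting with the identity.\<close>

definition frame :: "complex \<Rightarrow> complex \<Rightarrow> complex^3^3" where
  "frame l z = L.sol (l, z) 1"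

lemma sol_SO3: "l \<noteq> 0 \<Longrightarrow> t \<in> {0..1} \<Longrightarrow> L.sol (l, z) t \<in> SO3"
  by (rule antisym_ode_SO3[where A="\<lambda>t. con (l, z) t z"]) (use L.sol_ode[of "(l, z)"] in \<open>auto simp: transpose_con L.sol_0\<close>)

text \<open>By construction the transport satisfies its equation only in the radial direction.
  Flatness extends it to every direction h.\<close>

lemma frame_directional:
  assumes l: "l \<noteq> 0"
  shows "((\<lambda>r. frame l (z + r *\<^sub>R h)) has_vector_derivative frame l z ** con (l, z) 1 h) (at 0)"
proof -
  interpret M: linear_ode_deriv "(**)" "\<lambda>p t. con p t (snd p)" "mat 1" "(- {0}) \<times> UNIV"
    "\<lambda>p t. con p t h + t *\<^sub>R dcon p t (snd p) h" "(0, h)" by (rule linear_ode_deriv_con)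
  have p: "(l, z) \<in> (- {0}) \<times> UNIV" using l by auto
  define U where "U t = L.sol (l, z) t" for t
  define V where "V t = snd (M.dual.sol (l, z) t)" for t
  \<comment> \<open>V is the variation of the transport when the end point moves along h; then t z
    moves along t h, so W measures the deviation from the expected derivative. Flatness makes W
    solve the homogeneous equation with initial value 0.\<close>
  define W where "W t = V t - t *\<^sub>R (U t ** con (l, z) t h)" for t
  have U: "(U has_vector_derivative U t ** con (l, z) t z) (at t within {0..1})" if "t \<in> {0..1}" for t
    using L.sol_ode[OF p that] by (simp add: U_def[abs_def])
  have V: "(V has_vector_derivative U t ** (con (l, z) t h + t *\<^sub>R dcon (l, z) t z h) + V t ** con (l, z) t z)
      (at t within {0..1})" if "t \<in> {0..1}" for t
    using M.dual_sol_ode[OF p that] by (simp add: U_def V_def[abs_def])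
  have C: "((\<lambda>t. con (l, z) t h) has_vector_derivative dcon (l, z) t h z) (at t within {0..1})" for t
  proof -
    have line: "((\<lambda>t. F (t *\<^sub>R z)) has_vector_derivative Re z *\<^sub>R pdx F (t *\<^sub>R z) + Im z *\<^sub>R pdy F (t *\<^sub>R z)) (at t within {0..1})"
      if F: "smooth F" for F :: "complex \<Rightarrow> complex^3^3"
    proof -
      have "((\<lambda>t. t *\<^sub>R z) has_derivative (\<lambda>s. s *\<^sub>R z)) (at t within {0..1})"
        by (auto intro!: derivative_eq_intros)
      from has_derivative_compose[OF this smooth_has_derivative[OF F, of "t *\<^sub>R z"]]
      show ?thesis by (simp add: has_vector_derivative_def algebra_simps)
    qed
    show ?thesis
      unfolding con_def dcon_def fst_conv snd_conv
      by (intro has_vector_derivative_add bounded_linear.has_vector_derivative[OF bounded_linear_scaleR_right] line smP smQ l)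
  qed
  have W: "(W has_vector_derivative W t ** con (l, z) t z) (at t within {0..1})" if t: "t \<in> {0..1}" for t
  proof -
    have "((\<lambda>t. t *\<^sub>R (U t ** con (l, z) t h)) has_vector_derivative
       t *\<^sub>R (U t ** dcon (l, z) t h z + U t ** con (l, z) t z ** con (l, z) t h) + 1 *\<^sub>R (U t ** con (l, z) t h)) (at t within {0..1})"
      by (intro has_vector_derivative_scaleR matrix_mult.has_vector_derivative U C t) (auto intro!: derivative_eq_intros)
    from has_vector_derivative_diff[OF V[OF t] this]
    have "(W has_vector_derivative
       U t ** (con (l, z) t h + t *\<^sub>R dcon (l, z) t z h) + V t ** con (l, z) t z -
       (t *\<^sub>R (U t ** dcon (l, z) t h z + U t ** con (l, z) t z ** con (l, z) t h) + 1 *\<^sub>R (U t ** con (l, z) t h))) (at t within {0..1})"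
      by (simp add: W_def[abs_def])
    moreover have "U t ** (con (l, z) t h + t *\<^sub>R dcon (l, z) t z h) + V t ** con (l, z) t z -
       (t *\<^sub>R (U t ** dcon (l, z) t h z + U t ** con (l, z) t z ** con (l, z) t h) + 1 *\<^sub>R (U t ** con (l, z) t h))
       = W t ** con (l, z) t z + t *\<^sub>R (U t ** (con (l, z) t h ** con (l, z) t z - con (l, z) t z ** con (l, z) t h + dcon (l, z) t z h - dcon (l, z) t h z))"
      unfolding W_def
      by (simp add: matrix_mult.add_left matrix_mult.add_right matrix_mult.diff_left matrix_mult.diff_right
        matrix_mult.scaleR_left matrix_mult.scaleR_right matrix_mul_assoc algebra_simps)
    ultimately show ?thesis by (simp add: flat_con[OF l] matrix_mult.zero_right)
  qed
  have "W 1 = 0"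
  proof (rule antisym_ode_unique[OF U W transpose_con])
    show "U 0 = mat 1" by (simp add: U_def L.sol_0)
    show "W 0 = 0" by (simp add: W_def V_def M.dual.sol_0)
  qed auto
  then have "V 1 = frame l z ** con (l, z) 1 h" by (simp add: W_def U_def frame_def)
  with M.sol_param_derivative[OF p, of 1] show ?thesis
    by (simp add: V_def frame_def[abs_def])
qed

lemma continuous_frame: "continuous_on ((- {0}) \<times> UNIV) (\<lambda>(l, z). frame l z)"
proof -
  have "continuous_on (((- {0}) \<times> UNIV) \<times> {0..1}) (\<lambda>x. L.sol (fst x) (snd x))"
    using L.continuous_on_sol by (simp add: case_prod_unfold)
  moreover have "continuous_on ((- {0}) \<times> UNIV) (\<lambda>x :: complex \<times> complex. (x, 1::real))"
    by (intro continuous_intros)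
  moreover have "(\<lambda>x :: complex \<times> complex. (x, 1)) ` ((- {0}) \<times> UNIV) \<subseteq> ((- {0}) \<times> UNIV) \<times> {0..1::real}"
    by auto
  ultimately have "continuous_on ((- {0}) \<times> UNIV) (\<lambda>x :: complex \<times> complex. L.sol (fst (x, 1::real)) (snd (x, 1::real)))"
    by (rule continuous_on_compose2)
  then show ?thesis by (simp add: frame_def case_prod_unfold)
qed

lemma frame_has_derivative:
  assumes l: "l \<noteq> 0"
  shows "(frame l has_derivative (\<lambda>h. Re h *\<^sub>R (frame l z ** P l z) + Im h *\<^sub>R (frame l z ** Q l z))) (at z)"
proof (rule has_derivative_if_directional)
  have "continuous_on UNIV (frame l)"
    by (rule continuous_on_compose2[OF continuous_frame, of _ "\<lambda>z. (l, z)", simplified]) (use l in \<open>auto intro!: continuous_intros\<close>)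
  then show "continuous_on UNIV (\<lambda>z. frame l z ** P l z)" "continuous_on UNIV (\<lambda>z. frame l z ** Q l z)"
    using smooth_imp_continuous_on[OF smP[OF l]] smooth_imp_continuous_on[OF smQ[OF l]]
    by (auto intro!: matrix_mult.continuous_on)
  show "((\<lambda>r. frame l (z + r *\<^sub>R h)) has_vector_derivative
      Re h *\<^sub>R (frame l z ** P l z) + Im h *\<^sub>R (frame l z ** Q l z)) (at 0)" for z h
    using frame_directional[OF l, of z h]
    by (simp add: con_def matrix_mult.add_right matrix_mult.scaleR_right)
qed

lemma holomorphic_pic: "t \<in> {0..1} \<Longrightarrow> (\<lambda>l. L.pic n (l, z) t $ i $ j) holomorphic_on - {0}"
proof (induction n arbitrary: t i j)
  case (Suc n)
  have ts: "t * s \<in> {0..1}" if "s \<in> {0..1}" for s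
    using Suc.prems that by (auto intro: mult_nonneg_nonneg mult_le_one)
  let ?g = "\<lambda>l s. L.pic n (l, z) (t * s) ** con (l, z) (t * s) z"
  have "(\<lambda>l. integral {0..1} (\<lambda>s. ?g l s $ i $ j)) holomorphic_on - {0}"
  proof (rule holomorphic_on_integral_param)
    have "continuous_on ((- {0}) \<times> {0..1}) (\<lambda>x. ?g (fst x) (snd x))"
      by (rule continuous_on_compose2[OF L.continuous_on_integrand[OF L.continuous_on_pic[of n]],
            of _ "\<lambda>x. (((fst x, z), t), snd x)", unfolded case_prod_unfold, simplified])
         (use Suc.prems in \<open>auto intro!: continuous_intros\<close>)
    then show "continuous_on ((- {0}) \<times> {0..1}) (\<lambda>(l, s). ?g l s $ i $ j)"
      unfolding case_prod_unfold by (intro continuous_intros)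
    have "(\<lambda>l. con (l, z) (t * s) z $ i' $ j') holomorphic_on - {0}" for s i' j'
      unfolding con_def by (simp add: scaleR_conv_of_real) (intro holomorphic_intros holP holQ)
    then show "(\<lambda>l. ?g l s $ i $ j) holomorphic_on - {0}" if "s \<in> {0..1}" for s
      unfolding matrix_mult_nth3 using Suc.IH[OF ts[OF that]] by (intro holomorphic_intros)
  qed (auto intro: open_Compl)
  moreover have "integral {0..1} (\<lambda>s. ?g l s $ i $ j) = integral {0..1} (?g l) $ i $ j" if "l \<in> - {0}" for l
    using integral_linear[OF L.integrand_integrable[of "(l, z)" t n]
        bounded_linear_compose[OF bounded_linear_vec_nth[of j] bounded_linear_vec_nth[of i]]] that Suc.prems
    by (simp add: o_def)
  ultimately have "(\<lambda>l. integral {0..1} (?g l) $ i $ j) holomorphic_on - {0}"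
    by (rule holomorphic_transform)
  then have "(\<lambda>l. of_real t * integral {0..1} (?g l) $ i $ j) holomorphic_on - {0}"
    by (intro holomorphic_intros)
  then show ?case by (simp add: scaleR_conv_of_real[where 'a=complex])
qed (simp add: holomorphic_on_const)

text \<open>The partial sums of the Picard series are holomorphic in l and converge uniformly on
  closed balls that avoid 0.\<close>

lemma holomorphic_frame: "(\<lambda>l. frame l z $ i $ j) holomorphic_on - {0}"
proof (rule holomorphic_uniform_sequence[where f="\<lambda>N l. \<Sum>n<N. L.pic n (l, z) 1 $ i $ j"])
  show "(\<lambda>l. \<Sum>n<N. L.pic n (l, z) 1 $ i $ j) holomorphic_on - {0}" for N
    by (intro holomorphic_intros holomorphic_pic) auto
  fix l :: complex assume "l \<in> - {0}"
  moreover have "open (- {0::complex})" by (intro open_Compl) simp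
  ultimately obtain d where d: "d > 0" "cball l d \<subseteq> - {0}" unfolding open_contains_cball by blast
  have "uniform_limit ((cball l d \<times> {z}) \<times> {0..1}) (\<lambda>N (p, t). \<Sum>n<N. L.pic n p t) (\<lambda>(p, t). L.sol p t) sequentially"
    using d by (intro L.uniform_limit_sol compact_Times) auto
  then have "uniform_limit (cball l d) (\<lambda>N k. \<Sum>n<N. L.pic n (k, z) 1) (\<lambda>k. L.sol (k, z) 1) sequentially"
    unfolding uniform_limit_iff by (fastforce elim: eventually_mono)
  then have "uniform_limit (cball l d) (\<lambda>N k. (\<Sum>n<N. L.pic n (k, z) 1) $ i $ j) (\<lambda>k. L.sol (k, z) 1 $ i $ j) sequentially"
    by (intro bounded_linear.uniform_limit[OF bounded_linear_vec_nth])
  then show "\<exists>d>0. cball l d \<subseteq> - {0} \<and> uniform_limit (cball l d) (\<lambda>N l. \<Sum>n<N. L.pic n (l, z) 1 $ i $ j) (\<lambda>l. frame l z $ i $ j) sequentially"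
    using d by (auto simp: frame_def intro!: exI[of _ d])
qed (auto intro: open_Compl)

lemma frame_SO3: "l \<noteq> 0 \<Longrightarrow> frame l z \<in> SO3"
  unfolding frame_def by (rule sol_SO3) auto

lemma smooth_frame: "l \<noteq> 0 \<Longrightarrow> smooth (frame l)"
  by (rule smooth_if_linear_equation[where P="P l" and Q="Q l" and R="\<lambda>z. 0" and T="\<lambda>z. 0"]) (auto simp: frame_has_derivative smP smQ)

end

section \<open>Frames of surfaces of constant curvature\<close>

definition sinh_gordon :: "(complex \<Rightarrow> complex) \<Rightarrow> bool" where
  "sinh_gordon \<omega> \<longleftrightarrow> smooth \<omega> \<and> (\<forall>z. pdx (pdx \<omega>) z + pdy (pdy \<omega>) z + sinh (\<omega> z) * cosh (\<omega> z) = 0)"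

text \<open>The dz-coefficient of the Maurer-Cartan form; \<open>uzb\<close> is that of the
  conjugate differential. \<mu> enters only the m-components, by 1/\<mu> here and by \<mu> there,
  exactly as \<lambda> enters an extended framing. So the scale of the coordinate and the spectral
  parameter are one parameter.\<close>

definition uz :: "complex \<Rightarrow> (complex \<Rightarrow> complex) \<Rightarrow> complex \<Rightarrow> complex^3" where
  "uz \<mu> \<omega> z = vector [\<i> * wz \<omega> z, - sinh (\<omega> z) / (2 * \<mu>), - \<i> * cosh (\<omega> z) / (2 * \<mu>)]"

definition uzb :: "complex \<Rightarrow> (complex \<Rightarrow> complex) \<Rightarrow> complex \<Rightarrow> complex^3" where
  "uzb \<mu> \<omega> z = vector [- \<i> * wzb \<omega> z, - \<mu> * sinh (\<omega> z) / 2, \<i> * \<mu> * cosh (\<omega> z) / 2]"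

text \<open>
  The columns of \<open>G\<close> are \<open>\<phi>\<close>, \<open>e2\<close>, \<open>\<epsilon> e1\<close> and \<open>\<omega>\<close> here stands for \<open>\<epsilon>\<close> times the \<open>\<omega>\<close> of the
  surface, where \<open>\<epsilon>\<close> is the sign in the definition of \<open>associated\<close>. With this choice the
  equations of the frame do not involve \<open>\<epsilon>\<close>.
\<close>

definition framed :: "complex \<Rightarrow> (complex \<Rightarrow> complex) \<Rightarrow> (complex \<Rightarrow> complex^3^3) \<Rightarrow> bool" where
  "framed \<mu> \<omega> G \<longleftrightarrow> \<mu> \<noteq> 0 \<and> sinh_gordon \<omega> \<and> smooth G \<and>
     (\<forall>z. G z \<in> SO3 \<and> mwz G z = G z ** xi (uz \<mu> \<omega> z) \<and> mwzb G z = G z ** xi (uzb \<mu> \<omega> z))"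

text \<open>\<epsilon> occurs only in the derivatives of the position: a point reflection reverses
  these and keeps the Gauss map, so it changes \<epsilon> and leaves \<omega> and G as they
  are.\<close>

definition adapted :: "csurface \<Rightarrow> (complex \<Rightarrow> complex) \<Rightarrow> complex \<Rightarrow> (complex \<Rightarrow> complex^3^3) \<Rightarrow> bool" where
  "adapted X \<omega> \<epsilon> G \<longleftrightarrow> framed (scl X) \<omega> G \<and> smooth (pos X) \<and> (\<forall>z. nrm X z = G z *v axis 1 1 \<and>
     Px X z = G z *v vector [0, 0, \<epsilon> * cosh (\<omega> z)] \<and> Py X z = G z *v vector [0, \<epsilon> * sinh (\<omega> z), 0])"

lemma scaleM_xi: "scaleM c (G ** xi u) = G ** xi (c *s u)"
  by (simp add: mat3_simps scaleM_def algebra_simps)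

lemma add_xi: "G ** xi u + G ** xi v = G ** xi (u + v)" for G :: "complex^3^3"
  by (simp add: xi_add matrix_mult.add_right)

lemma scaleM_add: "scaleM c (A + B) = scaleM c A + scaleM c B"
  and scaleM_scaleM: "scaleM c (scaleM d A) = scaleM (c * d) A"
  by (simp_all add: mat3_simps scaleM_def algebra_simps)

lemma xi_eq_iff: "G \<in> SO3 \<Longrightarrow> G ** xi u = G ** xi v \<longleftrightarrow> u = v"
  by (metis SO3_cancel(1) inv_xi)

lemma matrix_vec_eq_iff: "G \<in> SO3 \<Longrightarrow> G *v u = G *v v \<longleftrightarrow> u = v"
  by (metis SO3_cancel(5))

lemma mDx_eq: "\<mu> \<noteq> 0 \<Longrightarrow> mDx \<mu> G z = scaleM \<mu> (mwz G z) + scaleM (inverse \<mu>) (mwzb G z)"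
  and mDy_eq: "\<mu> \<noteq> 0 \<Longrightarrow> mDy \<mu> G z = scaleM (\<i> * \<mu>) (mwz G z) + scaleM (- \<i> * inverse \<mu>) (mwzb G z)"
proof -
  have 1: "(\<mu> + inverse \<mu>) / 2 + \<i> * (\<i> * (inverse \<mu> - \<mu>) / 2) = \<mu>"
    "(\<mu> + inverse \<mu>) / 2 - \<i> * (\<i> * (inverse \<mu> - \<mu>) / 2) = inverse \<mu>"
    "\<i> * (\<mu> - inverse \<mu>) / 2 + \<i> * ((\<mu> + inverse \<mu>) / 2) = \<i> * \<mu>"
    "\<i> * (\<mu> - inverse \<mu>) / 2 - \<i> * ((\<mu> + inverse \<mu>) / 2) = - \<i> * inverse \<mu>"
    by (simp_all add: field_simps)
  show "mDx \<mu> G z = scaleM \<mu> (mwz G z) + scaleM (inverse \<mu>) (mwzb G z)"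
    "mDy \<mu> G z = scaleM (\<i> * \<mu>) (mwz G z) + scaleM (- \<i> * inverse \<mu>) (mwzb G z)"
    unfolding mDx_def mDy_def mdd_eq_mwz 1 by simp_all
qed

text \<open>The Wirtinger form displays how \<mu> enters; in the other form \<mu> is hidden in
  \<open>Dx\<close> and \<open>Dy\<close>, which is how the equations arise on a surface. An
  invertible linear change relates the two pairs of derivatives.\<close>

lemma framed_equations_iff:
  assumes "\<mu> \<noteq> 0"
  shows "(mwz G z = G z ** xi (uz \<mu> \<omega> z) \<and> mwzb G z = G z ** xi (uzb \<mu> \<omega> z)) \<longleftrightarrow>
    (mDx \<mu> G z = G z ** xi (vector [Dy \<mu> \<omega> z, - sinh (\<omega> z), 0]) \<and>
     mDy \<mu> G z = G z ** xi (vector [- Dx \<mu> \<omega> z, 0, cosh (\<omega> z)]))" (is "?L \<longleftrightarrow> ?R")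
proof
  assume ?L
  then show ?R
    unfolding mDx_eq[OF assms] mDy_eq[OF assms] using assms
    by (simp add: scaleM_xi add_xi)
       (intro conjI arg_cong[where f="\<lambda>v. G z ** xi v"]; simp add: uz_def uzb_def vec3_eq_iff vector_3 Dx_def Dy_def field_simps)
next
  assume R: ?R
  have "mwz G z = scaleM (1 / (2 * \<mu>)) (mDx \<mu> G z) + scaleM (- \<i> / (2 * \<mu>)) (mDy \<mu> G z)"
    "mwzb G z = scaleM (\<mu> / 2) (mDx \<mu> G z) + scaleM (\<i> * \<mu> / 2) (mDy \<mu> G z)"
    unfolding mDx_eq[OF assms] mDy_eq[OF assms] scaleM_add scaleM_scaleM using assms
    by (simp_all add: vec_eq_iff scaleM_def field_simps)
  then show ?L
    unfolding R[THEN conjunct1] R[THEN conjunct2] using assms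
    by (simp add: scaleM_xi add_xi)
       (intro conjI arg_cong[where f="\<lambda>v. G z ** xi v"]; simp add: uz_def uzb_def vec3_eq_iff vector_3 Dx_def Dy_def field_simps)
qed

lemma framed_smooth: "framed \<mu> \<omega> G \<Longrightarrow> smooth \<omega>" "framed \<mu> \<omega> G \<Longrightarrow> smooth G" "framed \<mu> \<omega> G \<Longrightarrow> G z \<in> SO3"
  by (auto simp: framed_def sinh_gordon_def)

lemma framed_Dx:
  assumes "framed \<mu> \<omega> G"
  shows "mDx \<mu> G z = G z ** xi (vector [Dy \<mu> \<omega> z, - sinh (\<omega> z), 0])"
    "mDy \<mu> G z = G z ** xi (vector [- Dx \<mu> \<omega> z, 0, cosh (\<omega> z)])"
  using assms framed_equations_iff[of \<mu> G z \<omega>] by (auto simp: framed_def)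

lemma mdd_const_mult: "smooth G \<Longrightarrow> mdd a b (\<lambda>z. C ** G z) z = C ** mdd a b G z"
  by (simp add: mdd_mult matrix_mult.zero_left)

lemma mdd_mult_const: "smooth G \<Longrightarrow> mdd a b (\<lambda>z. G z ** C) z = mdd a b G z ** C"
  by (simp add: mdd_mult matrix_mult.zero_right)

lemma framed_left_mult:
  assumes "framed \<mu> \<omega> G" "C \<in> SO3"
  shows "framed \<mu> \<omega> (\<lambda>z. C ** G z)"
  using assms unfolding framed_def mwz_eq_mdd mwzb_eq_mdd
  by (auto simp: mdd_const_mult matrix_mul_assoc intro!: SO3_mult smooth_matrix_mult)

text \<open>A constant change of frame rotates the vectors of the Maurer-Cartan form by the inverse
  of C. It is meant for the half-turn that goes with a shift of \<omega> by i \<pi>.\<close>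

lemma framed_right_mult:
  assumes G: "framed \<mu> \<omega> G" and C: "C \<in> SO3" and \<omega>': "sinh_gordon \<omega>'"
    and u: "\<And>z. C *v uz \<mu> \<omega>' z = uz \<mu> \<omega> z" "\<And>z. C *v uzb \<mu> \<omega>' z = uzb \<mu> \<omega> z"
  shows "framed \<mu> \<omega>' (\<lambda>z. G z ** C)"
proof -
  have "G z ** xi (C *v v) ** C = G z ** C ** xi v" for v z
    using C by (simp add: xi_SO3 matrix_mul_assoc SO3_cancel)
  then show ?thesis
    using G C \<omega>' unfolding framed_def mwz_eq_mdd mwzb_eq_mdd
    by (auto simp: mdd_mult_const u[symmetric] intro!: SO3_mult smooth_matrix_mult)
qed

text \<open>The uniqueness half of the fundamental theorem of surfaces: the frames differ by a
  constant rotation C, and pos Y - C *v pos X has vanishing derivatives.\<close>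

lemma adapted_congruent:
  assumes X: "adapted X \<omega> \<epsilon> G" and Y: "adapted Y \<omega> \<epsilon> H" and s: "scl X = scl Y"
  shows "congruent X Y"
proof -
  have G: "framed (scl X) \<omega> G" and H: "framed (scl X) \<omega> H" using X Y s by (auto simp: adapted_def)
  obtain C where C: "C \<in> SO3" "\<And>z. H z = C ** G z"
    using SO3_congruent[of G "uz (scl X) \<omega>" "uzb (scl X) \<omega>" H] G H unfolding framed_def by blast
  define D where "D z = pos Y z - C *v pos X z" for z
  have sm: "smooth (pos X)" "smooth (pos Y)" using X Y by (auto simp: adapted_def)
  have smD: "smooth D" unfolding D_def using sm by (intro smooth_diff smooth_matrix_vec smooth_const)
  have d: "vdd a b D z = vdd a b (pos Y) z - C *v vdd a b (pos X) z" for a b z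
    unfolding D_def using sm by (simp add: vdd_diff vdd_matrix_vec smooth_matrix_vec)
  have "vDx (scl X) D z = 0" "vDy (scl X) D z = 0" for z
    using X Y s unfolding adapted_def
    by (simp_all add: vDx_eq_vdd vDy_eq_vdd d C(2) matrix_vector_mul_assoc)
  then have "Dx (scl X) (\<lambda>z. D z $ i) z = 0" "Dy (scl X) (\<lambda>z. D z $ i) z = 0" for i z
    by (auto simp: vDx_def vDy_def vec_eq_iff)
  then have w: "wz (\<lambda>z. D z $ i) z = 0" "wzb (\<lambda>z. D z $ i) z = 0" for i z
    using wz_eq_Dx_Dy[of "scl X" "\<lambda>z. D z $ i" z] wzb_eq_Dx_Dy[of "scl X" "\<lambda>z. D z $ i" z] G
    by (simp_all add: framed_def)
  have "D z $ i = D 0 $ i" for z i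
    by (rule wz_wzb_zero_imp_constant[where f="\<lambda>z. D z $ i"]) (use w smD in \<open>auto intro: smooth_nth\<close>)
  then have D: "D z = D 0" for z by (simp add: vec_eq_iff)
  have "pos Y z = C *v pos X z + D 0" "nrm Y z = C *v nrm X z" for z
    using D[of z] X Y C(2)[of z] by (auto simp: adapted_def matrix_vector_mul_assoc D_def algebra_simps)
  then show ?thesis unfolding congruent_def using s C(1) by blast
qed

lemma congruent_adapted:
  assumes "congruent X Y" "adapted X \<omega> \<epsilon> G"
  obtains H where "adapted Y \<omega> \<epsilon> H"
proof -
  obtain C c where C: "C \<in> SO3" "scl X = scl Y" "\<And>z. pos Y z = C *v pos X z + c" "\<And>z. nrm Y z = C *v nrm X z"
    using assms(1) unfolding congruent_def by blast
  have pY: "pos Y = (\<lambda>z. C *v pos X z + c)" using C(3) by auto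
  have sm: "smooth (pos X)" using assms(2) by (simp add: adapted_def)
  have d: "vdd a b (pos Y) z = C *v vdd a b (pos X) z" for a b z
    unfolding pY using sm by (simp add: vdd_add vdd_matrix_vec smooth_matrix_vec)
  have "adapted Y \<omega> \<epsilon> (\<lambda>z. C ** G z)"
    using assms(2) C unfolding adapted_def
    by (auto simp: vDx_eq_vdd vDy_eq_vdd d matrix_vector_mul_assoc framed_left_mult)
       (auto simp: pY sm intro!: smooth_add smooth_matrix_vec)
  then show ?thesis by (rule that)
qed

lemma congruent_sym:
  assumes "congruent X Y" shows "congruent Y X"
proof -
  obtain C c where C: "C \<in> SO3" "scl X = scl Y" "\<And>z. pos Y z = C *v pos X z + c" "\<And>z. nrm Y z = C *v nrm X z"
    using assms unfolding congruent_def by blast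
  have "pos X z = transpose C *v pos Y z + (- transpose C *v c)" "nrm X z = transpose C *v nrm Y z" for z
    using C(1) by (simp_all add: C(3,4) matrix_vector_right_distrib SO3_cancel)
      (simp add: vec3_eq_iff matrix_vec_nth3 algebra_simps)
  then show ?thesis unfolding congruent_def using C(1,2) SO3_transpose by metis
qed

section \<open>Existence of extended framings\<close>

text \<open>An extended framing in a special gauge: its value at l is the frame of the associated
  surface, in the coordinate of scale l.\<close>

definition framing :: "(complex \<Rightarrow> complex) \<Rightarrow> (complex \<Rightarrow> complex \<Rightarrow> complex^3^3) \<Rightarrow> bool" where
  "framing \<omega> \<Phi> \<longleftrightarrow> (\<forall>l. l \<noteq> 0 \<longrightarrow> framed l \<omega> (\<Phi> l)) \<and>
     continuous_on ((- {0}) \<times> UNIV) (\<lambda>(l, z). \<Phi> l z) \<and>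
     (\<forall>z i j. (\<lambda>l. \<Phi> l z $ i $ j) holomorphic_on - {0})"

lemma pd_matrix:
  assumes "smooth M"
  shows "pdx M z = mdd 1 0 M z" "pdy M z = mdd 0 1 M z"
proof -
  have D: "((\<lambda>z. M z $ i $ j) has_derivative (\<lambda>h. (Re h *\<^sub>R pdx M z + Im h *\<^sub>R pdy M z) $ i $ j)) (at z)" for i j
    by (intro bounded_linear.has_derivative[OF bounded_linear_vec_nth] smooth_has_derivative[OF assms])
  show "pdx M z = mdd 1 0 M z" "pdy M z = mdd 0 1 M z"
    using pdx_eqI[OF D] pdy_eqI[OF D] by (simp_all add: vec_eq_iff mdd_def dd_def)
qed

lemma mdd_eq_pd: "smooth M \<Longrightarrow> mdd a b M z = scaleM a (pdx M z) + scaleM b (pdy M z)"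
  by (simp add: pd_matrix) (simp add: vec_eq_iff mdd_def dd_def scaleM_def)

lemma mdd_xi: "smooth v \<Longrightarrow> mdd a b (\<lambda>z. xi (v z)) z = xi (vdd a b v z)"
  by (simp add: vec3_eq_iff mdd_def vdd_def xi_nth dd_uminus smooth_nth)

lemma continuous_on_xi_vector3:
  assumes "continuous_on S f" "continuous_on S g" "continuous_on S h"
  shows "continuous_on S (\<lambda>x. xi (vector [f x, g x, h x]))"
proof -
  have "continuous_on S (\<lambda>x. xi (vector [f x, g x, h x]) $ i $ j)" for i j
    using exhaust_3[of i] exhaust_3[of j] assms
    by (elim disjE) (simp_all add: xi_nth vector_3 continuous_on_minus)
  then have "continuous_on S (\<lambda>x. \<chi> i j. xi (vector [f x, g x, h x]) $ i $ j)"
    by (intro continuous_on_vec_lambda)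
  then show ?thesis by simp
qed

lemma holomorphic_on_xi_vector3:
  assumes "f holomorphic_on S" "g holomorphic_on S" "h holomorphic_on S"
  shows "(\<lambda>x. xi (vector [f x, g x, h x]) $ i $ j) holomorphic_on S"
  using exhaust_3[of i] exhaust_3[of j] assms
  by (elim disjE) (simp_all add: xi_nth vector_3 holomorphic_on_minus)

lemma xi_commutator: "xi u ** xi v - xi v ** xi u = xi (ccross u v)"
  by (simp add: mat3_simps ccross_def vector_3)

text \<open>With p and q the dx- and dy-coefficients, the spectral parameter enters the
  compatibility condition only through a^2 + b^2 = 1, so a single sinh-Gordon equation gives
  flatness for all l.\<close>

lemma framing_exists:
  assumes sg: "sinh_gordon \<omega>"
  obtains \<Phi> where "framing \<omega> \<Phi>"
proof -
  \<comment> \<open>For l = exp (i \<tau>) these are cos \<tau> and - sin \<tau>; the formulas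
    continue them to all nonzero l.\<close>
  define a where "a l = (l + inverse l) / 2" for l :: complex
  define b where "b l = \<i> * (l - inverse l) / 2" for l :: complex
  have ab: "a l * a l + b l * b l = 1" if "l \<noteq> 0" for l
    using that by (simp add: a_def b_def field_simps)
  define p where "p l z = (vector [pdy \<omega> z, - (a l * sinh (\<omega> z)), b l * cosh (\<omega> z)] :: complex^3)" for l z
  define q where "q l z = (vector [- pdx \<omega> z, b l * sinh (\<omega> z), a l * cosh (\<omega> z)] :: complex^3)" for l z
  have sm: "smooth \<omega>" and pde: "\<And>z. pdx (pdx \<omega>) z + pdy (pdy \<omega>) z = - (sinh (\<omega> z) * cosh (\<omega> z))"
    using sg by (auto simp: sinh_gordon_def add_eq_0_iff2)
  note smpd = smooth_pdx[OF sm] smooth_pdy[OF sm] smooth_sinh[OF sm] smooth_cosh[OF sm]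
  note smpd2 = smpd smooth_pdx[OF smooth_pdx[OF sm]] smooth_pdx[OF smooth_pdy[OF sm]]
    smooth_pdy[OF smooth_pdx[OF sm]] smooth_pdy[OF smooth_pdy[OF sm]]
  have smp: "smooth (p l)" and smq: "smooth (q l)" for l
    unfolding p_def[abs_def] q_def[abs_def] by (intro smooth_vector3 smooth_uminus smooth_mult smooth_const smpd)+
  have d: "dd s t (\<lambda>z. - (k * sinh (\<omega> z))) z = - (k * (cosh (\<omega> z) * dd s t \<omega> z))"
    "dd s t (\<lambda>z. k * sinh (\<omega> z)) z = k * (cosh (\<omega> z) * dd s t \<omega> z)"
    "dd s t (\<lambda>z. k * cosh (\<omega> z)) z = k * (sinh (\<omega> z) * dd s t \<omega> z)"
    "dd s t (\<lambda>z. - pdx \<omega> z) z = - dd s t (pdx \<omega>) z" for s t k z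
    by (simp_all add: dd_uminus dd_cmult dd_sinh dd_cosh sm smpd smooth_mult)
  have pdp: "pdx (\<lambda>z. xi (p l z)) z = xi (vector [pdx (pdy \<omega>) z, - (a l * (cosh (\<omega> z) * pdx \<omega> z)), b l * (sinh (\<omega> z) * pdx \<omega> z)])"
    "pdy (\<lambda>z. xi (p l z)) z = xi (vector [pdy (pdy \<omega>) z, - (a l * (cosh (\<omega> z) * pdy \<omega> z)), b l * (sinh (\<omega> z) * pdy \<omega> z)])"
    and pdq: "pdx (\<lambda>z. xi (q l z)) z = xi (vector [- pdx (pdx \<omega>) z, b l * (cosh (\<omega> z) * pdx \<omega> z), a l * (sinh (\<omega> z) * pdx \<omega> z)])"
    "pdy (\<lambda>z. xi (q l z)) z = xi (vector [- pdy (pdx \<omega>) z, b l * (cosh (\<omega> z) * pdy \<omega> z), a l * (sinh (\<omega> z) * pdy \<omega> z)])" for l z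
    unfolding pd_matrix[OF smooth_xi[OF smp]] mdd_xi[OF smp] pd_matrix[OF smooth_xi[OF smq]] mdd_xi[OF smq]
    unfolding p_def[abs_def] q_def[abs_def] vdd_vector3
    by (simp_all add: d) (simp_all add: dd_def)
  have c: "continuous_on ((- {0}) \<times> UNIV) (\<lambda>x. f (snd x))" if "smooth f" for f :: "complex \<Rightarrow> complex"
    by (rule continuous_on_compose2[OF smooth_imp_continuous_on[OF that, of UNIV]]) (auto intro!: continuous_intros)
  have ci: "continuous_on ((- {0}) \<times> UNIV) (\<lambda>x :: complex \<times> complex. inverse (fst x))"
    by (intro continuous_intros) auto
  have cc: "continuous_on ((- {0}) \<times> UNIV) (\<lambda>x :: complex \<times> complex. a (fst x))"
    "continuous_on ((- {0}) \<times> UNIV) (\<lambda>x :: complex \<times> complex. b (fst x))"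
    unfolding a_def b_def by (intro continuous_intros ci; simp)+
  have hol: "a holomorphic_on - {0}" "b holomorphic_on - {0}"
    unfolding a_def[abs_def] b_def[abs_def] by (intro holomorphic_intros; auto)+
  interpret flat_connection "\<lambda>l z. xi (p l z)" "\<lambda>l z. xi (q l z)"
  proof
    show "pdy (\<lambda>z. xi (p l z)) z - pdx (\<lambda>z. xi (q l z)) z = xi (p l z) ** xi (q l z) - xi (q l z) ** xi (p l z)"
      if l: "l \<noteq> 0" for l z
    proof -
      \<comment> \<open>The sinh-Gordon equation, with its coefficient 1 written as a^2 + b^2 to
        match the commutator.\<close>
      have *: "pdy (pdy \<omega>) z = - pdx (pdx \<omega>) z - (a l * a l + b l * b l) * (sinh (\<omega> z) * cosh (\<omega> z))"
        unfolding ab[OF l] using pde[of z] by (simp add: eq_neg_iff_add_eq_0 algebra_simps)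
      show ?thesis
        unfolding pdp pdq unfolding xi_commutator p_def q_def ccross_def
        by (simp add: * vec3_eq_iff xi_nth vector_3 algebra_simps)
    qed
    show "smooth (\<lambda>z. xi (p l z))" "smooth (\<lambda>z. xi (q l z))" for l by (intro smooth_xi smp smq)+
    show "transpose (xi (p l z)) = - xi (p l z)" "transpose (xi (q l z)) = - xi (q l z)" for l z
      by (simp_all add: transpose_xi)
    show "(\<lambda>l. xi (p l z) $ i $ j) holomorphic_on - {0}" "(\<lambda>l. xi (q l z) $ i $ j) holomorphic_on - {0}" for z i j
      unfolding p_def q_def by (intro holomorphic_on_xi_vector3 holomorphic_intros hol)+
    show "continuous_on ((- {0}) \<times> UNIV) (\<lambda>(l, z). xi (p l z))" "continuous_on ((- {0}) \<times> UNIV) (\<lambda>(l, z). xi (q l z))"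
      unfolding p_def q_def case_prod_unfold
      by (intro continuous_on_xi_vector3 continuous_on_minus continuous_on_mult c cc smpd)+
    show "continuous_on ((- {0}) \<times> UNIV) (\<lambda>(l, z). pdx (\<lambda>z. xi (p l z)) z)"
      "continuous_on ((- {0}) \<times> UNIV) (\<lambda>(l, z). pdy (\<lambda>z. xi (p l z)) z)"
      "continuous_on ((- {0}) \<times> UNIV) (\<lambda>(l, z). pdx (\<lambda>z. xi (q l z)) z)"
      "continuous_on ((- {0}) \<times> UNIV) (\<lambda>(l, z). pdy (\<lambda>z. xi (q l z)) z)"
      unfolding pdp pdq case_prod_unfold
      by (intro continuous_on_xi_vector3 continuous_on_minus continuous_on_mult c cc smpd2)+
  qed
  have "framed l \<omega> (frame l)" if l: "l \<noteq> 0" for l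
    unfolding framed_def
  proof (intro conjI allI)
    fix z
    have pd: "pdx (frame l) z = frame l z ** xi (p l z)" "pdy (frame l) z = frame l z ** xi (q l z)"
      using pdx_eqI[OF frame_has_derivative[OF l]] pdy_eqI[OF frame_has_derivative[OF l]] by simp_all
    have v: "(1/2) *s p l z + (- \<i> / 2) *s q l z = uz l \<omega> z" "(1/2) *s p l z + (\<i> / 2) *s q l z = uzb l \<omega> z"
      using l by (simp_all add: uz_def uzb_def p_def q_def a_def b_def vec3_eq_iff vector_3 wz_def wzb_def field_simps)
    show "mwz (frame l) z = frame l z ** xi (uz l \<omega> z)" "mwzb (frame l) z = frame l z ** xi (uzb l \<omega> z)"
      unfolding mwz_eq_mdd mwzb_eq_mdd mdd_eq_pd[OF smooth_frame[OF l]] pd scaleM_xi add_xi v by simp_all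
  qed (use l sg smooth_frame frame_SO3 in auto)
  then show ?thesis
    using continuous_frame holomorphic_frame by (intro that[of frame]) (auto simp: framing_def)
qed

section \<open>The Sym formula\<close>

text \<open>The linearization error D k is holomorphic in the parameter k and small on a whole disc
  around l. Cauchy's inequality therefore bounds its derivative in k, which is the linearization
  error of the differentiated family.\<close>

lemma deriv_param_has_derivative:
  fixes f A B :: "complex \<Rightarrow> complex \<Rightarrow> complex"
  assumes d: "\<And>l z. l \<in> U \<Longrightarrow> (f l has_derivative (\<lambda>h. Re h *\<^sub>R A l z + Im h *\<^sub>R B l z)) (at z)"
    and U: "open U" and l: "l \<in> U"
    and hf: "\<And>z. (\<lambda>l. f l z) holomorphic_on U"
    and hA: "\<And>z. (\<lambda>l. A l z) holomorphic_on U" and hB: "\<And>z. (\<lambda>l. B l z) holomorphic_on U"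
    and cA: "continuous_on (U \<times> UNIV) (\<lambda>x. A (fst x) (snd x))"
    and cB: "continuous_on (U \<times> UNIV) (\<lambda>x. B (fst x) (snd x))"
  shows "((\<lambda>z. deriv (\<lambda>k. f k z) l) has_derivative
    (\<lambda>h. Re h *\<^sub>R deriv (\<lambda>k. A k z) l + Im h *\<^sub>R deriv (\<lambda>k. B k z) l)) (at z)"
  unfolding has_derivative_at_alt
proof (intro conjI allI impI)
  show "bounded_linear (\<lambda>h. Re h *\<^sub>R deriv (\<lambda>k. A k z) l + Im h *\<^sub>R deriv (\<lambda>k. B k z) l)"
    by (intro bounded_linear_add bounded_linear_compose[OF bounded_linear_scaleR_left] bounded_linear_Re bounded_linear_Im)
  fix e :: real assume "e > 0"
  obtain r where r: "r > 0" "cball l r \<subseteq> U" using U l open_contains_cball by blast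
  \<comment> \<open>A and B contribute one \<open>e'\<close> each and Cauchy's inequality divides by
    r, so that 2 e' / r = e.\<close>
  define e' where "e' = e * r / 2"
  have e': "e' > 0" using \<open>e > 0\<close> r by (simp add: e'_def)
  have "\<exists>X. z \<in> X \<and> open X \<and> (\<forall>w\<in>X. \<forall>k\<in>cball l r. dist (F k w) (F k z) \<le> e')"
    if "continuous_on (U \<times> UNIV) (\<lambda>x. F (fst x) (snd x))" for F :: "complex \<Rightarrow> complex \<Rightarrow> complex"
  proof -
    have c: "continuous_on (UNIV \<times> cball l r) (\<lambda>x. F (snd x) (fst x))"
      by (rule continuous_on_compose2[OF that, of _ "\<lambda>x. (snd x, fst x)", unfolded fst_conv snd_conv])
         (use r in \<open>auto intro!: continuous_intros\<close>)
    show ?thesis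
      by (rule continuous_on_prod_compactE[OF c compact_cball UNIV_I[of z] e']) auto
  qed
  from this[OF cA] this[OF cB] obtain X Y where X: "z \<in> X" "open X" "\<forall>w\<in>X. \<forall>k\<in>cball l r. dist (A k w) (A k z) \<le> e'"
    and Y: "z \<in> Y" "open Y" "\<forall>w\<in>Y. \<forall>k\<in>cball l r. dist (B k w) (B k z) \<le> e'" by blast
  have "open (X \<inter> Y)" "z \<in> X \<inter> Y" using X Y by auto
  then obtain \<delta> where \<delta>: "\<delta> > 0" "ball z \<delta> \<subseteq> X \<inter> Y" using open_contains_ball by blast
  show "\<exists>d>0. \<forall>w. norm (w - z) < d \<longrightarrow> norm (deriv (\<lambda>k. f k w) l - deriv (\<lambda>k. f k z) l -
      (Re (w - z) *\<^sub>R deriv (\<lambda>k. A k z) l + Im (w - z) *\<^sub>R deriv (\<lambda>k. B k z) l)) \<le> e * norm (w - z)"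
  proof (intro exI[of _ \<delta>] conjI allI impI)
    fix w assume w: "norm (w - z) < \<delta>"
    define D where "D k = f k w - f k z - (of_real (Re (w - z)) * A k z + of_real (Im (w - z)) * B k z)" for k
    have bound: "norm (D k) \<le> norm (w - z) * (2 * e')" if k: "k \<in> cball l r" for k
    proof -
      have "norm (f k w - f k z - (Re (w - z) *\<^sub>R A k z + Im (w - z) *\<^sub>R B k z)) \<le> norm (w - z) * (2 * e')"
      proof (rule differentiable_bound_linearization[where S="ball z \<delta>" and f'="\<lambda>x h. Re h *\<^sub>R A k x + Im h *\<^sub>R B k x" and ?x0.0=z])
        show "z + t *\<^sub>R (w - z) \<in> ball z \<delta>" if "t \<in> {0..1}" for t
        proof -
          have "norm (t *\<^sub>R (w - z)) \<le> norm (w - z)" using that by (simp add: mult_left_le_one_le)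
          then show ?thesis using w by (simp add: dist_norm)
        qed
        show "(f k has_derivative (\<lambda>h. Re h *\<^sub>R A k x + Im h *\<^sub>R B k x)) (at x within ball z \<delta>)" for x
          using d[OF subsetD[OF r(2) k]] by (rule has_derivative_at_withinI)
        show "onorm ((\<lambda>h. Re h *\<^sub>R A k x + Im h *\<^sub>R B k x) - (\<lambda>h. Re h *\<^sub>R A k z + Im h *\<^sub>R B k z)) \<le> 2 * e'"
          if x: "x \<in> ball z \<delta>" for x
        proof (rule onorm_le)
          fix h
          have AB: "norm (A k x - A k z) \<le> e'" "norm (B k x - B k z) \<le> e'"
            using X(3) Y(3) \<delta>(2) x k by (auto simp: dist_norm)
          have "((\<lambda>h. Re h *\<^sub>R A k x + Im h *\<^sub>R B k x) - (\<lambda>h. Re h *\<^sub>R A k z + Im h *\<^sub>R B k z)) h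
              = Re h *\<^sub>R (A k x - A k z) + Im h *\<^sub>R (B k x - B k z)"
            by (simp add: algebra_simps)
          also have "norm \<dots> \<le> \<bar>Re h\<bar> * norm (A k x - A k z) + \<bar>Im h\<bar> * norm (B k x - B k z)"
            by (rule order_trans[OF norm_triangle_ineq]) simp
          also have "\<dots> \<le> norm h * e' + norm h * e'"
            using AB abs_Re_le_cmod abs_Im_le_cmod by (intro add_mono mult_mono) auto
          finally show "norm (((\<lambda>h. Re h *\<^sub>R A k x + Im h *\<^sub>R B k x) - (\<lambda>h. Re h *\<^sub>R A k z + Im h *\<^sub>R B k z)) h) \<le> 2 * e' * norm h"
            by simp
        qed
      qed (use \<delta> in simp)
      then show ?thesis by (simp add: D_def scaleR_conv_of_real)
    qed
    have holD: "D holomorphic_on U" unfolding D_def[abs_def] by (intro holomorphic_intros hf hA hB)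
    have "norm ((deriv ^^ 1) D l) \<le> fact 1 * (norm (w - z) * (2 * e')) / r ^ 1"
    proof (rule Cauchy_inequality)
      show "D holomorphic_on ball l r" using holD r(2) ball_subset_cball holomorphic_on_subset by (meson subset_trans)
      show "continuous_on (cball l r) D" using holD r(2) by (meson continuous_on_subset holomorphic_on_imp_continuous_on)
      show "norm (D k) \<le> norm (w - z) * (2 * e')" if "norm (l - k) = r" for k
        using bound[of k] that by (simp add: dist_norm)
    qed (rule r)
    then have 1: "norm (deriv D l) \<le> e * norm (w - z)" using r by (simp add: e'_def mult.commute)
    have 2: "deriv D l = deriv (\<lambda>k. f k w) l - deriv (\<lambda>k. f k z) l -
        (of_real (Re (w - z)) * deriv (\<lambda>k. A k z) l + of_real (Im (w - z)) * deriv (\<lambda>k. B k z) l)"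
      unfolding D_def
      by (rule DERIV_imp_deriv) (intro DERIV_diff DERIV_add DERIV_cmult holomorphic_derivI[OF _ U l] hf hA hB)
    show "norm (deriv (\<lambda>k. f k w) l - deriv (\<lambda>k. f k z) l -
      (Re (w - z) *\<^sub>R deriv (\<lambda>k. A k z) l + Im (w - z) *\<^sub>R deriv (\<lambda>k. B k z) l)) \<le> e * norm (w - z)"
      using 1 unfolding 2 by (simp add: scaleR_conv_of_real)
  qed (rule \<delta>)
qed

lemma has_derivative_vecI:
  fixes f :: "'a::real_normed_vector \<Rightarrow> 'b::real_normed_vector^'n"
  assumes "\<And>i. ((\<lambda>z. f z $ i) has_derivative (\<lambda>h. D h $ i)) F"
  shows "(f has_derivative D) F"
proof -
  have "((\<lambda>z. \<Sum>i\<in>UNIV. axis i (f z $ i)) has_derivative (\<lambda>h. \<Sum>i\<in>UNIV. axis i (D h $ i))) F"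
    by (intro has_derivative_sum bounded_linear.has_derivative[OF bounded_linear_axis] assms)
  then show ?thesis by (simp add: vec_eq_sum_axis[symmetric])
qed

section \<open>Variation of a framing in the spectral parameter\<close>

lemma transpose_scaleM: "transpose (scaleM c A) = scaleM c (transpose A)"
  and scaleM_uminus: "scaleM c (- A) = - scaleM c A"
  by (simp_all add: vec_eq_iff transpose_nth scaleM_def)

lemma matrix_vec_smult: "A *v (c *s u) = c *s (A *v u)" for A :: "complex^3^3"
  by (simp add: vec3_eq_iff matrix_vec_nth3 algebra_simps)

definition dlam :: "(complex \<Rightarrow> complex \<Rightarrow> complex^3^3) \<Rightarrow> complex \<Rightarrow> complex \<Rightarrow> complex^3^3" where
  "dlam \<Phi> l z = (\<chi> i j. deriv (\<lambda>k. \<Phi> k z $ i $ j) l)"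

text \<open>\<open>px\<close> and \<open>py\<close> are the dx- and dy-coefficients of the
  Maurer-Cartan form at spectral parameter k, and \<open>dpx\<close>, \<open>dpy\<close> are their
  derivatives in k.\<close>

definition px :: "(complex \<Rightarrow> complex) \<Rightarrow> complex \<Rightarrow> complex \<Rightarrow> complex^3" where
  "px \<omega> k z = vector [\<i> * wz \<omega> z - \<i> * wzb \<omega> z, - ((inverse k + k) * (sinh (\<omega> z) / 2)), - \<i> * ((inverse k - k) * (cosh (\<omega> z) / 2))]"

definition py :: "(complex \<Rightarrow> complex) \<Rightarrow> complex \<Rightarrow> complex \<Rightarrow> complex^3" where
  "py \<omega> k z = vector [- (wz \<omega> z + wzb \<omega> z), - \<i> * ((inverse k - k) * (sinh (\<omega> z) / 2)), (inverse k + k) * (cosh (\<omega> z) / 2)]"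

definition dpx :: "(complex \<Rightarrow> complex) \<Rightarrow> complex \<Rightarrow> complex \<Rightarrow> complex^3" where
  "dpx \<omega> k z = vector [0, (inverse k * inverse k - 1) * (sinh (\<omega> z) / 2), \<i> * ((inverse k * inverse k + 1) * (cosh (\<omega> z) / 2))]"

definition dpy :: "(complex \<Rightarrow> complex) \<Rightarrow> complex \<Rightarrow> complex \<Rightarrow> complex^3" where
  "dpy \<omega> k z = vector [0, \<i> * ((inverse k * inverse k + 1) * (sinh (\<omega> z) / 2)), - ((inverse k * inverse k - 1) * (cosh (\<omega> z) / 2))]"

lemma pd_framed:
  assumes "framed l \<omega> G"
  shows "pdx G z = G z ** xi (px \<omega> l z)" "pdy G z = G z ** xi (py \<omega> l z)"
proof -
  have l: "l \<noteq> 0" and G: "smooth G" "mwz G z = G z ** xi (uz l \<omega> z)" "mwzb G z = G z ** xi (uzb l \<omega> z)"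
    using assms by (auto simp: framed_def)
  have v: "1 *s uz l \<omega> z + 1 *s uzb l \<omega> z = px \<omega> l z" "\<i> *s uz l \<omega> z + (- \<i>) *s uzb l \<omega> z = py \<omega> l z"
    using l by (simp_all add: vec3_eq_iff vector_3 uz_def uzb_def px_def py_def field_simps)
  show "pdx G z = G z ** xi (px \<omega> l z)" "pdy G z = G z ** xi (py \<omega> l z)"
    unfolding pd_matrix[OF G(1)] mdd_eq_mwz G scaleM_xi add_xi v[symmetric] by simp_all
qed

lemma field_derivative_xi_vector3:
  assumes "(f has_field_derivative f') (at l)" "(g has_field_derivative g') (at l)" "(h has_field_derivative h') (at l)"
  shows "((\<lambda>k. xi (vector [f k, g k, h k]) $ i $ j) has_field_derivative xi (vector [f', g', h']) $ i $ j) (at l)"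
  using exhaust_3[of i] exhaust_3[of j] assms
  by (elim disjE) (simp_all add: xi_nth vector_3 DERIV_minus)

lemma field_derivative_px:
  assumes "k \<noteq> 0"
  shows "((\<lambda>k. xi (px \<omega> k z) $ i $ j) has_field_derivative xi (dpx \<omega> k z) $ i $ j) (at k)"
    "((\<lambda>k. xi (py \<omega> k z) $ i $ j) has_field_derivative xi (dpy \<omega> k z) $ i $ j) (at k)"
  unfolding px_def py_def dpx_def dpy_def using assms
  by (intro field_derivative_xi_vector3; auto intro!: derivative_eq_intros simp: field_simps)+

lemma field_derivative_matrix_mult:
  fixes M N :: "complex \<Rightarrow> complex^3^3"
  assumes "\<And>i j. ((\<lambda>k. M k $ i $ j) has_field_derivative M' $ i $ j) (at l)"
    "\<And>i j. ((\<lambda>k. N k $ i $ j) has_field_derivative N' $ i $ j) (at l)"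
  shows "((\<lambda>k. (M k ** N k) $ i $ j) has_field_derivative (M' ** N l + M l ** N') $ i $ j) (at l)"
  unfolding matrix_mult_nth3 vector_add_component
  by (rule DERIV_cong) (auto intro!: derivative_eq_intros assms simp: algebra_simps)

lemma smooth_px: "smooth \<omega> \<Longrightarrow> smooth (px \<omega> l)" "smooth \<omega> \<Longrightarrow> smooth (py \<omega> l)"
  "smooth \<omega> \<Longrightarrow> smooth (dpx \<omega> l)" "smooth \<omega> \<Longrightarrow> smooth (dpy \<omega> l)"
  unfolding px_def[abs_def] py_def[abs_def] dpx_def[abs_def] dpy_def[abs_def]
  by (intro smooth_vector3 smooth_const smooth_uminus smooth_mult smooth_add smooth_diff smooth_divide_const smooth_wz smooth_wzb smooth_sinh smooth_cosh; assumption)+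

context
  fixes \<omega> :: "complex \<Rightarrow> complex" and \<Phi> :: "complex \<Rightarrow> complex \<Rightarrow> complex^3^3"
  assumes F: "framing \<omega> \<Phi>"
begin

lemma framing_framed: "l \<noteq> 0 \<Longrightarrow> framed l \<omega> (\<Phi> l)"
  using F by (simp add: framing_def)

lemma framing_dlam: "l \<noteq> 0 \<Longrightarrow> ((\<lambda>k. \<Phi> k z $ i $ j) has_field_derivative dlam \<Phi> l z $ i $ j) (at l)"
  using F unfolding framing_def dlam_def
  by (auto intro!: holomorphic_derivI[where S="- {0}"] open_Compl)

text \<open>The spectral derivative solves the linear system of the framing with an inhomogeneity,
  which comes from the dependence of the coefficients on the parameter.\<close>

lemma dlam_has_derivative:
  assumes l: "l \<noteq> 0"
  shows "(dlam \<Phi> l has_derivative (\<lambda>h. Re h *\<^sub>R (dlam \<Phi> l z ** xi (px \<omega> l z) + \<Phi> l z ** xi (dpx \<omega> l z)) +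
    Im h *\<^sub>R (dlam \<Phi> l z ** xi (py \<omega> l z) + \<Phi> l z ** xi (dpy \<omega> l z)))) (at z)"
proof (intro has_derivative_vecI)
  fix i j
  have sm: "smooth \<omega>" using framing_framed[OF l] by (rule framed_smooth)
  let ?A = "\<lambda>k z. (\<Phi> k z ** xi (px \<omega> k z)) $ i $ j" and ?B = "\<lambda>k z. (\<Phi> k z ** xi (py \<omega> k z)) $ i $ j"
  have A: "((\<lambda>k. ?A k z) has_field_derivative (dlam \<Phi> k z ** xi (px \<omega> k z) + \<Phi> k z ** xi (dpx \<omega> k z)) $ i $ j) (at k)" if "k \<noteq> 0" for k z
    by (intro field_derivative_matrix_mult framing_dlam field_derivative_px that)
  have B: "((\<lambda>k. ?B k z) has_field_derivative (dlam \<Phi> k z ** xi (py \<omega> k z) + \<Phi> k z ** xi (dpy \<omega> k z)) $ i $ j) (at k)" if "k \<noteq> 0" for k z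
    by (intro field_derivative_matrix_mult framing_dlam field_derivative_px that)
  have c: "continuous_on ((- {0}) \<times> UNIV) (\<lambda>x. f (snd x))" if "smooth f" for f :: "complex \<Rightarrow> complex"
    by (rule continuous_on_compose2[OF smooth_imp_continuous_on[OF that, of UNIV]]) (auto intro!: continuous_intros)
  have ci: "continuous_on ((- {0}) \<times> UNIV) (\<lambda>x :: complex \<times> complex. inverse (fst x))"
    by (intro continuous_intros) auto
  have c\<Phi>: "continuous_on ((- {0}) \<times> UNIV) (\<lambda>x. \<Phi> (fst x) (snd x))"
    using F by (simp add: framing_def case_prod_unfold)
  have cp: "continuous_on ((- {0}) \<times> UNIV) (\<lambda>x. xi (px \<omega> (fst x) (snd x)))" "continuous_on ((- {0}) \<times> UNIV) (\<lambda>x. xi (py \<omega> (fst x) (snd x)))"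
    unfolding px_def py_def
    by (intro continuous_on_xi_vector3 continuous_on_minus continuous_on_add continuous_on_diff continuous_on_mult continuous_on_const continuous_on_fst continuous_on_id
      continuous_on_divide ci c smooth_wz smooth_wzb smooth_sinh smooth_cosh sm; simp)+
  have "((\<lambda>z. deriv (\<lambda>k. \<Phi> k z $ i $ j) l) has_derivative
     (\<lambda>h. Re h *\<^sub>R deriv (\<lambda>k. ?A k z) l + Im h *\<^sub>R deriv (\<lambda>k. ?B k z) l)) (at z)"
  proof (rule deriv_param_has_derivative[where U="- {0}"])
    show "((\<lambda>z. \<Phi> k z $ i $ j) has_derivative (\<lambda>h. Re h *\<^sub>R ?A k z + Im h *\<^sub>R ?B k z)) (at z)" if "k \<in> - {0}" for k z
    proof -
      have k: "framed k \<omega> (\<Phi> k)" using that framing_framed by auto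
      have "((\<lambda>z. \<Phi> k z $ i $ j) has_derivative (\<lambda>h. (Re h *\<^sub>R pdx (\<Phi> k) z + Im h *\<^sub>R pdy (\<Phi> k) z) $ i $ j)) (at z)"
        by (intro bounded_linear.has_derivative[OF bounded_linear_vec_nth] smooth_has_derivative framed_smooth(2)[OF k])
      then show ?thesis by (simp add: pd_framed[OF k])
    qed
    show "(\<lambda>k. \<Phi> k z $ i $ j) holomorphic_on - {0}" for z using F by (simp add: framing_def)
    show "(\<lambda>k. ?A k z) holomorphic_on - {0}" "(\<lambda>k. ?B k z) holomorphic_on - {0}" for z
      unfolding holomorphic_on_open[OF open_Compl[OF closed_singleton]] using A B by blast+
    show "continuous_on ((- {0}) \<times> UNIV) (\<lambda>x. ?A (fst x) (snd x))" "continuous_on ((- {0}) \<times> UNIV) (\<lambda>x. ?B (fst x) (snd x))"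
      by (intro continuous_on_component matrix_mult.continuous_on c\<Phi> cp)+
  qed (use l in \<open>auto simp: open_Compl\<close>)
  then show "((\<lambda>z. dlam \<Phi> l z $ i $ j) has_derivative (\<lambda>h. (Re h *\<^sub>R (dlam \<Phi> l z ** xi (px \<omega> l z) + \<Phi> l z ** xi (dpx \<omega> l z)) +
    Im h *\<^sub>R (dlam \<Phi> l z ** xi (py \<omega> l z) + \<Phi> l z ** xi (dpy \<omega> l z))) $ i $ j)) (at z)"
    using DERIV_imp_deriv[OF A[OF l, of z]] DERIV_imp_deriv[OF B[OF l, of z]] by (simp add: dlam_def)
qed

lemma smooth_dlam:
  assumes l: "l \<noteq> 0"
  shows "smooth (dlam \<Phi> l)"
proof -
  note f = framed_smooth[OF framing_framed[OF l]]
  show ?thesis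
    by (rule smooth_if_linear_equation[OF dlam_has_derivative[OF l]])
       (intro smooth_matrix_mult smooth_xi smooth_px f)+
qed

lemma mdd_dlam:
  assumes l: "l \<noteq> 0"
  shows "mdd a b (dlam \<Phi> l) z = dlam \<Phi> l z ** xi (a *s px \<omega> l z + b *s py \<omega> l z) + \<Phi> l z ** xi (a *s dpx \<omega> l z + b *s dpy \<omega> l z)"
proof -
  have "pdx (dlam \<Phi> l) z = dlam \<Phi> l z ** xi (px \<omega> l z) + \<Phi> l z ** xi (dpx \<omega> l z)"
    "pdy (dlam \<Phi> l) z = dlam \<Phi> l z ** xi (py \<omega> l z) + \<Phi> l z ** xi (dpy \<omega> l z)"
    using pdx_eqI[OF dlam_has_derivative[OF l]] pdy_eqI[OF dlam_has_derivative[OF l]] by simp_all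
  then show ?thesis
    by (simp add: mdd_eq_pd[OF smooth_dlam[OF l]] scaleM_add scaleM_xi add_xi[symmetric] algebra_simps)
qed

text \<open>Differentiating \<Phi> ** transpose \<Phi> = mat 1 in the spectral parameter makes the
  matrix of the Sym formula antisymmetric, so \<open>inv xi\<close> in \<open>sym_pos\<close>
  inverts \<open>xi\<close> on it.\<close>

lemma xi_sym_pos:
  assumes l: "l \<noteq> 0"
  shows "xi (sym_pos \<Phi> l z) = scaleM (- \<i> * l) (dlam \<Phi> l z ** transpose (\<Phi> l z))"
proof -
  have SO: "\<Phi> k z \<in> SO3" if "k \<noteq> 0" for k using framed_smooth(3)[OF framing_framed[OF that]] .
  have "dlam \<Phi> l z ** transpose (\<Phi> l z) + \<Phi> l z ** transpose (dlam \<Phi> l z) = 0"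
  proof -
    have "((\<lambda>k. (\<Phi> k z ** transpose (\<Phi> k z)) $ i $ j) has_field_derivative
        (dlam \<Phi> l z ** transpose (\<Phi> l z) + \<Phi> l z ** transpose (dlam \<Phi> l z)) $ i $ j) (at l)" for i j
      by (rule field_derivative_matrix_mult) (simp_all add: transpose_nth framing_dlam[OF l])
    moreover have "((\<lambda>k. (\<Phi> k z ** transpose (\<Phi> k z)) $ i $ j) has_field_derivative 0) (at l)" for i j
      by (rule has_field_derivative_transform_within_open[where f="\<lambda>k. (mat 1 :: complex^3^3) $ i $ j" and S="- {0}"])
         (use l SO in \<open>auto simp: SO3_mult_transpose open_Compl\<close>)
    ultimately show ?thesis using DERIV_unique by (fastforce simp: vec_eq_iff)
  qed
  then have *: "transpose (dlam \<Phi> l z ** transpose (\<Phi> l z)) = - (dlam \<Phi> l z ** transpose (\<Phi> l z))"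
    by (simp add: matrix_transpose_mul eq_neg_iff_add_eq_0 add.commute)
  have "transpose (scaleM (- \<i> * l) (dlam \<Phi> l z ** transpose (\<Phi> l z))) = - scaleM (- \<i> * l) (dlam \<Phi> l z ** transpose (\<Phi> l z))"
    by (simp only: transpose_scaleM * scaleM_uminus)
  then show ?thesis
    using SO[OF l] unfolding sym_pos_def dlam_def by (simp add: SO3_matrix_inv xi_inv_antisym)
qed

lemma smooth_sym_pos:
  assumes l: "l \<noteq> 0"
  shows "smooth (sym_pos \<Phi> l)"
proof (rule smooth_vec)
  fix i
  have "smooth (\<lambda>z. xi (sym_pos \<Phi> l z))"
    unfolding xi_sym_pos[OF l]
    by (rule smooth_mat) (auto simp: scaleM_def intro!: smooth_mult smooth_mat_nth smooth_matrix_mult smooth_dlam[OF l] smooth_transpose framed_smooth(2)[OF framing_framed[OF l]])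
  then have "smooth (\<lambda>z. xi (sym_pos \<Phi> l z) $ j $ k)" for j k by (rule smooth_mat_nth)
  from this[of 3 2] this[of 1 3] this[of 2 1] show "smooth (\<lambda>z. sym_pos \<Phi> l z $ i)"
    using exhaust_3[of i] by (auto simp: xi_nth)
qed

text \<open>In the derivative of the Sym matrix the terms containing the connection form cancel.
  What remains is the spectral derivative of the form, conjugated by the frame, that is, a tangent
  vector with known components in the frame.\<close>

lemma vdd_sym_pos:
  assumes l: "l \<noteq> 0"
  shows "vdd a b (sym_pos \<Phi> l) z = \<Phi> l z *v ((- \<i> * l) *s (a *s dpx \<omega> l z + b *s dpy \<omega> l z))"
proof -
  note f = framed_smooth[OF framing_framed[OF l]]
  let ?u = "a *s px \<omega> l z + b *s py \<omega> l z" and ?d = "a *s dpx \<omega> l z + b *s dpy \<omega> l z"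
  have \<Phi>: "mdd a b (\<Phi> l) z = \<Phi> l z ** xi ?u"
    by (simp add: mdd_eq_pd[OF f(2)] pd_framed[OF framing_framed[OF l]] scaleM_xi add_xi)
  have "xi (vdd a b (sym_pos \<Phi> l) z) = mdd a b (\<lambda>z. xi (sym_pos \<Phi> l z)) z"
    by (rule mdd_xi[OF smooth_sym_pos[OF l], symmetric])
  also have "\<dots> = scaleM (- \<i> * l) (mdd a b (\<lambda>z. dlam \<Phi> l z ** transpose (\<Phi> l z)) z)"
    unfolding xi_sym_pos[OF l]
    by (simp add: mdd_def scaleM_def vec_eq_iff dd_cmult smooth_mat_nth smooth_matrix_mult smooth_dlam[OF l] smooth_transpose f dd_uminus smooth_mult)
  also have "mdd a b (\<lambda>z. dlam \<Phi> l z ** transpose (\<Phi> l z)) z = \<Phi> l z ** xi ?d ** transpose (\<Phi> l z)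
      + (dlam \<Phi> l z ** transpose (\<Phi> l z ** xi ?u) + dlam \<Phi> l z ** xi ?u ** transpose (\<Phi> l z))"
    by (simp add: mdd_mult smooth_dlam[OF l] smooth_transpose f mdd_transpose mdd_dlam[OF l] \<Phi> matrix_mult.add_left)
  also have "\<dots> = \<Phi> l z ** xi ?d ** transpose (\<Phi> l z)"
    unfolding transpose_mult_antisym[OF transpose_xi] by simp
  also have "\<dots> = xi (\<Phi> l z *v ?d)" by (rule xi_SO3[OF f(3), symmetric])
  also have "scaleM (- \<i> * l) \<dots> = xi (\<Phi> l z *v ((- \<i> * l) *s ?d))"
    by (simp only: xi_smult[symmetric] matrix_vec_smult)
  finally show ?thesis using inj_xi by (simp add: inj_eq)
qed

text \<open>Passing to the coordinate of scale l cancels the powers of l left by the Sym formula, so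
  the tangent vectors have the same components in the frame for every l.\<close>

lemma sym_adapted:
  assumes l: "l \<noteq> 0"
  shows "adapted (CSurface (\<lambda>z. \<epsilon> *s sym_pos \<Phi> l z) (sym_nrm \<Phi> l) l) \<omega> \<epsilon> (\<Phi> l)"
proof -
  note f = framing_framed[OF l]
  have n: "sym_nrm \<Phi> l z = \<Phi> l z *v axis 1 1" for z
    unfolding sym_nrm_def using framed_smooth(3)[OF f, of z] by (simp add: SO3_matrix_inv xi_SO3[symmetric])
  have d: "vdd a b (\<lambda>z. \<epsilon> *s sym_pos \<Phi> l z) z = \<Phi> l z *v (\<epsilon> *s ((- \<i> * l) *s (a *s dpx \<omega> l z + b *s dpy \<omega> l z)))" for a b z
    by (simp add: vdd_smult smooth_sym_pos[OF l] vdd_sym_pos[OF l] vec3_eq_iff matrix_vec_nth3 algebra_simps)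
  have "\<epsilon> *s ((- \<i> * l) *s (((l + inverse l) / 2) *s dpx \<omega> l z + (\<i> * (inverse l - l) / 2) *s dpy \<omega> l z)) = vector [0, 0, \<epsilon> * cosh (\<omega> z)]"
    "\<epsilon> *s ((- \<i> * l) *s ((\<i> * (l - inverse l) / 2) *s dpx \<omega> l z + ((l + inverse l) / 2) *s dpy \<omega> l z)) = vector [0, \<epsilon> * sinh (\<omega> z), 0]" for z
    using l by (simp_all add: vec3_eq_iff vector_3 dpx_def dpy_def field_simps)
  then show ?thesis
    unfolding adapted_def using f n
    by (simp add: vDx_eq_vdd vDy_eq_vdd d smooth_smult smooth_sym_pos[OF l])
qed

end

section \<open>The associated family\<close>

text \<open>A rotation K about the first axis respects the splitting into k and m: it rotates the
  m-component and adds to the k-component. Hence it commutes with scaling the m-component by s, and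
  one vector c serves for all M and s.\<close>

lemma gauge:
  fixes p :: "complex^3"
  assumes K: "smooth K" "\<And>z. K z \<in> SO3" "\<And>z. K z *v axis 1 1 = axis 1 1"
  obtains c :: "complex^3" where "\<And>M s. smooth M \<Longrightarrow> mdd a b M z = M z ** xi (vector [p $ 1, s * p $ 2, s * p $ 3]) \<Longrightarrow>
    mdd a b (\<lambda>z. M z ** K z) z = M z ** K z ** xi (vector [c $ 1, s * c $ 2, s * c $ 3])"
proof -
  obtain k where k: "mdd a b K z = K z ** xi k" using SO3_mdd_antisym[OF K(1,2)] by blast
  \<comment> \<open>The Maurer-Cartan form of K annihilates the fixed axis, so it has no
    m-component.\<close>
  have "vdd a b (\<lambda>z. K z *v axis 1 1) z = 0" using K(3) by simp
  then have "K z ** xi k *v axis 1 1 = 0" by (simp add: vdd_matrix_vec K(1) k)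
  then have "xi k *v axis 1 1 = 0"
    using SO3_cancel(5)[OF K(2), of z "xi k *v axis 1 1"] by (simp add: matrix_vector_mul_assoc)
  then have k0: "k $ 2 = 0" "k $ 3 = 0" by (simp_all add: mat3_simps)
  have KT: "transpose (K z) *v axis 1 1 = axis 1 1"
    using SO3_cancel(5)[OF K(2), of z "axis 1 1"] K(3) by simp
  have K0: "K z $ 1 $ 1 = 1" "K z $ 2 $ 1 = 0" "K z $ 3 $ 1 = 0" "K z $ 1 $ 2 = 0" "K z $ 1 $ 3 = 0"
    using K(3)[of z] KT by (simp_all add: mat3_simps)
  define c where "c = transpose (K z) *v p + k"
  have c: "transpose (K z) *v vector [p $ 1, s * p $ 2, s * p $ 3] + k = vector [c $ 1, s * c $ 2, s * c $ 3]" for s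
    by (simp add: c_def mat3_simps vector_3 K0 k0 algebra_simps)
  show ?thesis
  proof (rule that)
    fix M s assume M: "smooth M" "mdd a b M z = M z ** xi (vector [p $ 1, s * p $ 2, s * p $ 3])"
    have "K z ** xi (transpose (K z) *v v) = xi v ** K z" for v
      unfolding xi_SO3[OF SO3_transpose[OF K(2)]] by (simp add: matrix_mul_assoc SO3_mult_transpose[OF K(2)])
    then have "mdd a b (\<lambda>z. M z ** K z) z = M z ** K z ** xi (transpose (K z) *v vector [p $ 1, s * p $ 2, s * p $ 3]) + M z ** K z ** xi k"
      by (simp add: mdd_mult M K(1) k matrix_mul_assoc[symmetric])
    then show "mdd a b (\<lambda>z. M z ** K z) z = M z ** K z ** xi (vector [c $ 1, s * c $ 2, s * c $ 3])"
      by (simp add: add_xi c)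
  qed
qed

text \<open>An extended framing need not come from adapted frames, but two frames with the same
  normal differ by a rotation about it. Correcting at l0 suffices: by \<open>gauge\<close> the
  correction shifts the form in the same way for all l, so the form at l0 determines it
  everywhere.\<close>

lemma extended_framing_gauge:
  assumes \<Phi>: "extended_framing n \<Phi>" and l0: "l0 \<noteq> 0" and G: "framed l0 \<omega> G"
    and e: "\<And>z. G z *v axis 1 1 = \<Phi> l0 z *v axis 1 1"
  obtains K where "\<And>z. K z \<in> SO3" "\<And>z. K z *v axis 1 1 = axis 1 1"
    "framing \<omega> (\<lambda>l z. \<Phi> l z ** K z)" "\<And>z. \<Phi> l0 z ** K z = G z"
proof -
  obtain \<psi> where \<psi>: "smooth \<psi>" "\<And>z. \<psi> z \<in> SO3"
    and sm: "\<And>l. l \<noteq> 0 \<Longrightarrow> smooth (\<Phi> l)" and SO: "\<And>l z. l \<noteq> 0 \<Longrightarrow> \<Phi> l z \<in> SO3"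
    and dz: "\<And>l z. l \<noteq> 0 \<Longrightarrow> matrix_inv (\<Phi> l z) ** mwz (\<Phi> l) z = scaleM (inverse l) (mpart (matrix_inv (\<psi> z) ** mwz \<psi> z)) + kpart (matrix_inv (\<psi> z) ** mwz \<psi> z)"
    and dzb: "\<And>l z. l \<noteq> 0 \<Longrightarrow> matrix_inv (\<Phi> l z) ** mwzb (\<Phi> l) z = kpart (matrix_inv (\<psi> z) ** mwzb \<psi> z) + scaleM l (mpart (matrix_inv (\<psi> z) ** mwzb \<psi> z))"
    and c: "continuous_on ((- {0}) \<times> UNIV) (\<lambda>(l, z). \<Phi> l z)" and h: "\<And>z i j. (\<lambda>l. \<Phi> l z $ i $ j) holomorphic_on - {0}"
    using \<Phi> unfolding extended_framing_def Let_def by blast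
  \<comment> \<open>The rotation about the normal that carries the given framing at l0 to G.\<close>
  define K where "K z = transpose (\<Phi> l0 z) ** G z" for z
  have K: "smooth K" "\<And>z. K z \<in> SO3" "\<And>z. K z *v axis 1 1 = axis 1 1"
    unfolding K_def[abs_def] using sm[OF l0] SO[OF l0] framed_smooth[OF G]
    by (auto intro!: smooth_matrix_mult smooth_transpose SO3_mult SO3_transpose simp: matrix_vector_mul_assoc[symmetric] e SO3_cancel)
  have \<Phi>K: "\<Phi> l0 z ** K z = G z" for z unfolding K_def using SO[OF l0] by (simp add: SO3_cancel)
  have split: "scaleM s (mpart (xi p)) + kpart (xi p) = xi (vector [p $ 1, s * p $ 2, s * p $ 3])" for s p
    by (simp add: mpart_xi kpart_xi mat3_simps vector_3 scaleM_def)
  have "framed l \<omega> (\<lambda>z. \<Phi> l z ** K z)" if l: "l \<noteq> 0" for l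
    unfolding framed_def
  proof (intro conjI allI)
    show "smooth (\<lambda>z. \<Phi> l z ** K z)" by (intro smooth_matrix_mult sm l K)
    fix z
    show "\<Phi> l z ** K z \<in> SO3" by (intro SO3_mult SO l K)
    \<comment> \<open>Here s l is the factor of the m-component and u l the desired vector. The
      hypothesis \<open>u\<close> says that c, once determined at l0, yields the right vector at
      l.\<close>
    have main: "mdd a b (\<lambda>z. \<Phi> l z ** K z) z = \<Phi> l z ** K z ** xi (u l)"
      if S: "\<And>l. l \<noteq> 0 \<Longrightarrow> matrix_inv (\<Phi> l z) ** mdd a b (\<Phi> l) z = scaleM (s l) (mpart (matrix_inv (\<psi> z) ** mdd a b \<psi> z)) + kpart (matrix_inv (\<psi> z) ** mdd a b \<psi> z)"
        and u0: "mdd a b G z = G z ** xi (u l0)"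
        and u: "\<And>c :: complex^3. vector [c $ 1, s l0 * c $ 2, s l0 * c $ 3] = u l0 \<Longrightarrow> vector [c $ 1, s l * c $ 2, s l * c $ 3] = u l"
      for a b s and u :: "complex \<Rightarrow> complex^3"
    proof -
      obtain p where p: "mdd a b \<psi> z = \<psi> z ** xi p" using SO3_mdd_antisym[OF \<psi>] by blast
      have "matrix_inv (\<Phi> l z) ** mdd a b (\<Phi> l) z = xi (vector [p $ 1, s l * p $ 2, s l * p $ 3])" if "l \<noteq> 0" for l
        using S[OF that] \<psi>(2)[of z] by (simp add: p SO3_matrix_inv SO3_cancel split)
      then have d: "mdd a b (\<Phi> l) z = \<Phi> l z ** xi (vector [p $ 1, s l * p $ 2, s l * p $ 3])" if "l \<noteq> 0" for l
        using SO[OF that, of z] that by (metis SO3_cancel(2) SO3_matrix_inv)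
      obtain c :: "complex^3" where c: "\<And>M s. smooth M \<Longrightarrow> mdd a b M z = M z ** xi (vector [p $ 1, s * p $ 2, s * p $ 3]) \<Longrightarrow>
          mdd a b (\<lambda>z. M z ** K z) z = M z ** K z ** xi (vector [c $ 1, s * c $ 2, s * c $ 3])"
        using gauge[OF K] by blast
      have "G z ** xi (vector [c $ 1, s l0 * c $ 2, s l0 * c $ 3]) = G z ** xi (u l0)"
        using c[OF sm[OF l0] d[OF l0]] u0 by (simp add: \<Phi>K)
      then have "vector [c $ 1, s l0 * c $ 2, s l0 * c $ 3] = u l0"
        by (simp add: xi_eq_iff[OF framed_smooth(3)[OF G]])
      then show ?thesis using c[OF sm[OF l] d[OF l]] u by simp
    qed
    show "mwz (\<lambda>z. \<Phi> l z ** K z) z = \<Phi> l z ** K z ** xi (uz l \<omega> z)"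
      unfolding mwz_eq_mdd
    proof (rule main[where s=inverse and u="\<lambda>l. uz l \<omega> z"])
      fix c :: "complex^3" assume "vector [c $ 1, inverse l0 * c $ 2, inverse l0 * c $ 3] = uz l0 \<omega> z"
      then have "inverse l0 * (c $ 2 + sinh (\<omega> z) / 2) = 0" "inverse l0 * (c $ 3 + \<i> * cosh (\<omega> z) / 2) = 0" "c $ 1 = \<i> * wz \<omega> z"
        using l0 by (simp_all add: uz_def vec3_eq_iff vector_3 field_simps)
      then have "c $ 2 = - (sinh (\<omega> z) / 2)" "c $ 3 = - (\<i> * cosh (\<omega> z) / 2)" "c $ 1 = \<i> * wz \<omega> z"
        using l0 by (simp_all add: eq_neg_iff_add_eq_0)
      then show "vector [c $ 1, inverse l * c $ 2, inverse l * c $ 3] = uz l \<omega> z"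
        using l by (simp add: uz_def vec3_eq_iff vector_3 field_simps)
    qed (use dz G in \<open>auto simp: mwz_eq_mdd framed_def\<close>)
    show "mwzb (\<lambda>z. \<Phi> l z ** K z) z = \<Phi> l z ** K z ** xi (uzb l \<omega> z)"
      unfolding mwzb_eq_mdd
    proof (rule main[where s="\<lambda>l. l" and u="\<lambda>l. uzb l \<omega> z"])
      fix c :: "complex^3" assume "vector [c $ 1, l0 * c $ 2, l0 * c $ 3] = uzb l0 \<omega> z"
      then have "l0 * (c $ 2 + sinh (\<omega> z) / 2) = 0" "l0 * (c $ 3 - \<i> * cosh (\<omega> z) / 2) = 0" "c $ 1 = - (\<i> * wzb \<omega> z)"
        by (simp_all add: uzb_def vec3_eq_iff vector_3 algebra_simps)
      then have "c $ 2 = - (sinh (\<omega> z) / 2)" "c $ 3 = \<i> * cosh (\<omega> z) / 2" "c $ 1 = - (\<i> * wzb \<omega> z)"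
        using l0 by (simp_all add: eq_neg_iff_add_eq_0)
      then show "vector [c $ 1, l * c $ 2, l * c $ 3] = uzb l \<omega> z"
        by (simp add: uzb_def vec3_eq_iff vector_3)
    qed (use dzb G in \<open>auto simp: mwzb_eq_mdd framed_def add.commute\<close>)
  qed (use l G in \<open>auto simp: framed_def\<close>)
  moreover have "continuous_on ((- {0}) \<times> UNIV) (\<lambda>(l, z). \<Phi> l z ** K z)"
  proof -
    have "continuous_on ((- {0}) \<times> UNIV) (\<lambda>x :: complex \<times> complex. K (snd x))"
      by (rule continuous_on_compose2[OF smooth_imp_continuous_on[OF K(1), of UNIV]]) (auto intro!: continuous_intros)
    then show ?thesis using c unfolding case_prod_unfold by (intro matrix_mult.continuous_on)
  qed
  moreover have "(\<lambda>l. (\<Phi> l z ** K z) $ i $ j) holomorphic_on - {0}" for z i j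
    unfolding matrix_mult_nth3 by (intro holomorphic_intros h)
  ultimately have "framing \<omega> (\<lambda>l z. \<Phi> l z ** K z)" by (simp add: framing_def)
  then show ?thesis using that K \<Phi>K by blast
qed

text \<open>K does not depend on the spectral parameter, so it cancels in the logarithmic
  derivative; for the normal it drops out because it fixes the first axis.\<close>

lemma sym_gauge:
  assumes "\<And>z. K z \<in> SO3" "\<And>z. K z *v axis 1 1 = axis 1 1" "\<And>l z. l \<noteq> 0 \<Longrightarrow> \<Phi> l z \<in> SO3"
    and h: "\<And>z i j. (\<lambda>l. \<Phi> l z $ i $ j) holomorphic_on - {0}" and l: "l \<noteq> 0"
  shows "sym_pos (\<lambda>l z. \<Phi> l z ** K z) l z = sym_pos \<Phi> l z" "sym_nrm (\<lambda>l z. \<Phi> l z ** K z) l z = sym_nrm \<Phi> l z"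
proof -
  have d: "((\<lambda>k. \<Phi> k z $ i $ j) has_field_derivative deriv (\<lambda>k. \<Phi> k z $ i $ j) l) (at l)" for i j
    by (rule holomorphic_derivI[OF h]) (use l in \<open>auto simp: open_Compl\<close>)
  have "deriv (\<lambda>k. (\<Phi> k z ** K z) $ i $ j) l = ((\<chi> i j. deriv (\<lambda>k. \<Phi> k z $ i $ j) l) ** K z) $ i $ j" for i j
    unfolding matrix_mult_nth3 vec_lambda_beta
    by (rule DERIV_imp_deriv) (intro DERIV_add DERIV_cmult_right d)
  then have "(\<chi> i j. deriv (\<lambda>k. (\<Phi> k z ** K z) $ i $ j) l) = (\<chi> i j. deriv (\<lambda>k. \<Phi> k z $ i $ j) l) ** K z"
    by (simp add: vec_eq_iff)
  moreover have inv: "matrix_inv (\<Phi> l z ** K z) = transpose (K z) ** matrix_inv (\<Phi> l z)"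
    using assms by (simp add: SO3_matrix_inv SO3_mult matrix_transpose_mul)
  moreover have "A ** K z ** (transpose (K z) ** B) = A ** B" for A B :: "complex^3^3"
    using assms(1) by (simp add: matrix_mul_assoc SO3_cancel)
  ultimately show "sym_pos (\<lambda>l z. \<Phi> l z ** K z) l z = sym_pos \<Phi> l z"
    by (simp add: sym_pos_def)
  have "\<Phi> l z ** K z ** xi (axis 1 1) ** (transpose (K z) ** matrix_inv (\<Phi> l z)) = \<Phi> l z ** (K z ** xi (axis 1 1) ** transpose (K z)) ** matrix_inv (\<Phi> l z)"
    by (simp add: matrix_mul_assoc)
  also have "K z ** xi (axis 1 1) ** transpose (K z) = xi (axis 1 1)"
    using xi_SO3[OF assms(1), of z "axis 1 1"] assms(2) by simp
  finally show "sym_nrm (\<lambda>l z. \<Phi> l z ** K z) l z = sym_nrm \<Phi> l z"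
    by (simp add: sym_nrm_def inv)
qed

text \<open>After the gauge correction, which the Sym formula does not see, \<omega> is shared by
  the whole family.\<close>

lemma sym_adapted_all:
  assumes \<Phi>: "extended_framing n \<Phi>" and l0: "l0 \<noteq> 0" and l: "l \<noteq> 0"
    and G: "adapted (CSurface (\<lambda>z. \<epsilon>' *s sym_pos \<Phi> l0 z) (sym_nrm \<Phi> l0) l0) \<omega> \<epsilon> G"
  obtains H where "adapted (CSurface (\<lambda>z. \<epsilon>' *s sym_pos \<Phi> l z) (sym_nrm \<Phi> l) l) \<omega> \<epsilon> H"
proof -
  have SO: "\<And>l z. l \<noteq> 0 \<Longrightarrow> \<Phi> l z \<in> SO3" and h: "\<And>z i j. (\<lambda>l. \<Phi> l z $ i $ j) holomorphic_on - {0}"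
    using \<Phi> unfolding extended_framing_def Let_def by blast+
  have f: "framed l0 \<omega> G" using G by (simp add: adapted_def)
  have e: "G z *v axis 1 1 = \<Phi> l0 z *v axis 1 1" for z
  proof -
    have "sym_nrm \<Phi> l0 z = \<Phi> l0 z *v axis 1 1"
      unfolding sym_nrm_def using SO[OF l0, of z] by (simp add: SO3_matrix_inv xi_SO3[symmetric])
    then show ?thesis using G by (simp add: adapted_def)
  qed
  obtain K where K: "\<And>z. K z \<in> SO3" "\<And>z. K z *v axis 1 1 = axis 1 1"
    "framing \<omega> (\<lambda>l z. \<Phi> l z ** K z)" "\<And>z. \<Phi> l0 z ** K z = G z"
    by (rule extended_framing_gauge[OF \<Phi> l0 f e]) (rule that)
  have ad: "adapted (CSurface (\<lambda>z. \<epsilon>' *s sym_pos \<Phi> l z) (sym_nrm \<Phi> l) l) \<omega> \<epsilon>' (\<lambda>z. \<Phi> l z ** K z)" if "l \<noteq> 0" for l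
  proof -
    have "sym_pos (\<lambda>l z. \<Phi> l z ** K z) l = sym_pos \<Phi> l" "sym_nrm (\<lambda>l z. \<Phi> l z ** K z) l = sym_nrm \<Phi> l"
      using sym_gauge[OF K(1,2) SO h that] by auto
    then show ?thesis using sym_adapted[OF K(3) that, of \<epsilon>'] by simp
  qed
  \<comment> \<open>The same frame carries both signs. They are compared at the point 0, where cosh
    \<omega> and sinh \<omega> do not both vanish.\<close>
  have "G 0 *v vector [0, 0, \<epsilon> * cosh (\<omega> 0)] = G 0 *v vector [0, 0, \<epsilon>' * cosh (\<omega> 0)]"
    "G 0 *v vector [0, \<epsilon> * sinh (\<omega> 0), 0] = G 0 *v vector [0, \<epsilon>' * sinh (\<omega> 0), 0]"
    using G ad[OF l0] unfolding adapted_def K(4) by (metis csurface.sel)+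
  note this[unfolded matrix_vec_eq_iff[OF framed_smooth(3)[OF f]]]
  then have "cosh (\<omega> 0) = 0 \<or> \<epsilon> = \<epsilon>'" "sinh (\<omega> 0) = 0 \<or> \<epsilon> = \<epsilon>'"
    by (auto simp: vec3_eq_iff vector_3)
  moreover have "cosh (\<omega> 0) \<noteq> 0 \<or> sinh (\<omega> 0) \<noteq> 0"
    using hyperbolic_pythagoras[of "\<omega> 0"] by auto
  ultimately have "\<epsilon> = \<epsilon>'" by blast
  then show ?thesis using ad[OF l] that by simp
qed

text \<open>The pair of \<omega> and \<epsilon> is invariant under association, in both directions.
  With scale 1 for X, the scale of U is the spectral parameter itself.\<close>

lemma associated_adapted:
  assumes a: "associated l X U" and s: "scl X = 1"
  shows "(\<exists>G. adapted X \<omega> \<epsilon> G) \<longleftrightarrow> (\<exists>G. adapted U \<omega> \<epsilon> G)"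
proof -
  obtain \<Phi> \<epsilon>' where l: "l \<noteq> 0" and \<Phi>: "extended_framing (nrm X) \<Phi>"
    and X: "congruent X (CSurface (\<lambda>z. \<epsilon>' *s sym_pos \<Phi> 1 z) (sym_nrm \<Phi> 1) 1)"
    and U: "congruent U (CSurface (\<lambda>z. \<epsilon>' *s sym_pos \<Phi> l z) (sym_nrm \<Phi> l) l)"
    using a s unfolding associated_def by auto
  show ?thesis
  proof
    assume "\<exists>G. adapted X \<omega> \<epsilon> G"
    then obtain G where "adapted (CSurface (\<lambda>z. \<epsilon>' *s sym_pos \<Phi> 1 z) (sym_nrm \<Phi> 1) 1) \<omega> \<epsilon> G"
      using congruent_adapted[OF X] by metis
    then obtain H where "adapted (CSurface (\<lambda>z. \<epsilon>' *s sym_pos \<Phi> l z) (sym_nrm \<Phi> l) l) \<omega> \<epsilon> H"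
      by (rule sym_adapted_all[OF \<Phi> one_neq_zero l])
    then show "\<exists>G. adapted U \<omega> \<epsilon> G" using congruent_adapted[OF congruent_sym[OF U]] by metis
  next
    assume "\<exists>G. adapted U \<omega> \<epsilon> G"
    then obtain G where "adapted (CSurface (\<lambda>z. \<epsilon>' *s sym_pos \<Phi> l z) (sym_nrm \<Phi> l) l) \<omega> \<epsilon> G"
      using congruent_adapted[OF U] by metis
    then obtain H where "adapted (CSurface (\<lambda>z. \<epsilon>' *s sym_pos \<Phi> 1 z) (sym_nrm \<Phi> 1) 1) \<omega> \<epsilon> H"
      by (rule sym_adapted_all[OF \<Phi> l one_neq_zero])
    then show "\<exists>G. adapted X \<omega> \<epsilon> G" using congruent_adapted[OF congruent_sym[OF X]] by metis
  qed
qed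

text \<open>The frame of X serves as the lift \<psi>; passing from \<open>uz 1\<close> and
  \<open>uzb 1\<close> to scale l multiplies just the m-components by the required factors.\<close>

lemma framing_extended_framing:
  assumes X: "adapted X \<omega> \<epsilon> G" and s: "scl X = 1" and \<Phi>: "framing \<omega> \<Phi>"
  shows "extended_framing (nrm X) \<Phi>"
  unfolding extended_framing_def Let_def
proof (intro conjI exI[of _ G] allI impI)
  have G: "framed 1 \<omega> G" using X s by (simp add: adapted_def)
  show "smooth G" using framed_smooth[OF G] by simp
  show "G z \<in> SO3" "G z *v axis 1 1 = nrm X z" for z using framed_smooth[OF G] X by (simp_all add: adapted_def)
  fix l :: complex assume l: "l \<noteq> 0"
  have F: "framed l \<omega> (\<Phi> l)" using \<Phi> l by (simp add: framing_def)
  show "smooth (\<Phi> l)" using framed_smooth[OF F] by simp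
  fix z
  show SO: "\<Phi> l z \<in> SO3" using framed_smooth[OF F] by simp
  have d: "matrix_inv (G z) ** mwz G z = xi (uz 1 \<omega> z)" "matrix_inv (G z) ** mwzb G z = xi (uzb 1 \<omega> z)"
    "matrix_inv (\<Phi> l z) ** mwz (\<Phi> l) z = xi (uz l \<omega> z)" "matrix_inv (\<Phi> l z) ** mwzb (\<Phi> l) z = xi (uzb l \<omega> z)"
    using F G SO framed_smooth(3)[OF G, of z] by (simp_all add: framed_def SO3_matrix_inv SO3_cancel)
  show "matrix_inv (\<Phi> l z) ** mwz (\<Phi> l) z = scaleM (inverse l) (mpart (matrix_inv (G z) ** mwz G z)) + kpart (matrix_inv (G z) ** mwz G z)"
    "matrix_inv (\<Phi> l z) ** mwzb (\<Phi> l) z = kpart (matrix_inv (G z) ** mwzb G z) + scaleM l (mpart (matrix_inv (G z) ** mwzb G z))"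
    unfolding d mpart_xi kpart_xi using l
    by (simp_all add: uz_def uzb_def mat3_simps vector_3 scaleM_def field_simps)
qed (use \<Phi> in \<open>auto simp: framing_def\<close>)

lemma associatedI:
  assumes X: "adapted X \<omega> \<epsilon> G" "scl X = 1" and U: "adapted U \<omega> \<epsilon> H" "scl U = l" and \<epsilon>: "\<epsilon> \<in> {1, -1}"
  shows "associated l X U"
proof -
  have l: "l \<noteq> 0" "sinh_gordon \<omega>" using U by (auto simp: adapted_def framed_def)
  then obtain \<Phi> where \<Phi>: "framing \<omega> \<Phi>" using framing_exists by blast
  have "congruent X (CSurface (\<lambda>z. \<epsilon> *s sym_pos \<Phi> 1 z) (sym_nrm \<Phi> 1) 1)"
    using adapted_congruent[OF X(1) sym_adapted[OF \<Phi>, of 1 \<epsilon>]] X(2) by simp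
  moreover have "congruent U (CSurface (\<lambda>z. \<epsilon> *s sym_pos \<Phi> l z) (sym_nrm \<Phi> l) l)"
    using adapted_congruent[OF U(1) sym_adapted[OF \<Phi> l(1), of \<epsilon>]] U(2) by simp
  ultimately show ?thesis
    unfolding associated_def using l \<epsilon> framing_extended_framing[OF X \<Phi>] X(2) by auto
qed

lemma adapted_exists:
  assumes "sinh_gordon \<omega>" "l \<noteq> 0"
  obtains U H where "adapted U \<omega> \<epsilon> H" "scl U = l"
proof -
  obtain \<Phi> where "framing \<omega> \<Phi>" using framing_exists[OF assms(1)] by blast
  from sym_adapted[OF this assms(2)] show ?thesis by (rule that) simp
qed

section \<open>Curvature line coordinates\<close>

lemma cdot_commute: "cdot u v = cdot v u"
  by (simp add: cdot_3 mult.commute)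

lemma cdot_linear:
  "cdot (u + v) w = cdot u w + cdot v w" "cdot (u - v) w = cdot u w - cdot v w" "cdot (c *s u) w = c * cdot u w"
  "cdot w (u + v) = cdot w u + cdot w v" "cdot w (u - v) = cdot w u - cdot w v" "cdot w (c *s u) = c * cdot w u"
  by (simp_all add: cdot_3 algebra_simps)

lemma sinh_square': "sinh x * sinh x = cosh x * cosh x - 1" for x :: complex
  using hyperbolic_pythagoras[of x] by (simp add: power2_eq_square algebra_simps)

lemma rows_nth: "(vector [a, b, c] :: complex^3^3) $ 1 = a" "(vector [a, b, c] :: complex^3^3) $ 2 = b"
    "(vector [a, b, c] :: complex^3^3) $ 3 = c"
  by (simp_all add: vector_3)

lemma columns_orthonormal:
  assumes "cdot a a = 1" "cdot b b = 1" "cdot c c = 1" "cdot a b = 0" "cdot a c = 0" "cdot b c = 0"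
  shows "transpose (transpose (vector [a, b, c] :: complex^3^3)) ** transpose (vector [a, b, c]) = mat 1"
  using assms by (simp add: mat3_simps rows_nth cdot_3 mult.commute)

text \<open>An orthonormal triple may be left-handed. Its determinant is constant by connectedness,
  and scaling the third column by it makes the determinant 1; this is the origin of
  \<epsilon>.\<close>

lemma frame_of_columns:
  assumes u: "smooth u" "smooth v" "smooth w"
    and on: "\<And>z. cdot (u z) (u z) = 1" "\<And>z. cdot (v z) (v z) = 1" "\<And>z. cdot (w z) (w z) = 1"
      "\<And>z. cdot (u z) (v z) = 0" "\<And>z. cdot (u z) (w z) = 0" "\<And>z. cdot (v z) (w z) = 0"
  obtains \<epsilon> and G :: "complex \<Rightarrow> complex^3^3" where "\<epsilon> \<in> {1, -1}" "smooth G" "\<And>z. G z \<in> SO3"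
    "\<And>z. G z *v axis 1 1 = u z" "\<And>z. G z *v axis 2 1 = v z" "\<And>z. G z *v axis 3 1 = \<epsilon> *s w z"
proof -
  define M where "M \<epsilon> z = transpose (vector [u z, v z, \<epsilon> *s w z] :: complex^3^3)" for \<epsilon> z
  have col: "M \<epsilon> z *v axis 1 1 = u z" "M \<epsilon> z *v axis 2 1 = v z" "M \<epsilon> z *v axis 3 1 = \<epsilon> *s w z" for \<epsilon> z
    by (simp_all add: M_def vec3_eq_iff matrix_vec_nth3 transpose_nth rows_nth axis_nth3)
  have sm: "smooth (M \<epsilon>)" for \<epsilon>
  proof (rule smooth_mat)
    show "smooth (\<lambda>z. M \<epsilon> z $ i $ j)" for i j
      using exhaust_3[of j] u by (elim disjE) (simp_all add: M_def transpose_nth rows_nth smooth_nth smooth_mult)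
  qed
  have MM: "transpose (M \<epsilon> z) ** M \<epsilon> z = mat 1" if "\<epsilon> * \<epsilon> = 1" for \<epsilon> z
    unfolding M_def using on[of z] that
    by (intro columns_orthonormal) (simp_all add: cdot_linear mult.assoc[symmetric])
  have det: "det (M 1 z) = det (M 1 0)" for z
  proof (rule sign_constant[of UNIV "\<lambda>z. det (M 1 z)" 1])
    show "continuous_on UNIV (\<lambda>z. det (M 1 z))"
      unfolding det_3 by (intro continuous_intros smooth_imp_continuous_on sm)
    show "det (M 1 z) = 1 \<or> det (M 1 z) = - 1" for z
    proof -
      have "det (M 1 z) * det (M 1 z) = 1"
        using arg_cong[OF MM[of 1 z], of det] by (simp add: det_mul det_transpose)
      then show ?thesis by (simp add: square_eq_1_iff)
    qed
  qed (auto simp: connected_UNIV)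
  define \<epsilon> where "\<epsilon> = det (M 1 0)"
  have "\<epsilon> * \<epsilon> = 1"
    using arg_cong[OF MM[of 1 0], of det] by (simp add: det_mul det_transpose \<epsilon>_def)
  then have \<epsilon>: "\<epsilon> \<in> {1, -1}" by (simp add: square_eq_1_iff)
  have "det (M \<epsilon> z) = \<epsilon> * det (M 1 z)" for z
    unfolding det_3 by (simp add: M_def transpose_nth rows_nth algebra_simps)
  then have "M \<epsilon> z \<in> SO3" for z
    using MM[OF \<open>\<epsilon> * \<epsilon> = 1\<close>] det[of z] \<open>\<epsilon> * \<epsilon> = 1\<close> by (intro SO3I) (simp_all add: \<epsilon>_def)
  then show ?thesis using that[OF \<epsilon> sm _ col] by blast
qed

lemma sinh_gordon_scale:
  assumes "sinh_gordon \<omega>" "\<epsilon> \<in> {1, -1}"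
  shows "sinh_gordon (\<lambda>z. \<epsilon> * \<omega> z)"
proof -
  have sm: "smooth \<omega>" using assms by (simp add: sinh_gordon_def)
  have 1: "pdx (\<lambda>z. - \<omega> z) = (\<lambda>z. - pdx \<omega> z)" "pdy (\<lambda>z. - \<omega> z) = (\<lambda>z. - pdy \<omega> z)"
    using dd_uminus[OF sm, of 1 0] dd_uminus[OF sm, of 0 1] by (auto simp: dd_def)
  have 2: "pdx (\<lambda>z. - pdx \<omega> z) z = - pdx (pdx \<omega>) z" "pdy (\<lambda>z. - pdy \<omega> z) z = - pdy (pdy \<omega>) z" for z
    using dd_uminus[OF smooth_pdx[OF sm], of 1 0] dd_uminus[OF smooth_pdy[OF sm], of 0 1] by (auto simp: dd_def)
  have 3: "- pdx (pdx \<omega>) z + - pdy (pdy \<omega>) z + sinh (- \<omega> z) * cosh (- \<omega> z) = 0" for z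
  proof -
    have "pdx (pdx \<omega>) z + pdy (pdy \<omega>) z + sinh (\<omega> z) * cosh (\<omega> z) = 0"
      using assms(1) by (simp add: sinh_gordon_def)
    moreover have "- pdx (pdx \<omega>) z + - pdy (pdy \<omega>) z + sinh (- \<omega> z) * cosh (- \<omega> z)
      = - (pdx (pdx \<omega>) z + pdy (pdy \<omega>) z + sinh (\<omega> z) * cosh (\<omega> z))"
      by simp
    ultimately show ?thesis by (metis add.inverse_neutral)
  qed
  have "sinh_gordon (\<lambda>z. - \<omega> z)"
    unfolding sinh_gordon_def 1 2 using smooth_uminus[OF sm] 3 by blast
  then show ?thesis using assms by auto
qed

text \<open>
  The coefficient matrices of the frame are read off from the derivatives of \<open>\<phi>\<close>, except for the
  component about \<open>\<phi>\<close>; that one follows from \<open>\<phi>\<^sub>x\<^sub>y = \<phi>\<^sub>y\<^sub>x\<close> and \<open>F\<^sub>x\<^sub>y = F\<^sub>y\<^sub>x\<close> together, since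
  \<open>cosh\<^sup>2 \<omega> - sinh\<^sup>2 \<omega> = 1\<close>.
\<close>

lemma adaptedI:
  assumes \<mu>: "scl X \<noteq> 0" and sg: "sinh_gordon \<omega>" and sm: "smooth (pos X)" "smooth (nrm X)"
    and G: "smooth G" "\<And>z. G z \<in> SO3" and \<epsilon>: "\<epsilon> \<noteq> 0"
    and n: "\<And>z. nrm X z = G z *v axis 1 1"
    and Px: "\<And>z. Px X z = G z *v vector [0, 0, \<epsilon> * cosh (\<omega> z)]" and Py: "\<And>z. Py X z = G z *v vector [0, \<epsilon> * sinh (\<omega> z), 0]"
    and Nx: "\<And>z. Nx X z = G z *v vector [0, 0, sinh (\<omega> z)]" and Ny: "\<And>z. Ny X z = G z *v vector [0, cosh (\<omega> z), 0]"
  shows "adapted X \<omega> \<epsilon> G"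
proof -
  let ?\<mu> = "scl X"
  have sm\<omega>: "smooth \<omega>" using sg by (simp add: sinh_gordon_def)
  note sms = smooth_sinh[OF sm\<omega>] smooth_cosh[OF sm\<omega>]
  have eqs: "mDx ?\<mu> G z = G z ** xi (vector [Dy ?\<mu> \<omega> z, - sinh (\<omega> z), 0]) \<and>
     mDy ?\<mu> G z = G z ** xi (vector [- Dx ?\<mu> \<omega> z, 0, cosh (\<omega> z)])" for z
  proof -
    obtain p where p: "mDx ?\<mu> G z = G z ** xi p" unfolding mDx_def using SO3_mdd_antisym[OF G] by blast
    obtain q where q: "mDy ?\<mu> G z = G z ** xi q" unfolding mDy_def using SO3_mdd_antisym[OF G] by blast
    have dx: "vDx ?\<mu> (\<lambda>z. G z *v v z) z = G z *v (xi p *v v z + vDx ?\<mu> v z)" if "smooth v" for v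
      using vdd_matrix_vec[OF G(1) that] p
      by (simp add: vDx_eq_vdd mDx_def matrix_vector_right_distrib matrix_vector_mul_assoc)
    have dy: "vDy ?\<mu> (\<lambda>z. G z *v v z) z = G z *v (xi q *v v z + vDy ?\<mu> v z)" if "smooth v" for v
      using vdd_matrix_vec[OF G(1) that] q
      by (simp add: vDy_eq_vdd mDy_def matrix_vector_right_distrib matrix_vector_mul_assoc)
    note inj = matrix_vec_eq_iff[OF G(2)]
    have nX: "nrm X = (\<lambda>z. G z *v axis 1 1)" using n by auto
    have "xi p *v axis 1 1 = vector [0, 0, sinh (\<omega> z)]" "xi q *v axis 1 1 = vector [0, cosh (\<omega> z), 0]"
      using Nx[of z] Ny[of z] unfolding nX dx[OF smooth_const] dy[OF smooth_const]
      by (simp_all add: inj vDx_eq_vdd vDy_eq_vdd)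
    then have p23: "p $ 3 = 0" "p $ 2 = - sinh (\<omega> z)" and q23: "q $ 3 = cosh (\<omega> z)" "q $ 2 = 0"
      by (auto simp: mat3_simps vector_3 minus_equation_iff)
    have Nx': "Nx X = (\<lambda>z. G z *v vector [0, 0, sinh (\<omega> z)])" and Ny': "Ny X = (\<lambda>z. G z *v vector [0, cosh (\<omega> z), 0])"
      and Px': "Px X = (\<lambda>z. G z *v vector [0, 0, \<epsilon> * cosh (\<omega> z)])" and Py': "Py X = (\<lambda>z. G z *v vector [0, \<epsilon> * sinh (\<omega> z), 0])"
      using Nx Ny Px Py by auto
    have c: "vDy ?\<mu> (vDx ?\<mu> Y) z = vDx ?\<mu> (vDy ?\<mu> Y) z" if "smooth Y" for Y
      unfolding vDx_eq_vdd vDy_eq_vdd by (rule vdd_commute[OF that])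
    have "xi q *v vector [0, 0, sinh (\<omega> z)] + vDy ?\<mu> (\<lambda>z. vector [0, 0, sinh (\<omega> z)]) z
       = xi p *v vector [0, cosh (\<omega> z), 0] + vDx ?\<mu> (\<lambda>z. vector [0, cosh (\<omega> z), 0]) z"
      using c[OF sm(2)] unfolding Nx' Ny' by (simp add: dx dy smooth_vector3 sms inj)
    then have N: "sinh (\<omega> z) * Dx ?\<mu> \<omega> z = - q $ 1 * sinh (\<omega> z)" "cosh (\<omega> z) * Dy ?\<mu> \<omega> z = p $ 1 * cosh (\<omega> z)"
      by (simp_all add: vDx_eq_vdd vDy_eq_vdd vdd_vector3 mat3_simps vector_3 Dx_eq_dd Dy_eq_dd dd_sinh dd_cosh sm\<omega>)
    have "xi q *v vector [0, 0, \<epsilon> * cosh (\<omega> z)] + vDy ?\<mu> (\<lambda>z. vector [0, 0, \<epsilon> * cosh (\<omega> z)]) z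
       = xi p *v vector [0, \<epsilon> * sinh (\<omega> z), 0] + vDx ?\<mu> (\<lambda>z. vector [0, \<epsilon> * sinh (\<omega> z), 0]) z"
      using c[OF sm(1)] unfolding Px' Py' by (simp add: dx dy smooth_vector3 smooth_mult sms inj)
    then have "\<epsilon> * (cosh (\<omega> z) * Dx ?\<mu> \<omega> z) = \<epsilon> * (- q $ 1 * cosh (\<omega> z))" "\<epsilon> * (sinh (\<omega> z) * Dy ?\<mu> \<omega> z) = \<epsilon> * (p $ 1 * sinh (\<omega> z))"
      by (simp_all add: vDx_eq_vdd vDy_eq_vdd vdd_vector3 mat3_simps vector_3 Dx_eq_dd Dy_eq_dd dd_cmult dd_sinh dd_cosh sm\<omega> sms algebra_simps)
    then have P: "cosh (\<omega> z) * Dx ?\<mu> \<omega> z = - q $ 1 * cosh (\<omega> z)" "sinh (\<omega> z) * Dy ?\<mu> \<omega> z = p $ 1 * sinh (\<omega> z)"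
      unfolding mult_left_cancel[OF \<epsilon>] by blast+
    have ch: "cosh (\<omega> z) \<noteq> 0 \<or> sinh (\<omega> z) \<noteq> 0"
      using hyperbolic_pythagoras[of "\<omega> z"] by auto
    have "(Dx ?\<mu> \<omega> z + q $ 1) * sinh (\<omega> z) = 0" "(Dx ?\<mu> \<omega> z + q $ 1) * cosh (\<omega> z) = 0"
      "(Dy ?\<mu> \<omega> z - p $ 1) * sinh (\<omega> z) = 0" "(Dy ?\<mu> \<omega> z - p $ 1) * cosh (\<omega> z) = 0"
      using N P by (simp_all add: algebra_simps)
    then have "Dx ?\<mu> \<omega> z + q $ 1 = 0" "Dy ?\<mu> \<omega> z - p $ 1 = 0"
      using ch unfolding mult_eq_0_iff by blast+
    then have "q $ 1 = - Dx ?\<mu> \<omega> z" and "p $ 1 = Dy ?\<mu> \<omega> z"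
      by (simp_all add: eq_neg_iff_add_eq_0 add.commute)
    then show ?thesis
      unfolding p q using p23 q23 by (intro conjI arg_cong[where f="\<lambda>v. G z ** xi v"]) (simp_all add: vec3_eq_iff vector_3)
  qed
  then have "mwz G z = G z ** xi (uz ?\<mu> \<omega> z)" "mwzb G z = G z ** xi (uzb ?\<mu> \<omega> z)" for z
    using framed_equations_iff[OF \<mu>, of G z \<omega>] by auto
  then show ?thesis using \<mu> sg sm G n Px Py by (simp add: adapted_def framed_def)
qed

section \<open>Passage between fundamental forms and adapted frames\<close>

lemma spherical_surface_cdot:
  assumes X: "spherical_surface X \<omega>"
  shows "cdot (nrm X z) (nrm X z) = 1"
    "cdot (nrm X z) (Px X z) = 0" "cdot (nrm X z) (Py X z) = 0" "cdot (nrm X z) (Nx X z) = 0" "cdot (nrm X z) (Ny X z) = 0"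
    "cdot (Px X z) (Px X z) = cosh (\<omega> z) * cosh (\<omega> z)" "cdot (Px X z) (Py X z) = 0"
    "cdot (Px X z) (Nx X z) = sinh (\<omega> z) * cosh (\<omega> z)" "cdot (Px X z) (Ny X z) = 0"
    "cdot (Py X z) (Px X z) = 0" "cdot (Py X z) (Py X z) = sinh (\<omega> z) * sinh (\<omega> z)"
    "cdot (Py X z) (Nx X z) = 0" "cdot (Py X z) (Ny X z) = sinh (\<omega> z) * cosh (\<omega> z)"
    "cdot (Nx X z) (Px X z) = sinh (\<omega> z) * cosh (\<omega> z)" "cdot (Nx X z) (Py X z) = 0"
    "cdot (Nx X z) (Nx X z) = sinh (\<omega> z) * sinh (\<omega> z)" "cdot (Nx X z) (Ny X z) = 0"
    "cdot (Ny X z) (Px X z) = 0" "cdot (Ny X z) (Py X z) = sinh (\<omega> z) * cosh (\<omega> z)"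
    "cdot (Ny X z) (Nx X z) = 0" "cdot (Ny X z) (Ny X z) = cosh (\<omega> z) * cosh (\<omega> z)"
proof -
  have sm: "smooth (nrm X)" and N: "cdot (nrm X z) (nrm X z) = 1" "cdot (Px X z) (nrm X z) = 0" "cdot (Py X z) (nrm X z) = 0" for z
    using X by (auto simp: spherical_surface_def with_gauss_map_def)
  have "cdot (nrm X z) (vdd a b (nrm X) z) = 0" for a b
    using dd_cdot[OF sm sm, of a b z] N(1) by (simp add: cdot_commute[of "vdd a b (nrm X) z"])
  then show "cdot (nrm X z) (Nx X z) = 0" "cdot (nrm X z) (Ny X z) = 0"
    by (simp_all add: vDx_eq_vdd vDy_eq_vdd)
  show "cdot (nrm X z) (nrm X z) = 1" "cdot (nrm X z) (Px X z) = 0" "cdot (nrm X z) (Py X z) = 0"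
    using N(1)[of z] N(2,3)[of z, unfolded cdot_commute[of _ "nrm X z"]] by blast+
  show I: "cdot (Px X z) (Px X z) = cosh (\<omega> z) * cosh (\<omega> z)" "cdot (Px X z) (Py X z) = 0" "cdot (Py X z) (Py X z) = sinh (\<omega> z) * sinh (\<omega> z)"
    "cdot (Px X z) (Nx X z) = sinh (\<omega> z) * cosh (\<omega> z)" "cdot (Px X z) (Ny X z) = 0" "cdot (Py X z) (Nx X z) = 0" "cdot (Py X z) (Ny X z) = sinh (\<omega> z) * cosh (\<omega> z)"
    "cdot (Nx X z) (Nx X z) = sinh (\<omega> z) * sinh (\<omega> z)" "cdot (Nx X z) (Ny X z) = 0" "cdot (Ny X z) (Ny X z) = cosh (\<omega> z) * cosh (\<omega> z)"
    using X by (auto simp: spherical_surface_def power2_eq_square)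
  show "cdot (Py X z) (Px X z) = 0" "cdot (Nx X z) (Px X z) = sinh (\<omega> z) * cosh (\<omega> z)" "cdot (Nx X z) (Py X z) = 0"
    "cdot (Ny X z) (Px X z) = 0" "cdot (Ny X z) (Py X z) = sinh (\<omega> z) * cosh (\<omega> z)" "cdot (Ny X z) (Nx X z) = 0"
    unfolding cdot_commute[of "Py X z" "Px X z"] cdot_commute[of "Nx X z" "Px X z"] cdot_commute[of "Nx X z" "Py X z"]
      cdot_commute[of "Ny X z" "Px X z"] cdot_commute[of "Ny X z" "Py X z"] cdot_commute[of "Ny X z" "Nx X z"]
    by (rule I)+
qed

lemma spherical_surface_adapted:
  assumes X: "spherical_surface X \<omega>" and e: "curvature_frame X \<omega> e1 e2"
  obtains \<epsilon> G where "\<epsilon> \<in> {1, -1}" "adapted X (\<lambda>z. \<epsilon> * \<omega> z) \<epsilon> G" "\<And>z. e1 z = \<epsilon> *s (G z *v axis 3 1)" "\<And>z. e2 z = G z *v axis 2 1"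
proof -
  have sm: "smooth (pos X)" "smooth (nrm X)" "smooth \<omega>" and \<mu>: "scl X \<noteq> 0" and sg: "sinh_gordon \<omega>"
    using X by (auto simp: spherical_surface_def with_gauss_map_def sinh_gordon_def)
  have fr: "Px X z = cosh (\<omega> z) *s e1 z" "Py X z = sinh (\<omega> z) *s e2 z" "Nx X z = sinh (\<omega> z) *s e1 z" "Ny X z = cosh (\<omega> z) *s e2 z" for z
    using e by (auto simp: curvature_frame_def)
  have p: "cosh (\<omega> z) * cosh (\<omega> z) - sinh (\<omega> z) * sinh (\<omega> z) = 1" for z
    using sinh_square'[of "\<omega> z"] by simp
  have h: "cosh (\<omega> z) *s (cosh (\<omega> z) *s v) - sinh (\<omega> z) *s (sinh (\<omega> z) *s v) = v" for v :: "complex^3" and z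
  proof -
    have "cosh (\<omega> z) *s (cosh (\<omega> z) *s v) - sinh (\<omega> z) *s (sinh (\<omega> z) *s v)
        = (cosh (\<omega> z) * cosh (\<omega> z) - sinh (\<omega> z) * sinh (\<omega> z)) *s v"
      by (simp add: vec_eq_iff algebra_simps)
    then show ?thesis by (simp add: p)
  qed
  \<comment> \<open>The identity cosh^2 - sinh^2 = 1 solves for e1 and e2 without division, so they
    are smooth also where sinh \<omega> or cosh \<omega> vanishes.\<close>
  have e1: "e1 z = cosh (\<omega> z) *s Px X z - sinh (\<omega> z) *s Nx X z" and e2: "e2 z = cosh (\<omega> z) *s Ny X z - sinh (\<omega> z) *s Py X z" for z
    by (simp_all only: fr h)
  have d: "smooth (Px X)" "smooth (Py X)" "smooth (Nx X)" "smooth (Ny X)"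
    unfolding vDx_eq_vdd vDy_eq_vdd by (intro smooth_vdd sm)+
  have sme: "smooth e1" "smooth e2"
    unfolding e1[abs_def] e2[abs_def] by (intro smooth_diff smooth_smult d smooth_sinh smooth_cosh sm)+
  note J = spherical_surface_cdot[OF X]
  have on: "cdot (nrm X z) (e2 z) = 0" "cdot (nrm X z) (e1 z) = 0" "cdot (e2 z) (e1 z) = 0" for z
    unfolding e1 e2 cdot_linear J by simp_all
  have on': "cdot (e2 z) (e2 z) = 1" "cdot (e1 z) (e1 z) = 1" for z
    unfolding e1 e2 cdot_linear J using p[of z] by algebra+
  obtain \<epsilon> and G :: "complex \<Rightarrow> complex^3^3" where \<epsilon>: "\<epsilon> \<in> {1, -1}" and G: "smooth G" "\<And>z. G z \<in> SO3"
    and g: "\<And>z. G z *v axis 1 1 = nrm X z" "\<And>z. G z *v axis 2 1 = e2 z" "\<And>z. G z *v axis 3 1 = \<epsilon> *s e1 z"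
    by (rule frame_of_columns[OF sm(2) sme(2) sme(1) J(1) on' on]) (rule that)
  have g3: "e1 z = \<epsilon> *s (G z *v axis 3 1)" for z using \<epsilon> by (auto simp: g)
  have col: "G z *v vector [0, 0, c] = c *s (G z *v axis 3 1)" "G z *v vector [0, c, 0] = c *s (G z *v axis 2 1)" for c z
    by (simp_all add: mat3_simps vector_3)
  have "adapted X (\<lambda>z. \<epsilon> * \<omega> z) \<epsilon> G"
    by (rule adaptedI[OF \<mu> sinh_gordon_scale[OF sg \<epsilon>] sm(1,2) G])
       (use \<epsilon> in \<open>auto simp: g fr col\<close>)
  then show ?thesis by (rule that[OF \<epsilon> _ g3 g(2)[symmetric]])
qed

lemma adapted_derivatives:
  assumes "adapted X \<omega> \<epsilon> G"
  shows "Nx X z = G z *v vector [0, 0, sinh (\<omega> z)]" "Ny X z = G z *v vector [0, cosh (\<omega> z), 0]"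
proof -
  have f: "framed (scl X) \<omega> G" and n: "nrm X = (\<lambda>z. G z *v axis 1 1)"
    using assms by (auto simp: adapted_def)
  have "Nx X z = mDx (scl X) G z *v axis 1 1" "Ny X z = mDy (scl X) G z *v axis 1 1"
    unfolding n vDx_eq_vdd vDy_eq_vdd mDx_def mDy_def
    by (simp_all add: vdd_matrix_vec framed_smooth[OF f])
  then show "Nx X z = G z *v vector [0, 0, sinh (\<omega> z)]" "Ny X z = G z *v vector [0, cosh (\<omega> z), 0]"
    by (simp_all add: framed_Dx[OF f] matrix_vector_mul_assoc[symmetric] matrix_vec_eq_iff[OF framed_smooth(3)[OF f]])
       (simp_all add: mat3_simps vector_3)
qed

lemma adapted_smooth_nrm: "adapted X \<omega> \<epsilon> G \<Longrightarrow> smooth (nrm X)"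
proof -
  assume a: "adapted X \<omega> \<epsilon> G"
  then have f: "framed (scl X) \<omega> G" and n: "nrm X = (\<lambda>z. G z *v axis 1 1)"
    by (auto simp: adapted_def)
  show ?thesis unfolding n using framed_smooth[OF f] by (intro smooth_matrix_vec smooth_const)
qed

lemma cdot_SO3_vector:
  "G \<in> SO3 \<Longrightarrow> cdot (G *v vector [a, b, c]) (G *v vector [a', b', c']) = a * a' + b * b' + c * c'"
  unfolding cdot_SO3 by (simp add: cdot_3 vector_3)

lemma axis_1_vector: "axis 1 1 = (vector [1, 0, 0] :: complex^3)"
  by (simp add: vec3_eq_iff axis_nth3 vector_3)

lemma adapted_gauss_map:
  assumes a: "adapted X \<omega> \<epsilon> G"
  shows "with_gauss_map X" "curvature_line_coordinate X"
proof -
  have f: "framed (scl X) \<omega> G" using a by (simp add: adapted_def)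
  have D: "nrm X z = G z *v axis 1 1" "Px X z = G z *v vector [0, 0, \<epsilon> * cosh (\<omega> z)]" "Py X z = G z *v vector [0, \<epsilon> * sinh (\<omega> z), 0]" for z
    using a by (auto simp: adapted_def)
  show "with_gauss_map X" "curvature_line_coordinate X"
    using a f adapted_smooth_nrm[OF a] unfolding with_gauss_map_def curvature_line_coordinate_def
    by (auto simp: D adapted_derivatives[OF a] cdot_SO3_vector framed_smooth(3)[OF f] axis_1_vector)
       (auto simp: adapted_def framed_def)
qed

lemma adapted_spherical_surface:
  assumes a: "adapted X \<omega> \<epsilon> G" and \<epsilon>: "\<epsilon> \<in> {1, -1}"
  shows "spherical_surface X (\<lambda>z. \<epsilon> * \<omega> z)"
    "curvature_frame X (\<lambda>z. \<epsilon> * \<omega> z) (\<lambda>z. \<epsilon> *s (G z *v axis 3 1)) (\<lambda>z. G z *v axis 2 1)"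
proof -
  have f: "framed (scl X) \<omega> G" using a by (simp add: adapted_def)
  have D: "nrm X z = G z *v axis 1 1" "Px X z = G z *v vector [0, 0, \<epsilon> * cosh (\<omega> z)]" "Py X z = G z *v vector [0, \<epsilon> * sinh (\<omega> z), 0]" for z
    using a by (auto simp: adapted_def)
  note DD = D adapted_derivatives[OF a]
  have "sinh_gordon (\<lambda>z. \<epsilon> * \<omega> z)" using f \<epsilon> by (intro sinh_gordon_scale) (simp add: framed_def)
  then show "spherical_surface X (\<lambda>z. \<epsilon> * \<omega> z)"
    unfolding spherical_surface_def sinh_gordon_def using adapted_gauss_map[OF a] \<epsilon>
    by (auto simp: DD cdot_SO3_vector framed_smooth(3)[OF f] power2_eq_square)
  have col: "G z *v vector [0, 0, c] = c *s (G z *v axis 3 1)" "G z *v vector [0, c, 0] = c *s (G z *v axis 2 1)" for c z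
    by (simp_all add: mat3_simps vector_3)
  show "curvature_frame X (\<lambda>z. \<epsilon> * \<omega> z) (\<lambda>z. \<epsilon> *s (G z *v axis 3 1)) (\<lambda>z. G z *v axis 2 1)"
    unfolding curvature_frame_def using \<epsilon> by (auto simp: DD col)
qed

section \<open>Bianchi-Baecklund transforms in frames\<close>

lemma framed_vec_derivative:
  assumes f: "framed \<mu> \<omega> G" and y: "smooth y"
  shows "vDx \<mu> (\<lambda>z. G z *v y z) z = G z *v (xi (vector [Dy \<mu> \<omega> z, - sinh (\<omega> z), 0]) *v y z + vDx \<mu> y z)"
    "vDy \<mu> (\<lambda>z. G z *v y z) z = G z *v (xi (vector [- Dx \<mu> \<omega> z, 0, cosh (\<omega> z)]) *v y z + vDy \<mu> y z)"
  using vdd_matrix_vec[OF framed_smooth(2)[OF f] y] framed_Dx[OF f, of z]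
  by (simp_all add: vDx_eq_vdd vDy_eq_vdd mDx_def mDy_def matrix_vector_right_distrib matrix_vector_mul_assoc)

definition bb_eqs :: "complex \<Rightarrow> complex \<Rightarrow> (complex \<Rightarrow> complex) \<Rightarrow> (complex \<Rightarrow> complex) \<Rightarrow> bool" where
  "bb_eqs \<mu> \<beta> \<omega> \<theta> \<longleftrightarrow> smooth \<theta> \<and>
     (\<forall>z. Dx \<mu> \<theta> z + \<i> * Dy \<mu> \<omega> z = sinh \<beta> * sinh (\<theta> z) * cosh (\<omega> z) + cosh \<beta> * cosh (\<theta> z) * sinh (\<omega> z)) \<and>
     (\<forall>z. \<i> * Dy \<mu> \<theta> z + Dx \<mu> \<omega> z = - sinh \<beta> * cosh (\<theta> z) * sinh (\<omega> z) - cosh \<beta> * sinh (\<theta> z) * cosh (\<omega> z))"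

text \<open>
  In the frame \<open>\<phi>\<close>, \<open>e2\<close>, \<open>\<epsilon> e1\<close> of the surface, \<open>bb_dir\<close> is the direction of the segment between corresponding
  points, and the columns of \<open>bb_matrix\<close> are the normal, \<open>e2\<close> and \<open>\<epsilon> e1\<close> of the transform, for
  which \<open>\<theta>\<close> takes the role of \<open>\<omega>\<close>.
\<close>

definition bb_dir :: "(complex \<Rightarrow> complex) \<Rightarrow> complex \<Rightarrow> complex^3" where
  "bb_dir \<theta> z = vector [0, \<i> * sinh (\<theta> z), cosh (\<theta> z)]"

definition bb_nrm :: "complex \<Rightarrow> (complex \<Rightarrow> complex) \<Rightarrow> complex \<Rightarrow> complex^3" where
  "bb_nrm \<beta> \<theta> z = vector [- (cosh \<beta> * inverse (sinh \<beta>)), \<i> * inverse (sinh \<beta>) * cosh (\<theta> z), inverse (sinh \<beta>) * sinh (\<theta> z)]"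

definition bb_matrix :: "complex \<Rightarrow> (complex \<Rightarrow> complex) \<Rightarrow> (complex \<Rightarrow> complex) \<Rightarrow> complex \<Rightarrow> complex^3^3" where
  "bb_matrix \<beta> \<omega> \<theta> z = transpose (vector [bb_nrm \<beta> \<theta> z,
     vector [- \<i> * cosh (\<omega> z) * inverse (sinh \<beta>),
       - sinh (\<omega> z) * sinh (\<theta> z) - cosh \<beta> * inverse (sinh \<beta>) * cosh (\<omega> z) * cosh (\<theta> z),
       \<i> * sinh (\<omega> z) * cosh (\<theta> z) + \<i> * cosh \<beta> * inverse (sinh \<beta>) * cosh (\<omega> z) * sinh (\<theta> z)],
     vector [- sinh (\<omega> z) * inverse (sinh \<beta>),
       \<i> * cosh (\<omega> z) * sinh (\<theta> z) + \<i> * cosh \<beta> * inverse (sinh \<beta>) * sinh (\<omega> z) * cosh (\<theta> z),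
       cosh (\<omega> z) * cosh (\<theta> z) + cosh \<beta> * inverse (sinh \<beta>) * sinh (\<omega> z) * sinh (\<theta> z)]])"

lemma det_transpose_rows:
  "det (transpose (vector [a, b, c] :: complex^3^3)) = cdot a (ccross b c)"
  unfolding det_transpose unfolding det_3 by (simp add: rows_nth cdot_3 ccross_def vector_3 algebra_simps)

lemma bb_matrix_SO3:
  assumes "sinh \<beta> \<noteq> 0"
  shows "bb_matrix \<beta> \<omega> \<theta> z \<in> SO3"
proof -
  define S T C s c t k where "S = sinh \<beta>" "T = inverse S" "C = cosh \<beta>" "s = sinh (\<omega> z)" "c = cosh (\<omega> z)" "t = sinh (\<theta> z)" "k = cosh (\<theta> z)"
  note defs = this
  have r: "S * T = 1" "C * C - S * S = 1" "c * c - s * s = 1" "k * k - t * t = 1" "\<i> * \<i> = -1"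
    using assms sinh_square'[of \<beta>] sinh_square'[of "\<omega> z"] sinh_square'[of "\<theta> z"] by (simp_all add: defs)
  \<comment> \<open>All that orthonormality needs to know about \<beta>: coth^2 minus the square of
    1/sinh is 1.\<close>
  have u: "C * T * (C * T) - T * T = 1" using r(1,2) by algebra
  show ?thesis
  proof (rule SO3I)
    show "transpose (bb_matrix \<beta> \<omega> \<theta> z) ** bb_matrix \<beta> \<omega> \<theta> z = mat 1"
      unfolding bb_matrix_def bb_nrm_def defs[symmetric]
    proof (rule columns_orthonormal; simp only: cdot_3 vector_3)
    qed (use r(3,4,5) u in algebra)+
    show "det (bb_matrix \<beta> \<omega> \<theta> z) = 1"
      unfolding bb_matrix_def bb_nrm_def defs[symmetric] det_transpose_rows cdot_3 ccross_def vector_3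
      using r(3,4,5) u by algebra
  qed
qed

lemma smooth_bb:
  assumes "smooth \<omega>" "smooth \<theta>"
  shows "smooth (bb_dir \<theta>)" "smooth (bb_nrm \<beta> \<theta>)" "smooth (bb_matrix \<beta> \<omega> \<theta>)"
proof -
  note sm = smooth_sinh[OF assms(1)] smooth_cosh[OF assms(1)] smooth_sinh[OF assms(2)] smooth_cosh[OF assms(2)]
  show "smooth (bb_dir \<theta>)" "smooth (bb_nrm \<beta> \<theta>)"
    unfolding bb_dir_def[abs_def] bb_nrm_def[abs_def] by (intro smooth_vector3 smooth_mult smooth_const sm)+
  show "smooth (bb_matrix \<beta> \<omega> \<theta>)"
    unfolding bb_matrix_def[abs_def]
  proof (intro smooth_transpose smooth_vec[of "\<lambda>z. vector [f z, g z, h z] :: complex^3^3" for f g h])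
    fix i :: 3
    show "smooth (\<lambda>z. (vector [bb_nrm \<beta> \<theta> z,
     vector [- \<i> * cosh (\<omega> z) * inverse (sinh \<beta>),
       - sinh (\<omega> z) * sinh (\<theta> z) - cosh \<beta> * inverse (sinh \<beta>) * cosh (\<omega> z) * cosh (\<theta> z),
       \<i> * sinh (\<omega> z) * cosh (\<theta> z) + \<i> * cosh \<beta> * inverse (sinh \<beta>) * cosh (\<omega> z) * sinh (\<theta> z)],
     vector [- sinh (\<omega> z) * inverse (sinh \<beta>),
       \<i> * cosh (\<omega> z) * sinh (\<theta> z) + \<i> * cosh \<beta> * inverse (sinh \<beta>) * sinh (\<omega> z) * cosh (\<theta> z),
       cosh (\<omega> z) * cosh (\<theta> z) + cosh \<beta> * inverse (sinh \<beta>) * sinh (\<omega> z) * sinh (\<theta> z)]] :: complex^3^3) $ i)"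
      using exhaust_3[of i] \<open>smooth (bb_nrm \<beta> \<theta>)\<close>
      by (elim disjE) (simp_all only: rows_nth, (intro smooth_vector3 smooth_mult smooth_add smooth_diff smooth_uminus smooth_const sm)+)
  qed
qed

text \<open>When the two equations are differentiated to form the Laplacian of \<theta>, the mixed
  second derivatives of \<omega> cancel. The first order terms left over are again the left sides of
  the equations.\<close>

lemma sinh_gordon_bb:
  assumes \<mu>: "\<mu> \<noteq> 0" and \<omega>: "sinh_gordon \<omega>" and bb: "bb_eqs \<mu> \<beta> \<omega> \<theta>"
  shows "sinh_gordon \<theta>"
  unfolding sinh_gordon_def
proof (intro conjI allI)
  have sm: "smooth \<omega>" and st: "smooth \<theta>" using \<omega> bb by (auto simp: sinh_gordon_def bb_eqs_def)
  show "smooth \<theta>" by fact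
  define f g where "f z = sinh \<beta> * sinh (\<theta> z) * cosh (\<omega> z) + cosh \<beta> * cosh (\<theta> z) * sinh (\<omega> z)"
    and "g z = - sinh \<beta> * cosh (\<theta> z) * sinh (\<omega> z) - cosh \<beta> * sinh (\<theta> z) * cosh (\<omega> z)" for z
  have e: "Dx \<mu> \<theta> z + \<i> * Dy \<mu> \<omega> z = f z" "\<i> * Dy \<mu> \<theta> z + Dx \<mu> \<omega> z = g z" for z
    using bb by (auto simp: bb_eqs_def f_def g_def)
  have x: "Dx \<mu> \<theta> = (\<lambda>z. f z - \<i> * Dy \<mu> \<omega> z)"
    using e(1) by (auto simp: fun_eq_iff eq_diff_eq)
  have y: "Dy \<mu> \<theta> = (\<lambda>z. - \<i> * (g z - Dx \<mu> \<omega> z))"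
  proof
    fix z
    have "g z - Dx \<mu> \<omega> z = \<i> * Dy \<mu> \<theta> z" unfolding e(2)[symmetric] by simp
    then show "Dy \<mu> \<theta> z = - \<i> * (g z - Dx \<mu> \<omega> z)" by (simp add: mult.assoc[symmetric])
  qed
  note sms = smooth_sinh[OF sm] smooth_cosh[OF sm] smooth_sinh[OF st] smooth_cosh[OF st]
  have sf: "smooth f" "smooth g"
    unfolding f_def[abs_def] g_def[abs_def] by (intro smooth_add smooth_diff smooth_mult smooth_const sms)+
  have dfg: "dd a b f z = (sinh \<beta> * cosh (\<theta> z) * cosh (\<omega> z) + cosh \<beta> * sinh (\<theta> z) * sinh (\<omega> z)) * dd a b \<theta> z
      + (sinh \<beta> * sinh (\<theta> z) * sinh (\<omega> z) + cosh \<beta> * cosh (\<theta> z) * cosh (\<omega> z)) * dd a b \<omega> z"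
    "dd a b g z = - (sinh \<beta> * sinh (\<theta> z) * sinh (\<omega> z) + cosh \<beta> * cosh (\<theta> z) * cosh (\<omega> z)) * dd a b \<theta> z
      - (sinh \<beta> * cosh (\<theta> z) * cosh (\<omega> z) + cosh \<beta> * sinh (\<theta> z) * sinh (\<omega> z)) * dd a b \<omega> z" for a b z
    unfolding f_def[abs_def] g_def[abs_def]
    by (simp_all add: dd_add dd_diff dd_mult dd_uminus dd_sinh dd_cosh sm st sms smooth_mult smooth_uminus) (simp_all add: algebra_simps)
  fix z
  have "pdx (pdx \<theta>) z + pdy (pdy \<theta>) z = Dx \<mu> (\<lambda>z. f z - \<i> * Dy \<mu> \<omega> z) z + Dy \<mu> (\<lambda>z. - \<i> * (g z - Dx \<mu> \<omega> z)) z"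
    unfolding laplace_eq_Dx_Dy[OF st \<mu>] x y ..
  also have "\<dots> = Dx \<mu> f z - \<i> * Dx \<mu> (Dy \<mu> \<omega>) z - \<i> * (Dy \<mu> g z - Dy \<mu> (Dx \<mu> \<omega>) z)"
    unfolding Dx_eq_dd Dy_eq_dd using sf sm by (simp add: dd_diff dd_cmult dd_uminus smooth_dd smooth_mult smooth_diff smooth_uminus)
  also have "Dx \<mu> (Dy \<mu> \<omega>) z = Dy \<mu> (Dx \<mu> \<omega>) z"
    unfolding Dx_eq_dd Dy_eq_dd by (rule dd_commute[OF sm])
  finally have L: "pdx (pdx \<theta>) z + pdy (pdy \<theta>) z = Dx \<mu> f z - \<i> * Dy \<mu> g z" by (simp add: algebra_simps)
  \<comment> \<open>Grouped so that the derivatives of \<theta> and \<omega> appear only in the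
    combinations given by the two equations.\<close>
  have "Dx \<mu> f z - \<i> * Dy \<mu> g z
      = (sinh \<beta> * cosh (\<theta> z) * cosh (\<omega> z) + cosh \<beta> * sinh (\<theta> z) * sinh (\<omega> z)) * (Dx \<mu> \<theta> z + \<i> * Dy \<mu> \<omega> z)
      + (sinh \<beta> * sinh (\<theta> z) * sinh (\<omega> z) + cosh \<beta> * cosh (\<theta> z) * cosh (\<omega> z)) * (\<i> * Dy \<mu> \<theta> z + Dx \<mu> \<omega> z)"
    unfolding Dx_eq_dd Dy_eq_dd dfg by (simp add: algebra_simps)
  also have "\<dots> = - (sinh (\<theta> z) * cosh (\<theta> z))"
    unfolding e f_def g_def using sinh_square'[of "\<omega> z"] sinh_square'[of \<beta>] by algebra
  finally show "pdx (pdx \<theta>) z + pdy (pdy \<theta>) z + sinh (\<theta> z) * cosh (\<theta> z) = 0" using L by simp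
qed

text \<open>Only the position of Z is prescribed. Its normal enters through the individual lemmas,
  since the position leaves at least its sign open.\<close>

context
  fixes X Z :: csurface and \<omega> \<theta> :: "complex \<Rightarrow> complex" and \<epsilon> \<beta> :: complex and G :: "complex \<Rightarrow> complex^3^3"
  assumes X: "adapted X \<omega> \<epsilon> G" and \<epsilon>: "\<epsilon> \<in> {1, -1}" and bb: "bb_eqs (scl X) \<beta> \<omega> \<theta>" and S: "sinh \<beta> \<noteq> 0"
    and sclZ: "scl Z = scl X"
    and posZ: "\<And>z. pos Z z = pos X z + G z *v ((\<epsilon> * inverse (sinh \<beta>)) *s bb_dir \<theta> z)"
begin

lemma fX: "framed (scl X) \<omega> G" and sg\<omega>: "sinh_gordon \<omega>" and \<mu>: "scl X \<noteq> 0" and sm\<omega>: "smooth \<omega>" and sm\<theta>: "smooth \<theta>"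
  using X bb by (auto simp: adapted_def framed_def sinh_gordon_def bb_eqs_def)

lemma sg\<theta>: "sinh_gordon \<theta>"
  by (rule sinh_gordon_bb[OF \<mu> sg\<omega> bb])

lemma bb_vdd:
  "vdd a b (bb_dir \<theta>) z = vector [0, \<i> * (cosh (\<theta> z) * dd a b \<theta> z), sinh (\<theta> z) * dd a b \<theta> z]"
  "vdd a b (bb_nrm \<beta> \<theta>) z = vector [0, \<i> * inverse (sinh \<beta>) * (sinh (\<theta> z) * dd a b \<theta> z), inverse (sinh \<beta>) * (cosh (\<theta> z) * dd a b \<theta> z)]"
  unfolding bb_dir_def[abs_def] bb_nrm_def[abs_def] vdd_vector3
  by (simp_all add: dd_cmult dd_sinh dd_cosh sm\<theta> smooth_sinh smooth_cosh)

lemma pos_Z: "pos Z = (\<lambda>z. pos X z + G z *v ((\<epsilon> * inverse (sinh \<beta>)) *s bb_dir \<theta> z))"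
  using posZ by auto

lemma smooth_pos_Z: "smooth (pos Z)"
  unfolding pos_Z using X
  by (intro smooth_add smooth_matrix_vec smooth_smult smooth_const smooth_bb[OF sm\<omega> sm\<theta>] framed_smooth(2)[OF fX]) (simp add: adapted_def)

text \<open>With inverse (sinh \<beta>) as an unknown of its own, the derivative formulas for the
  transform become polynomial consequences of these relations.\<close>

lemma rels:
  "sinh \<beta> * inverse (sinh \<beta>) = 1" "sinh (\<theta> z) * sinh (\<theta> z) = cosh (\<theta> z) * cosh (\<theta> z) - 1"
  "sinh (\<omega> z) * sinh (\<omega> z) = cosh (\<omega> z) * cosh (\<omega> z) - 1" "\<i> * \<i> = -1"
  "Dx (scl X) \<theta> z + \<i> * Dy (scl X) \<omega> z = sinh \<beta> * sinh (\<theta> z) * cosh (\<omega> z) + cosh \<beta> * cosh (\<theta> z) * sinh (\<omega> z)"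
  "\<i> * Dy (scl X) \<theta> z + Dx (scl X) \<omega> z = - sinh \<beta> * cosh (\<theta> z) * sinh (\<omega> z) - cosh \<beta> * sinh (\<theta> z) * cosh (\<omega> z)"
  using S bb by (auto simp: sinh_square' bb_eqs_def)

lemma Px_Z: "Px Z z = G z *v (bb_matrix \<beta> \<omega> \<theta> z *v vector [0, 0, \<epsilon> * cosh (\<theta> z)])"
  and Py_Z: "Py Z z = G z *v (bb_matrix \<beta> \<omega> \<theta> z *v vector [0, \<epsilon> * sinh (\<theta> z), 0])"
proof -
  have smX: "smooth (pos X)" using X by (simp add: adapted_def)
  have smv: "smooth (\<lambda>z. (\<epsilon> * inverse (sinh \<beta>)) *s bb_dir \<theta> z)"
    by (intro smooth_smult smooth_const smooth_bb[OF sm\<omega> sm\<theta>])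
  have dv: "vdd a b (\<lambda>z. (\<epsilon> * inverse (sinh \<beta>)) *s bb_dir \<theta> z) z = (\<epsilon> * inverse (sinh \<beta>)) *s vdd a b (bb_dir \<theta>) z" for a b
    by (simp add: vdd_smult smooth_bb[OF sm\<omega> sm\<theta>])
  have smGv: "smooth (\<lambda>z. G z *v ((\<epsilon> * inverse (sinh \<beta>)) *s bb_dir \<theta> z))"
    by (intro smooth_matrix_vec smv framed_smooth(2)[OF fX])
  have d: "vDx (scl X) (pos Z) z = Px X z + vDx (scl X) (\<lambda>z. G z *v ((\<epsilon> * inverse (sinh \<beta>)) *s bb_dir \<theta> z)) z"
    "vDy (scl X) (pos Z) z = Py X z + vDy (scl X) (\<lambda>z. G z *v ((\<epsilon> * inverse (sinh \<beta>)) *s bb_dir \<theta> z)) z"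
    unfolding pos_Z vDx_eq_vdd vDy_eq_vdd by (rule vdd_add[OF smX smGv])+
  have PX: "Px X z = G z *v vector [0, 0, \<epsilon> * cosh (\<omega> z)]" "Py X z = G z *v vector [0, \<epsilon> * sinh (\<omega> z), 0]"
    using X by (auto simp: adapted_def)
  note r = rels(1,4) rels(2,3,5,6)[of z]
  show "Px Z z = G z *v (bb_matrix \<beta> \<omega> \<theta> z *v vector [0, 0, \<epsilon> * cosh (\<theta> z)])"
    unfolding sclZ d(1) framed_vec_derivative[OF fX smv] PX matrix_vector_right_distrib[symmetric]
  proof (rule arg_cong[where f="\<lambda>v. G z *v v"])
    show "vector [0, 0, \<epsilon> * cosh (\<omega> z)] + (xi (vector [Dy (scl X) \<omega> z, - sinh (\<omega> z), 0]) *v ((\<epsilon> * inverse (sinh \<beta>)) *s bb_dir \<theta> z)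
      + vDx (scl X) (\<lambda>z. (\<epsilon> * inverse (sinh \<beta>)) *s bb_dir \<theta> z) z) = bb_matrix \<beta> \<omega> \<theta> z *v vector [0, 0, \<epsilon> * cosh (\<theta> z)]"
      unfolding vDx_eq_vdd dv bb_vdd unfolding Dx_eq_dd[symmetric] bb_dir_def bb_matrix_def bb_nrm_def vec3_eq_iff matrix_vec_nth3 xi_nth
        vector_add_component vector_smult_component transpose_nth rows_nth vector_3
      using r by (intro conjI) algebra+
  qed
  show "Py Z z = G z *v (bb_matrix \<beta> \<omega> \<theta> z *v vector [0, \<epsilon> * sinh (\<theta> z), 0])"
    unfolding sclZ d(2) framed_vec_derivative[OF fX smv] PX matrix_vector_right_distrib[symmetric]
  proof (rule arg_cong[where f="\<lambda>v. G z *v v"])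
    show "vector [0, \<epsilon> * sinh (\<omega> z), 0] + (xi (vector [- Dx (scl X) \<omega> z, 0, cosh (\<omega> z)]) *v ((\<epsilon> * inverse (sinh \<beta>)) *s bb_dir \<theta> z)
      + vDy (scl X) (\<lambda>z. (\<epsilon> * inverse (sinh \<beta>)) *s bb_dir \<theta> z) z) = bb_matrix \<beta> \<omega> \<theta> z *v vector [0, \<epsilon> * sinh (\<theta> z), 0]"
      unfolding vDy_eq_vdd dv bb_vdd unfolding Dy_eq_dd[symmetric] bb_dir_def bb_matrix_def bb_nrm_def vec3_eq_iff matrix_vec_nth3 xi_nth
        vector_add_component vector_smult_component transpose_nth rows_nth vector_3
      using r by (intro conjI) algebra+
  qed
qed

lemma bb_nrm_derivative:
  "vDx (scl X) (\<lambda>z. G z *v bb_nrm \<beta> \<theta> z) z = G z *v (bb_matrix \<beta> \<omega> \<theta> z *v vector [0, 0, sinh (\<theta> z)])"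
  "vDy (scl X) (\<lambda>z. G z *v bb_nrm \<beta> \<theta> z) z = G z *v (bb_matrix \<beta> \<omega> \<theta> z *v vector [0, cosh (\<theta> z), 0])"
proof -
  note r = rels(1,4) rels(2,3,5,6)[of z]
  have smn: "smooth (bb_nrm \<beta> \<theta>)" by (rule smooth_bb(2)[OF sm\<omega> sm\<theta>])
  show "vDx (scl X) (\<lambda>z. G z *v bb_nrm \<beta> \<theta> z) z = G z *v (bb_matrix \<beta> \<omega> \<theta> z *v vector [0, 0, sinh (\<theta> z)])"
    unfolding framed_vec_derivative[OF fX smn]
  proof (rule arg_cong[where f="\<lambda>v. G z *v v"])
    show "xi (vector [Dy (scl X) \<omega> z, - sinh (\<omega> z), 0]) *v bb_nrm \<beta> \<theta> z + vDx (scl X) (bb_nrm \<beta> \<theta>) z = bb_matrix \<beta> \<omega> \<theta> z *v vector [0, 0, sinh (\<theta> z)]"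
      unfolding vDx_eq_vdd bb_vdd unfolding Dx_eq_dd[symmetric] bb_matrix_def bb_nrm_def vec3_eq_iff matrix_vec_nth3 xi_nth
        vector_add_component vector_smult_component transpose_nth rows_nth vector_3
      using r by (intro conjI) algebra+
  qed
  show "vDy (scl X) (\<lambda>z. G z *v bb_nrm \<beta> \<theta> z) z = G z *v (bb_matrix \<beta> \<omega> \<theta> z *v vector [0, cosh (\<theta> z), 0])"
    unfolding framed_vec_derivative[OF fX smn]
  proof (rule arg_cong[where f="\<lambda>v. G z *v v"])
    show "xi (vector [- Dx (scl X) \<omega> z, 0, cosh (\<omega> z)]) *v bb_nrm \<beta> \<theta> z + vDy (scl X) (bb_nrm \<beta> \<theta>) z = bb_matrix \<beta> \<omega> \<theta> z *v vector [0, cosh (\<theta> z), 0]"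
      unfolding vDy_eq_vdd bb_vdd unfolding Dy_eq_dd[symmetric] bb_matrix_def bb_nrm_def vec3_eq_iff matrix_vec_nth3 xi_nth
        vector_add_component vector_smult_component transpose_nth rows_nth vector_3
      using r by (intro conjI) algebra+
  qed
qed

text \<open>For \<open>s = -1\<close> the normal is reversed, which replaces \<open>\<theta>\<close> by \<open>- \<theta>\<close> and \<open>e2\<close> by \<open>- e2\<close>.\<close>

lemma bb_adapted:
  assumes s: "s \<in> {1, -1}" and n: "\<And>z. nrm Z z = G z *v (s *s bb_nrm \<beta> \<theta> z)"
  shows "\<exists>H. adapted Z (\<lambda>z. s * \<theta> z) \<epsilon> H"
proof -
  \<comment> \<open>For s = -1 this is the half-turn about the third axis: it reverses the normal
    and e2 and keeps \<epsilon> e1.\<close>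
  define D :: "complex^3^3" where "D = transpose (vector [vector [s, 0, 0], vector [0, s, 0], vector [0, 0, 1]])"
  have ss: "s * s = 1" using s by auto
  have D: "D \<in> SO3"
  proof (rule SO3I)
    show "transpose D ** D = mat 1"
      unfolding D_def by (rule columns_orthonormal) (simp_all add: cdot_3 vector_3 ss)
    show "det D = 1"
      unfolding D_def det_transpose_rows by (simp add: cdot_3 vector_3 ccross_def ss)
  qed
  define H where "H z = G z ** bb_matrix \<beta> \<omega> \<theta> z ** D" for z
  have H: "H z *v v = G z *v (bb_matrix \<beta> \<omega> \<theta> z *v (D *v v))" for z v
    by (simp add: H_def matrix_vector_mul_assoc matrix_mul_assoc)
  have Dv: "D *v vector [a, b, c] = vector [s * a, s * b, c]" "D *v axis 1 1 = vector [s, 0, 0]" for a b c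
    by (simp_all add: D_def vec3_eq_iff matrix_vec_nth3 transpose_nth rows_nth vector_3 axis_nth3)
  have Bv: "bb_matrix \<beta> \<omega> \<theta> z *v vector [s, 0, 0] = s *s bb_nrm \<beta> \<theta> z" for z
    by (simp add: bb_matrix_def vec3_eq_iff matrix_vec_nth3 transpose_nth rows_nth vector_3)
  have smn: "smooth (\<lambda>z. G z *v bb_nrm \<beta> \<theta> z)"
    by (intro smooth_matrix_vec smooth_bb[OF sm\<omega> sm\<theta>] framed_smooth(2)[OF fX])
  have nZ: "nrm Z = (\<lambda>z. s *s (G z *v bb_nrm \<beta> \<theta> z))"
    using n by (auto simp: matrix_vec_smult)
  have sh: "sinh (s * x) = s * sinh x" "cosh (s * x) = cosh x" for x :: complex
    using s by auto
  have "adapted Z (\<lambda>z. s * \<theta> z) \<epsilon> H"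
  proof (rule adaptedI)
    show "scl Z \<noteq> 0" "smooth (pos Z)" by (simp_all add: sclZ \<mu> smooth_pos_Z)
    show "sinh_gordon (\<lambda>z. s * \<theta> z)" by (rule sinh_gordon_scale[OF sg\<theta> s])
    show "smooth (nrm Z)" unfolding nZ by (intro smooth_smult smooth_const smn)
    show "smooth H" unfolding H_def[abs_def]
      by (intro smooth_matrix_mult smooth_const smooth_bb[OF sm\<omega> sm\<theta>] framed_smooth(2)[OF fX])
    show "H z \<in> SO3" for z unfolding H_def by (intro SO3_mult D bb_matrix_SO3 S framed_smooth(3)[OF fX])
    show "\<epsilon> \<noteq> 0" using \<epsilon> by auto
    show "nrm Z z = H z *v axis 1 1" for z unfolding H Dv Bv by (rule n)
    show "Px Z z = H z *v vector [0, 0, \<epsilon> * cosh (s * \<theta> z)]" "Py Z z = H z *v vector [0, \<epsilon> * sinh (s * \<theta> z), 0]" for z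
      unfolding H Dv Px_Z Py_Z sh using ss by (simp_all add: mult.left_commute mult.assoc[symmetric])
    have "vDx (scl X) (nrm Z) z = s *s (G z *v (bb_matrix \<beta> \<omega> \<theta> z *v vector [0, 0, sinh (\<theta> z)]))"
      "vDy (scl X) (nrm Z) z = s *s (G z *v (bb_matrix \<beta> \<omega> \<theta> z *v vector [0, cosh (\<theta> z), 0]))" for z
      unfolding nZ vDx_eq_vdd vDy_eq_vdd
      by (simp_all add: vdd_smult smn) (simp_all add: vDx_eq_vdd[symmetric] vDy_eq_vdd[symmetric] bb_nrm_derivative)
    then show "Nx Z z = H z *v vector [0, 0, sinh (s * \<theta> z)]" "Ny Z z = H z *v vector [0, cosh (s * \<theta> z), 0]" for z
      unfolding sclZ H Dv sh by (simp_all add: matrix_vec_smult[symmetric]) (simp_all add: mat3_simps vector_3 algebra_simps)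
  qed
  then show ?thesis by blast
qed

lemma BB_intro:
  assumes s: "s \<in> {1, -1}" and n: "\<And>z. nrm Z z = G z *v (s *s bb_nrm \<beta> \<theta> z)"
  shows "BB \<beta> X Z"
proof -
  obtain H where Z: "adapted Z (\<lambda>z. s * \<theta> z) \<epsilon> H" using bb_adapted[OF assms] by blast
  have nX: "nrm X z = G z *v axis 1 1" for z using X by (simp add: adapted_def)
  have dif: "pos Z z - pos X z = G z *v ((\<epsilon> * inverse (sinh \<beta>)) *s bb_dir \<theta> z)" for z
    by (simp add: posZ)
  have SO: "G z \<in> SO3" for z by (rule framed_smooth(3)[OF fX])
  have ss: "s * s = 1" "\<epsilon> * \<epsilon> = 1" using s \<epsilon> by auto
  have r: "sinh \<beta> * inverse (sinh \<beta>) = 1" using S by simp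
  \<comment> \<open>The required cosine and sine of the angle between the normals: p is their inner
    product, and p / q = - i cosh \<beta>.\<close>
  define p q where "p = - s * cosh \<beta> * inverse (sinh \<beta>)" and "q = - \<i> * s * inverse (sinh \<beta>)"
  have pq: "p * p + q * q = 1"
  proof -
    have "p * p + q * q = (s * s) * (inverse (sinh \<beta>) * inverse (sinh \<beta>)) * (cosh \<beta> * cosh \<beta> - 1)"
      by (simp add: p_def q_def algebra_simps)
    also have "\<dots> = (sinh \<beta> * inverse (sinh \<beta>)) * (sinh \<beta> * inverse (sinh \<beta>))"
      unfolding ss sinh_square'[symmetric] by (simp add: mult_ac)
    finally show ?thesis using r by simp
  qed
  \<comment> \<open>A complex angle with exp (i \<sigma>) = p + i q; the logarithm exists because (p
    + i q) (p - i q) = 1.\<close>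
  define \<sigma> where "\<sigma> = - \<i> * Ln (p + \<i> * q)"
  have prod: "(p + \<i> * q) * (p - \<i> * q) = 1" using pq by (simp add: algebra_simps)
  then have nz: "p + \<i> * q \<noteq> 0" by auto
  have "exp (\<i> * \<sigma>) = p + \<i> * q" using nz by (simp add: \<sigma>_def mult.assoc[symmetric] exp_Ln)
  moreover have "exp (- (\<i> * \<sigma>)) = p - \<i> * q"
    using prod nz calculation by (simp add: exp_minus field_simps)
  ultimately have cs: "cos \<sigma> = p" "sin \<sigma> = q"
    by (simp_all add: cos_exp_eq sin_exp_eq field_simps)
  have "bianchi_baecklund_transform \<sigma> X Z"
    unfolding bianchi_baecklund_transform_def
  proof (intro conjI allI)
    show "with_gauss_map X" "curvature_line_coordinate X" by (rule adapted_gauss_map[OF X])+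
    show "with_gauss_map Z" "curvature_line_coordinate Z" by (rule adapted_gauss_map[OF Z])+
    show "scl Z = scl X" by (rule sclZ)
    show "cdot (pos Z z - pos X z) (nrm X z) = 0" "cdot (pos Z z - pos X z) (nrm Z z) = 0" for z
      unfolding dif nX n cdot_SO3[OF SO] bb_dir_def bb_nrm_def
      by (simp_all add: cdot_3 vector_3 axis_nth3) (simp add: algebra_simps)
    have "cdot (pos Z z - pos X z) (pos Z z - pos X z) = (inverse (sinh \<beta>))\<^sup>2" for z
    proof -
      have "cdot (pos Z z - pos X z) (pos Z z - pos X z) = (\<epsilon> * \<epsilon>) * (inverse (sinh \<beta>))\<^sup>2 * (cosh (\<theta> z) * cosh (\<theta> z) - sinh (\<theta> z) * sinh (\<theta> z))"
        unfolding dif cdot_SO3[OF SO] bb_dir_def by (simp add: cdot_3 vector_3 power2_eq_square algebra_simps)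
      then show ?thesis using ss by (simp add: sinh_square')
    qed
    then show "\<exists>d. \<forall>z. cdot (pos Z z - pos X z) (pos Z z - pos X z) = d\<^sup>2" by blast
    show "cdot (nrm X z) (nrm Z z) = cos \<sigma>" for z
      unfolding nX n cdot_SO3[OF SO] cs bb_nrm_def p_def by (simp add: cdot_3 vector_3 axis_nth3)
  qed
  moreover have "sin \<sigma> \<noteq> 0" "cot \<sigma> = - \<i> * cosh \<beta>"
    using S s by (auto simp: cot_def cs p_def q_def field_simps)
  moreover have "spherical_surface X (\<lambda>z. \<epsilon> * \<omega> z)" "curvature_frame X (\<lambda>z. \<epsilon> * \<omega> z) (\<lambda>z. \<epsilon> *s (G z *v axis 3 1)) (\<lambda>z. G z *v axis 2 1)"
    by (rule adapted_spherical_surface[OF X \<epsilon>])+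
  moreover have "smooth (\<lambda>z. \<epsilon> * \<theta> z)" by (intro smooth_mult smooth_const sm\<theta>)
  moreover have D: "Dx (scl X) (\<lambda>z. \<epsilon> * \<theta> z) z = \<epsilon> * Dx (scl X) \<theta> z" "Dx (scl X) (\<lambda>z. \<epsilon> * \<omega> z) z = \<epsilon> * Dx (scl X) \<omega> z"
    "Dy (scl X) (\<lambda>z. \<epsilon> * \<theta> z) z = \<epsilon> * Dy (scl X) \<theta> z" "Dy (scl X) (\<lambda>z. \<epsilon> * \<omega> z) z = \<epsilon> * Dy (scl X) \<omega> z" for z
    by (simp_all add: Dx_eq_dd Dy_eq_dd dd_cmult sm\<theta> sm\<omega>)
  have sh: "sinh (\<epsilon> * x) = \<epsilon> * sinh x" "cosh (\<epsilon> * x) = cosh x" for x :: complex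
    using \<epsilon> by auto
  \<comment> \<open>The equations are odd under simultaneous change of sign of \<omega> and
    \<theta>, so \<epsilon> factors out.\<close>
  have "Dx (scl X) (\<lambda>z. \<epsilon> * \<theta> z) z + \<i> * Dy (scl X) (\<lambda>z. \<epsilon> * \<omega> z) z
      = sinh \<beta> * sinh (\<epsilon> * \<theta> z) * cosh (\<epsilon> * \<omega> z) + cosh \<beta> * cosh (\<epsilon> * \<theta> z) * sinh (\<epsilon> * \<omega> z)"
    "\<i> * Dy (scl X) (\<lambda>z. \<epsilon> * \<theta> z) z + Dx (scl X) (\<lambda>z. \<epsilon> * \<omega> z) z
      = - sinh \<beta> * cosh (\<epsilon> * \<theta> z) * sinh (\<epsilon> * \<omega> z) - cosh \<beta> * sinh (\<epsilon> * \<theta> z) * cosh (\<epsilon> * \<omega> z)" for z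
    unfolding D sh using rels(5,6)[of z] by algebra+
  moreover have "pos Z z = pos X z + (1 / sinh \<beta>) *s (cosh (\<epsilon> * \<theta> z) *s (\<epsilon> *s (G z *v axis 3 1)) + (\<i> * sinh (\<epsilon> * \<theta> z)) *s (G z *v axis 2 1))" for z
    unfolding posZ sh bb_dir_def by (simp add: mat3_simps vector_3 field_simps)
  ultimately show ?thesis unfolding BB_def by blast
qed

text \<open>
  The remaining case in the analysis of the normal of a transform: here \<open>F\<close> is a straight line, and
  the transform a translate of it whose normal is rotated by a constant angle.
\<close>

lemma degenerate_adapted:
  assumes sh: "\<And>z. sinh (\<omega> z) = 0" "\<And>z. sinh (\<theta> z) = 0" and n: "\<And>z. nrm Z z = G z *v y z"
    and y: "\<And>z. y z = vector [a, b * cosh (\<theta> z), 0]" and ab: "a * a + b * b = 1"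
  shows "\<exists>H. adapted Z \<theta> \<epsilon> H"
proof -
  have ch: "cosh (\<omega> z) * cosh (\<omega> z) = 1" "cosh (\<theta> z) * cosh (\<theta> z) = 1" for z
    using sinh_square'[of "\<omega> z"] sinh_square'[of "\<theta> z"] sh[of z] by simp_all
  \<comment> \<open>With both hyperbolic sines zero the third column of \<open>bb_matrix\<close> is
    (0, 0, k). Keeping it and taking y as first column, the second column of M is their cross
    product.\<close>
  define k where "k z = cosh (\<omega> z) * cosh (\<theta> z)" for z
  have kk: "k z * k z = 1" for z
  proof -
    have "k z * k z = (cosh (\<omega> z) * cosh (\<omega> z)) * (cosh (\<theta> z) * cosh (\<theta> z))" by (simp add: k_def mult_ac)
    then show ?thesis by (simp add: ch)
  qed
  define M where "M z = transpose (vector [y z, vector [- (k z * (b * cosh (\<theta> z))), k z * a, 0], vector [0, 0, k z]] :: complex^3^3)" for z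
  have d0: "dd c d \<omega> z = 0" "dd c d \<theta> z = 0" for c d z
  proof -
    have "dd c d (\<lambda>z. sinh (\<omega> z)) z = 0" "dd c d (\<lambda>z. sinh (\<theta> z)) z = 0" unfolding sh by simp_all
    then have "cosh (\<omega> z) * dd c d \<omega> z = 0" "cosh (\<theta> z) * dd c d \<theta> z = 0"
      by (simp_all add: dd_sinh sm\<omega> sm\<theta>)
    moreover have "cosh (\<omega> z) \<noteq> 0" "cosh (\<theta> z) \<noteq> 0" using ch[of z] by auto
    ultimately show "dd c d \<omega> z = 0" "dd c d \<theta> z = 0" by simp_all
  qed
  note sms = smooth_cosh[OF sm\<omega>] smooth_cosh[OF sm\<theta>]
  have smk: "smooth k" unfolding k_def[abs_def] by (intro smooth_mult sms)
  have smy: "smooth y"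
  proof -
    have "y = (\<lambda>z. vector [a, b * cosh (\<theta> z), 0])" using y by auto
    moreover have "smooth (\<lambda>z. vector [a, b * cosh (\<theta> z), 0] :: complex^3)" by (intro smooth_vector3 smooth_mult smooth_const sms)
    ultimately show ?thesis by simp
  qed
  have dy: "vdd c d y z = 0" for c d z
  proof -
    have "y = (\<lambda>z. vector [a, b * cosh (\<theta> z), 0])" using y by auto
    then show ?thesis by (simp add: vdd_vector3 dd_cmult dd_cosh sms sm\<theta> sh vec3_eq_iff vector_3)
  qed
  have MSO: "M z \<in> SO3" for z
  proof (rule SO3I)
    have e: "b * cosh (\<theta> z) * (b * cosh (\<theta> z)) = b * b" using ch(2)[of z] by (simp add: mult_ac)
    show "transpose (M z) ** M z = mat 1"
      unfolding M_def y
      by (rule columns_orthonormal; simp only: cdot_3 vector_3) ((simp; fail) | (use kk[of z] ab e in algebra))+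
    show "det (M z) = 1"
      unfolding M_def y det_transpose_rows cdot_3 ccross_def vector_3 using kk[of z] ab e by algebra
  qed
  have smM: "smooth M"
  proof -
    have "smooth (\<lambda>z. vector [y z, vector [- (k z * (b * cosh (\<theta> z))), k z * a, 0], vector [0, 0, k z]] :: complex^3^3)"
    proof (rule smooth_vec)
      fix i :: 3
      show "smooth (\<lambda>z. (vector [y z, vector [- (k z * (b * cosh (\<theta> z))), k z * a, 0], vector [0, 0, k z]] :: complex^3^3) $ i)"
        using exhaust_3[of i] smy
        by (elim disjE) (simp_all only: rows_nth, (intro smooth_vector3 smooth_mult smooth_uminus smooth_const smk sms)+)
    qed
    then show ?thesis unfolding M_def[abs_def] by (rule smooth_transpose)
  qed
  define H where "H z = G z ** M z" for z
  have H: "H z *v v = G z *v (M z *v v)" for z v by (simp add: H_def matrix_vector_mul_assoc)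
  have nZ: "nrm Z = (\<lambda>z. G z *v y z)" using n by auto
  have "adapted Z \<theta> \<epsilon> H"
  proof (rule adaptedI)
    show "scl Z \<noteq> 0" "smooth (pos Z)" "sinh_gordon \<theta>" by (simp_all add: sclZ \<mu> smooth_pos_Z sg\<theta>)
    show "smooth (nrm Z)" unfolding nZ by (intro smooth_matrix_vec smy framed_smooth(2)[OF fX])
    show "smooth H" unfolding H_def[abs_def] by (intro smooth_matrix_mult smM framed_smooth(2)[OF fX])
    show "H z \<in> SO3" for z unfolding H_def by (intro SO3_mult MSO framed_smooth(3)[OF fX])
    show "\<epsilon> \<noteq> 0" using \<epsilon> by auto
    show "nrm Z z = H z *v axis 1 1" for z
      unfolding H n by (simp add: M_def y vec3_eq_iff matrix_vec_nth3 transpose_nth rows_nth vector_3 axis_nth3)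
    show "Px Z z = H z *v vector [0, 0, \<epsilon> * cosh (\<theta> z)]" "Py Z z = H z *v vector [0, \<epsilon> * sinh (\<theta> z), 0]" for z
      unfolding H Px_Z Py_Z by (rule arg_cong[where f="\<lambda>v. G z *v v"],
        simp add: M_def bb_matrix_def k_def sh vec3_eq_iff matrix_vec_nth3 transpose_nth rows_nth vector_3)+
    show "Nx Z z = H z *v vector [0, 0, sinh (\<theta> z)]" for z
      unfolding H nZ sclZ framed_vec_derivative[OF fX smy]
      by (rule arg_cong[where f="\<lambda>v. G z *v v"])
         (simp add: vDx_eq_vdd dy Dy_eq_dd d0 sh vec3_eq_iff matrix_vec_nth3 xi_nth vector_3)
    have kc: "k z * cosh (\<theta> z) = cosh (\<omega> z)" for z using ch(2)[of z] by (simp add: k_def mult.assoc)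
    show "Ny Z z = H z *v vector [0, cosh (\<theta> z), 0]" for z
      unfolding H nZ sclZ framed_vec_derivative[OF fX smy]
    proof (rule arg_cong[where f="\<lambda>v. G z *v v"])
      show "xi (vector [- Dx (scl X) \<omega> z, 0, cosh (\<omega> z)]) *v y z + vDy (scl X) y z = M z *v vector [0, cosh (\<theta> z), 0]"
        unfolding vDy_eq_vdd dy Dx_eq_dd d0 M_def y vec3_eq_iff matrix_vec_nth3 xi_nth vector_add_component transpose_nth rows_nth vector_3 zero_index
        by (simp add: kc[symmetric] mult_ac)
    qed
  qed
  then show ?thesis by blast
qed

end

text \<open>In the frame of X the normal of Z has first component cos \<sigma>, is orthogonal to the
  segment and has length 1, which leaves two independent signs. One is s. If the other does not
  match it, tangency to Z forces the degenerate case; \<open>nd\<close> either makes the mismatch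
  disappear, by cosh \<beta> = 0, or excludes zeros of cosh \<omega>.\<close>

lemma BB_elim:
  assumes B: "BB \<beta> X Z" and S: "sinh \<beta> \<noteq> 0" and nd: "cosh \<beta> = 0 \<or> (\<forall>z. cdot (Px X z) (Px X z) \<noteq> 0)"
  obtains \<omega> \<epsilon> G \<theta> s H where "\<epsilon> \<in> {1, -1}" "s \<in> {1, -1}" "adapted X \<omega> \<epsilon> G" "bb_eqs (scl X) \<beta> \<omega> \<theta>" "adapted Z (\<lambda>z. s * \<theta> z) \<epsilon> H"
proof -
  obtain \<sigma> \<omega>' e1 e2 \<theta>' where \<sigma>: "sin \<sigma> \<noteq> 0" "cot \<sigma> = - \<i> * cosh \<beta>" and bt: "bianchi_baecklund_transform \<sigma> X Z"
    and sp: "spherical_surface X \<omega>'" "curvature_frame X \<omega>' e1 e2" and sm\<theta>': "smooth \<theta>'"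
    and eq: "\<And>z. Dx (scl X) \<theta>' z + \<i> * Dy (scl X) \<omega>' z = sinh \<beta> * sinh (\<theta>' z) * cosh (\<omega>' z) + cosh \<beta> * cosh (\<theta>' z) * sinh (\<omega>' z)"
     "\<And>z. \<i> * Dy (scl X) \<theta>' z + Dx (scl X) \<omega>' z = - sinh \<beta> * cosh (\<theta>' z) * sinh (\<omega>' z) - cosh \<beta> * sinh (\<theta>' z) * cosh (\<omega>' z)"
    and pZ: "\<And>z. pos Z z = pos X z + (1 / sinh \<beta>) *s (cosh (\<theta>' z) *s e1 z + (\<i> * sinh (\<theta>' z)) *s e2 z)"
    using B unfolding BB_def by blast
  obtain \<epsilon> G where \<epsilon>: "\<epsilon> \<in> {1, -1}" and X: "adapted X (\<lambda>z. \<epsilon> * \<omega>' z) \<epsilon> G"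
    and e: "\<And>z. e1 z = \<epsilon> *s (G z *v axis 3 1)" "\<And>z. e2 z = G z *v axis 2 1"
    by (rule spherical_surface_adapted[OF sp]) (rule that)
  define \<omega> \<theta> where "\<omega> z = \<epsilon> * \<omega>' z" and "\<theta> z = \<epsilon> * \<theta>' z" for z
  have ee: "\<epsilon> * \<epsilon> = 1" using \<epsilon> by auto
  have sm\<omega>': "smooth \<omega>'" using sp(1) by (simp add: spherical_surface_def)
  have sh: "sinh (\<epsilon> * x) = \<epsilon> * sinh x" "cosh (\<epsilon> * x) = cosh x" for x :: complex
    using \<epsilon> by auto
  have X: "adapted X \<omega> \<epsilon> G" using X by (simp add: \<omega>_def[abs_def])
  have D: "Dx (scl X) \<theta> z = \<epsilon> * Dx (scl X) \<theta>' z" "Dx (scl X) \<omega> z = \<epsilon> * Dx (scl X) \<omega>' z"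
    "Dy (scl X) \<theta> z = \<epsilon> * Dy (scl X) \<theta>' z" "Dy (scl X) \<omega> z = \<epsilon> * Dy (scl X) \<omega>' z" for z
    by (simp_all add: \<omega>_def[abs_def] \<theta>_def[abs_def] Dx_eq_dd Dy_eq_dd dd_cmult sm\<theta>' sm\<omega>')
  have bb: "bb_eqs (scl X) \<beta> \<omega> \<theta>"
    unfolding bb_eqs_def
  proof (intro conjI allI)
    show "smooth \<theta>" unfolding \<theta>_def[abs_def] by (intro smooth_mult smooth_const sm\<theta>')
    fix z
    show "Dx (scl X) \<theta> z + \<i> * Dy (scl X) \<omega> z = sinh \<beta> * sinh (\<theta> z) * cosh (\<omega> z) + cosh \<beta> * cosh (\<theta> z) * sinh (\<omega> z)"
      "\<i> * Dy (scl X) \<theta> z + Dx (scl X) \<omega> z = - sinh \<beta> * cosh (\<theta> z) * sinh (\<omega> z) - cosh \<beta> * sinh (\<theta> z) * cosh (\<omega> z)"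
      unfolding D unfolding \<omega>_def \<theta>_def sh using eq[of z] by algebra+
  qed
  have posZ: "pos Z z = pos X z + G z *v ((\<epsilon> * inverse (sinh \<beta>)) *s bb_dir \<theta> z)" for z
    unfolding pZ e bb_dir_def \<theta>_def sh using ee
    by (simp add: mat3_simps vector_3 field_simps) (metis (no_types) mult.assoc mult.commute mult_1)?
  have sclZ: "scl Z = scl X" using bt by (simp add: bianchi_baecklund_transform_def)
  note ctx = X \<epsilon> bb S sclZ posZ
  have fX: "framed (scl X) \<omega> G" using X by (simp add: adapted_def)
  note SO = framed_smooth(3)[OF fX]
  define y where "y z = transpose (G z) *v nrm Z z" for z
  have Gy: "nrm Z z = G z *v y z" for z using SO by (simp add: y_def SO3_cancel)
  have gmZ: "with_gauss_map Z" using bt by (simp add: bianchi_baecklund_transform_def)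
  have y1: "y z $ 1 = cos \<sigma>" for z
  proof -
    have "cdot (nrm X z) (nrm Z z) = cos \<sigma>" using bt by (simp add: bianchi_baecklund_transform_def)
    moreover have "nrm X z = G z *v axis 1 1" using X by (simp add: adapted_def)
    ultimately show ?thesis unfolding Gy by (simp add: cdot_SO3[OF SO]) (simp add: cdot_3 axis_nth3)
  qed
  have yy: "y z $ 1 * y z $ 1 + y z $ 2 * y z $ 2 + y z $ 3 * y z $ 3 = 1" for z
  proof -
    have "cdot (nrm Z z) (nrm Z z) = 1" using gmZ by (simp add: with_gauss_map_def)
    then show ?thesis unfolding Gy cdot_SO3[OF SO] by (simp add: cdot_3)
  qed
  have yv: "\<i> * sinh (\<theta> z) * y z $ 2 + cosh (\<theta> z) * y z $ 3 = 0" for z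
  proof -
    have "cdot (pos Z z - pos X z) (nrm Z z) = 0" using bt by (simp add: bianchi_baecklund_transform_def)
    then have "cdot ((\<epsilon> * inverse (sinh \<beta>)) *s bb_dir \<theta> z) (y z) = 0"
      unfolding posZ Gy by (simp add: cdot_SO3[OF SO])
    then have "(\<epsilon> * inverse (sinh \<beta>)) * (\<i> * sinh (\<theta> z) * y z $ 2 + cosh (\<theta> z) * y z $ 3) = 0"
      unfolding cdot_3 bb_dir_def vector_smult_component vector_3 by algebra
    then show ?thesis using S \<epsilon> by auto
  qed
  \<comment> \<open>Orthogonality to \<open>bb_dir\<close> leaves one direction (cosh \<theta>, - i
    sinh \<theta>) for the last two components of y; b is the coefficient.\<close>
  define b where "b z = cosh (\<theta> z) * y z $ 2 - \<i> * sinh (\<theta> z) * y z $ 3" for z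
  note th = sinh_square'[of "\<theta> z" for z]
  have y23: "y z $ 2 = b z * cosh (\<theta> z)" "y z $ 3 = - \<i> * (b z * sinh (\<theta> z))" for z
    unfolding b_def using yv[of z] th[of z] i_squared by algebra+
  have c: "cos \<sigma> = - \<i> * cosh \<beta> * sin \<sigma>" using \<sigma> by (simp add: cot_def field_simps)
  have sc: "sin \<sigma> * sin \<sigma> + cos \<sigma> * cos \<sigma> = 1" using sin_cos_squared_add[of \<sigma>] by (simp add: power2_eq_square)
  have sS: "(sin \<sigma> * sinh \<beta>) * (sin \<sigma> * sinh \<beta>) = \<i> * \<i>"
    using sc c sinh_square'[of \<beta>] i_squared by algebra
  \<comment> \<open>Unit length gives b^2 = sin^2 \<sigma>. The value -1 is written as a square so
    that roots can be taken.\<close>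
  have "(b z * sinh \<beta>) * (b z * sinh \<beta>) = \<i> * \<i>" for z
    using yy[of z] y23[of z] y1[of z] th[of z] sc sS i_squared by algebra
  then have bS: "b z * sinh \<beta> = \<i> \<or> b z * sinh \<beta> = - \<i>" for z
    using square_eq_iff[of "b z * sinh \<beta>" \<i>] by blast
  have b': "b z = \<i> * inverse (sinh \<beta>) \<or> b z = - (\<i> * inverse (sinh \<beta>))" for z
    using bS[of z] S by (auto simp: field_simps)
  have smb: "continuous_on UNIV b"
  proof -
    have "smooth (nrm Z)" using gmZ by (simp add: with_gauss_map_def)
    then have "smooth y" unfolding y_def[abs_def] by (intro smooth_matrix_vec smooth_transpose framed_smooth(2)[OF fX])
    moreover have "smooth \<theta>" using bb by (simp add: bb_eqs_def)
    ultimately have "smooth b" unfolding b_def[abs_def]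
      by (intro smooth_diff smooth_mult smooth_const smooth_nth smooth_sinh smooth_cosh)
    then show ?thesis by (rule smooth_imp_continuous_on)
  qed
  have bc: "b z = b 0" for z
    by (rule sign_constant[OF smb connected_UNIV b']) auto
  \<comment> \<open>Chosen so that the last two components of y are those of \<open>bb_nrm\<close>
    times s.\<close>
  define s where "s = - \<i> * (b 0 * sinh \<beta>)"
  have s: "s \<in> {1, -1}" using bS[of 0] by (auto simp: s_def)
  have bs: "b z = s * (\<i> * inverse (sinh \<beta>))" for z
    unfolding bc[of z] s_def using S by (simp add: field_simps)
  have eq: "cos \<sigma> = cosh \<beta> * ((- \<i> * sin \<sigma> * sinh \<beta>) * inverse (sinh \<beta>))"
    using c S by (simp add: mult_ac)
  have "(- \<i> * sin \<sigma> * sinh \<beta>) * (- \<i> * sin \<sigma> * sinh \<beta>) = 1" using sS i_squared by algebra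
  then have "- \<i> * sin \<sigma> * sinh \<beta> = 1 \<or> - \<i> * sin \<sigma> * sinh \<beta> = -1"
    by (simp only: square_eq_1_iff)
  then have "cos \<sigma> = cosh \<beta> * (1 * inverse (sinh \<beta>)) \<or> cos \<sigma> = cosh \<beta> * (-1 * inverse (sinh \<beta>))"
    using eq by metis
  then have "cos \<sigma> = cosh \<beta> * inverse (sinh \<beta>) \<or> cos \<sigma> = - (cosh \<beta> * inverse (sinh \<beta>))"
    by simp
  moreover have ii: "\<i> * (s * (\<i> * x)) = - (s * x)" for x
    using i_squared by (metis (no_types) mult.left_commute mult_minus1 mult_minus_right mult.assoc)
  \<comment> \<open>For cosh \<beta> = 0 both formulas say cos \<sigma> = 0, so the mismatch may be
    assumed to occur with cosh \<beta> \<noteq> 0.\<close>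
  ultimately consider (good) "cos \<sigma> = - s * (cosh \<beta> * inverse (sinh \<beta>))" | (bad) "cos \<sigma> = s * (cosh \<beta> * inverse (sinh \<beta>))" "cosh \<beta> \<noteq> 0"
    using s by fastforce
  then show ?thesis
  proof cases
    case good
    have "y z = s *s bb_nrm \<beta> \<theta> z" for z
      using y1[of z] good by (simp add: vec3_eq_iff bb_nrm_def vector_3 y23 bs ii mult.assoc)
    then have "\<exists>H. adapted Z (\<lambda>z. s * \<theta> z) \<epsilon> H"
      by (intro bb_adapted[OF ctx s]) (simp add: Gy)
    then show ?thesis using that[OF \<epsilon> s X bb] by blast
  next
    case bad
    have PX: "Px X z = G z *v vector [0, 0, \<epsilon> * cosh (\<omega> z)]" for z using X by (simp add: adapted_def)
    have ch: "cosh (\<omega> z) \<noteq> 0" for z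
      using nd bad(2) \<epsilon> unfolding PX cdot_SO3_vector[OF SO] by auto
    have P: "cdot (Px Z z) (nrm Z z) = 0" "cdot (Py Z z) (nrm Z z) = 0" for z
      using gmZ by (auto simp: with_gauss_map_def)
    have r: "sinh \<beta> * inverse (sinh \<beta>) = 1" using S by simp
    \<comment> \<open>y and s times \<open>bb_nrm\<close> differ only in the sign of the first
      component, and both are orthogonal to the tangent vectors of Z. Hence the first components of
      those tangent vectors vanish.\<close>
    have K: "cosh (\<theta> z) * sinh (\<omega> z) = 0" "sinh (\<theta> z) * cosh (\<omega> z) = 0" for z
    proof -
      have e0: "\<epsilon> \<noteq> 0" and s0: "s \<noteq> 0" using \<epsilon> s by auto
      define T where "T = inverse (sinh \<beta>)"
      have T: "T \<noteq> 0" using S by (simp add: T_def)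
      have y': "y z $ 1 = s * (cosh \<beta> * T)" "y z $ 2 = s * (\<i> * T * cosh (\<theta> z))" "y z $ 3 = s * (T * sinh (\<theta> z))"
        using y1[of z] bad(1) by (simp_all add: y23 bs ii T_def mult.assoc)
      have "cdot (bb_matrix \<beta> \<omega> \<theta> z *v vector [0, 0, \<epsilon> * cosh (\<theta> z)]) (y z) = 0"
        using P(1)[of z] unfolding Px_Z[OF ctx] Gy cdot_SO3[OF SO] .
      then have 1: "2 * (\<epsilon> * s * cosh \<beta> * T * T * (cosh (\<theta> z) * sinh (\<omega> z))) = 0"
        unfolding bb_matrix_def bb_nrm_def cdot_3 matrix_vec_nth3 transpose_nth rows_nth vector_3 y' T_def[symmetric]
        using th[of z] i_squared by algebra
      have "cdot (bb_matrix \<beta> \<omega> \<theta> z *v vector [0, \<epsilon> * sinh (\<theta> z), 0]) (y z) = 0"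
        using P(2)[of z] unfolding Py_Z[OF ctx] Gy cdot_SO3[OF SO] .
      then have 2: "2 * \<i> * (\<epsilon> * s * cosh \<beta> * T * T * (sinh (\<theta> z) * cosh (\<omega> z))) = 0"
        unfolding bb_matrix_def bb_nrm_def cdot_3 matrix_vec_nth3 transpose_nth rows_nth vector_3 y' T_def[symmetric]
        using th[of z] i_squared by algebra
      show "cosh (\<theta> z) * sinh (\<omega> z) = 0" "sinh (\<theta> z) * cosh (\<omega> z) = 0"
        using 1 2 e0 s0 bad(2) T by (simp_all only: mult_eq_0_iff) simp_all
    qed
    have sh0: "sinh (\<theta> z) = 0" for z using K(2)[of z] ch[of z] by simp
    have "cosh (\<theta> z) \<noteq> 0" for z
    proof
      assume "cosh (\<theta> z) = 0"
      then show False using th[of z] sh0[of z] by simp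
    qed
    then have sh1: "sinh (\<omega> z) = 0" for z using K(1)[of z] by simp
    have "\<exists>H. adapted Z \<theta> \<epsilon> H"
    proof (rule degenerate_adapted[OF ctx sh1 sh0 Gy])
      show "y z = vector [cos \<sigma>, b 0 * cosh (\<theta> z), 0]" for z
        using y1[of z] y23[of z] sh0[of z] bc[of z] by (simp add: vec3_eq_iff vector_3)
      show "cos \<sigma> * cos \<sigma> + b 0 * b 0 = 1"
        using yy[of 0] y1[of 0] y23[of 0] th[of 0] i_squared by algebra
    qed
    then obtain H where "adapted Z \<theta> \<epsilon> H" by blast
    then have "adapted Z (\<lambda>z. 1 * \<theta> z) \<epsilon> H" by simp
    then show ?thesis by (rule that[OF \<epsilon> _ X bb, rotated]) simp
  qed
qed

section \<open>Change of the spectral parameter\<close>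

text \<open>The difference and the sum of the two equations: the addition theorems combine the right
  sides, and sinh \<beta>, cosh \<beta> combine to exponentials. In this form \<beta> and \<mu> are
  visibly one parameter.\<close>

lemma bb_eqs_iff:
  assumes \<mu>: "\<mu> \<noteq> 0" and sm: "smooth \<omega>" "smooth \<theta>"
  shows "bb_eqs \<mu> \<beta> \<omega> \<theta> \<longleftrightarrow> (\<forall>z. 2 * \<mu> * (wz \<theta> z - wz \<omega> z) = exp \<beta> * sinh (\<theta> z + \<omega> z) \<and>
    2 * (wzb \<theta> z + wzb \<omega> z) = - \<mu> * exp (- \<beta>) * sinh (\<theta> z - \<omega> z))"
proof -
  have "(A + \<i> * B = S * t * c + C * k * s \<and> \<i> * A' + B' = - S * k * s - C * t * c) \<longleftrightarrow>
     ((A - B') - \<i> * (A' - B) = (S + C) * (t * c + k * s) \<and> (A + B') + \<i> * (A' + B) = - (C - S) * (t * c - k * s))"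
    for A B A' B' S C t c k s :: complex
  proof safe
    assume "A + \<i> * B = S * t * c + C * k * s" "\<i> * A' + B' = - S * k * s - C * t * c"
    then show "(A - B') - \<i> * (A' - B) = (S + C) * (t * c + k * s)" "(A + B') + \<i> * (A' + B) = - (C - S) * (t * c - k * s)" by algebra+
  next
    assume *: "(A - B') - \<i> * (A' - B) = (S + C) * (t * c + k * s)" "(A + B') + \<i> * (A' + B) = - (C - S) * (t * c - k * s)"
    then have **: "2 * (A + \<i> * B) = 2 * (S * t * c + C * k * s)" "2 * (\<i> * A' + B') = 2 * (- S * k * s - C * t * c)" by algebra+
    have two: "x = y" if "2 * x = 2 * y" for x y :: complex using that by simp
    show "A + \<i> * B = S * t * c + C * k * s" "\<i> * A' + B' = - S * k * s - C * t * c"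
      by (rule two[OF **(1)], rule two[OF **(2)])
  qed
  note key = this
  have e: "exp \<beta> = sinh \<beta> + cosh \<beta>" "exp (- \<beta>) = cosh \<beta> - sinh \<beta>"
    by (simp_all add: sinh_plus_cosh cosh_minus_sinh)
  have d1: "(Dx \<mu> \<theta> z - Dx \<mu> \<omega> z) - \<i> * (Dy \<mu> \<theta> z - Dy \<mu> \<omega> z) = 2 * \<mu> * (wz \<theta> z - wz \<omega> z)"
    and d2: "\<mu> * ((Dx \<mu> \<theta> z + Dx \<mu> \<omega> z) + \<i> * (Dy \<mu> \<theta> z + Dy \<mu> \<omega> z)) = 2 * (wzb \<theta> z + wzb \<omega> z)" for z
    using \<mu> by (simp_all add: Dx_def Dy_def field_simps)
  have key2: "(Dx \<mu> \<theta> z + Dx \<mu> \<omega> z) + \<i> * (Dy \<mu> \<theta> z + Dy \<mu> \<omega> z) = - (cosh \<beta> - sinh \<beta>) * (sinh (\<theta> z) * cosh (\<omega> z) - cosh (\<theta> z) * sinh (\<omega> z)) \<longleftrightarrow>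
     2 * (wzb \<theta> z + wzb \<omega> z) = - \<mu> * (cosh \<beta> - sinh \<beta>) * (sinh (\<theta> z) * cosh (\<omega> z) - cosh (\<theta> z) * sinh (\<omega> z))" for z
  proof -
    have "- \<mu> * (cosh \<beta> - sinh \<beta>) * x = \<mu> * (- (cosh \<beta> - sinh \<beta>) * x)" for x
      by (simp only: mult_minus_left mult_minus_right mult.assoc)
    then show ?thesis unfolding d2[symmetric] by (simp only: mult_left_cancel[OF \<mu>])
  qed
  show ?thesis
    unfolding bb_eqs_def all_conj_distrib[symmetric] key d1 key2 e sinh_add sinh_diff using sm by simp
qed

lemma sinh_cosh_plus_pi: "sinh (x + \<i> * of_real pi) = - sinh x" "cosh (x + \<i> * of_real pi) = - cosh x" for x :: complex
proof -
  have "exp (\<i> * of_real pi) = (-1 :: complex)" "exp (- (\<i> * of_real pi)) = (-1 :: complex)"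
    using exp_pi_i exp_minus[of "\<i> * complex_of_real pi"] by (simp_all add: mult.commute)
  then show "sinh (x + \<i> * of_real pi) = - sinh x" "cosh (x + \<i> * of_real pi) = - cosh x"
    by (simp_all add: sinh_field_def cosh_field_def exp_add exp_diff minus_add_distrib exp_minus field_simps)
qed

lemma wz_add_const: "smooth f \<Longrightarrow> wz (\<lambda>z. f z + c) z = wz f z" "smooth f \<Longrightarrow> wzb (\<lambda>z. f z + c) z = wzb f z"
  by (simp_all add: wz_eq_dd wzb_eq_dd dd_add)

text \<open>The hypothesis \<open>e\<close> preserves the ratio of exp \<beta> to \<mu> only up to
  sign. Shifting \<theta> by i \<pi> negates sinh (\<theta> + \<omega>) and sinh (\<theta> -
  \<omega>) and so supplies that sign.\<close>

lemma bb_eqs_change: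
  assumes bb: "bb_eqs \<mu> \<beta> \<omega> \<theta>" and sm: "smooth \<omega>" and \<mu>: "\<mu> \<noteq> 0" "\<mu>' \<noteq> 0" and e: "exp \<beta>' * \<mu> = - (exp \<beta> * \<mu>')"
  shows "bb_eqs \<mu>' \<beta>' \<omega> (\<lambda>z. \<theta> z + \<i> * of_real pi)"
proof -
  have st: "smooth \<theta>" using bb by (simp add: bb_eqs_def)
  have st': "smooth (\<lambda>z. \<theta> z + \<i> * of_real pi)" by (intro smooth_add smooth_const st)
  have E: "exp \<beta> * exp (- \<beta>) = 1" "exp \<beta>' * exp (- \<beta>') = 1" by (simp_all add: exp_minus)
  have eqs: "2 * \<mu> * (wz \<theta> z - wz \<omega> z) = exp \<beta> * sinh (\<theta> z + \<omega> z)" "2 * (wzb \<theta> z + wzb \<omega> z) = - \<mu> * exp (- \<beta>) * sinh (\<theta> z - \<omega> z)" for z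
    using bb bb_eqs_iff[OF \<mu>(1) sm st] by auto
  have sh: "sinh (\<theta> z + \<i> * of_real pi + \<omega> z) = - sinh (\<theta> z + \<omega> z)" "sinh (\<theta> z + \<i> * of_real pi - \<omega> z) = - sinh (\<theta> z - \<omega> z)" for z
    using sinh_cosh_plus_pi(1)[of "\<theta> z + \<omega> z"] sinh_cosh_plus_pi(1)[of "\<theta> z - \<omega> z"] by (simp_all add: algebra_simps)
  have 2: "\<mu> * exp (- \<beta>) = - (\<mu>' * exp (- \<beta>'))" using e E by algebra
  have 1: "2 * \<mu>' * (wz \<theta> z - wz \<omega> z) = - exp \<beta>' * sinh (\<theta> z + \<omega> z)" for z
  proof -
    have "\<mu> * (2 * \<mu>' * (wz \<theta> z - wz \<omega> z)) = \<mu>' * (exp \<beta> * sinh (\<theta> z + \<omega> z))"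
      unfolding eqs(1)[symmetric] by (simp add: mult_ac)
    also have "\<dots> = \<mu> * (- exp \<beta>' * sinh (\<theta> z + \<omega> z))" using e by algebra
    finally show ?thesis unfolding mult_left_cancel[OF \<mu>(1)] .
  qed
  show ?thesis
    unfolding bb_eqs_iff[OF \<mu>(2) sm st'] wz_add_const[OF st] sh
  proof (intro allI conjI)
    fix z
    show "2 * \<mu>' * (wz \<theta> z - wz \<omega> z) = exp \<beta>' * - sinh (\<theta> z + \<omega> z)" using 1[of z] by simp
    show "2 * (wzb \<theta> z + wzb \<omega> z) = - \<mu>' * exp (- \<beta>') * - sinh (\<theta> z - \<omega> z)" unfolding eqs(2) using 2 by algebra
  qed
qed

text \<open>The shift negates both hyperbolic functions, and a half-turn of the frame about the
  normal undoes this; the surface itself does not change.\<close>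

lemma adapted_shift:
  assumes X: "adapted X (\<lambda>z. s * (\<theta> z + \<i> * of_real pi)) \<epsilon> G" and s: "s \<in> {1, -1}" and sm: "smooth \<theta>"
    and sg: "sinh_gordon (\<lambda>z. s * \<theta> z)"
  shows "\<exists>H. adapted X (\<lambda>z. s * \<theta> z) \<epsilon> H"
proof -
  \<comment> \<open>The half-turn about the first axis, which is the normal in the frame.\<close>
  define D :: "complex^3^3" where "D = transpose (vector [vector [1, 0, 0], vector [0, -1, 0], vector [0, 0, -1]])"
  have D: "D \<in> SO3"
  proof (rule SO3I)
    show "transpose D ** D = mat 1"
      unfolding D_def by (rule columns_orthonormal) (simp_all add: cdot_3 vector_3)
    show "det D = 1"
      unfolding D_def det_transpose_rows by (simp add: cdot_3 vector_3 ccross_def)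
  qed
  have Dv: "D *v v = vector [v $ 1, - v $ 2, - v $ 3]" for v
    by (simp add: D_def vec3_eq_iff matrix_vec_nth3 transpose_nth rows_nth vector_3)
  have sh: "sinh (s * (\<theta> z + \<i> * of_real pi)) = - sinh (s * \<theta> z)" "cosh (s * (\<theta> z + \<i> * of_real pi)) = - cosh (s * \<theta> z)" for z
    using s sinh_cosh_plus_pi[of "\<theta> z"] sinh_minus[of "\<theta> z + \<i> * of_real pi"] cosh_minus[of "\<theta> z + \<i> * of_real pi"]
    by (auto simp: algebra_simps)
  have w: "wz (\<lambda>z. s * (\<theta> z + \<i> * of_real pi)) z = wz (\<lambda>z. s * \<theta> z) z" "wzb (\<lambda>z. s * (\<theta> z + \<i> * of_real pi)) z = wzb (\<lambda>z. s * \<theta> z) z" for z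
    using sm by (simp_all add: wz_eq_dd wzb_eq_dd dd_cmult dd_add smooth_add)
  have "framed (scl X) (\<lambda>z. s * \<theta> z) (\<lambda>z. G z ** D)"
  proof (rule framed_right_mult[OF _ D sg])
    show "framed (scl X) (\<lambda>z. s * (\<theta> z + \<i> * of_real pi)) G" using X by (simp add: adapted_def)
    show "D *v uz (scl X) (\<lambda>z. s * \<theta> z) z = uz (scl X) (\<lambda>z. s * (\<theta> z + \<i> * of_real pi)) z"
      "D *v uzb (scl X) (\<lambda>z. s * \<theta> z) z = uzb (scl X) (\<lambda>z. s * (\<theta> z + \<i> * of_real pi)) z" for z
      unfolding Dv uz_def uzb_def sh w by (simp_all add: vec3_eq_iff vector_3)
  qed
  then have "adapted X (\<lambda>z. s * \<theta> z) \<epsilon> (\<lambda>z. G z ** D)"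
    using X unfolding adapted_def sh
    by (auto simp: matrix_vector_mul_assoc[symmetric] Dv vector_3 axis_nth3 intro!: arg_cong[where f="\<lambda>v. G z *v v" for z])
       (simp_all add: vec3_eq_iff vector_3 axis_nth3)?
  then show ?thesis by blast
qed

lemma sinh_eq_zero_imp:
  assumes "sinh \<beta> = 0"
  shows "\<beta> \<in> {\<i> * of_int n * of_real pi | n :: int. True}"
proof -
  have "exp \<beta> = exp (- \<beta>)" using assms by (simp add: sinh_field_def)
  then have "exp (2 * \<beta>) = 1"
    using exp_add[of \<beta> \<beta>] exp_add[of "- \<beta>" \<beta>] by simp
  then obtain n :: int where "Re \<beta> = 0" "Im \<beta> = of_int n * pi"
    by (auto simp: exp_eq_1)
  then have "\<beta> = \<i> * of_int n * of_real pi" by (simp add: complex_eq_iff)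
  then show ?thesis by blast
qed

text \<open>The transform constructed in the new coordinate has the same s, \<theta> and \<epsilon>
  as the one from which \<open>bb\<close> came. By these data the two transforms are recognized as
  associated or congruent.\<close>

lemma BB_change:
  assumes X: "adapted X \<omega> \<epsilon> G" and \<epsilon>: "\<epsilon> \<in> {1, -1}" and s: "s \<in> {1, -1}" and S: "sinh \<beta>' \<noteq> 0"
    and bb: "bb_eqs \<mu> \<beta> \<omega> \<theta>" and \<mu>: "\<mu> \<noteq> 0" and e: "exp \<beta>' * \<mu> = - (exp \<beta> * scl X)"
  obtains Z H where "BB \<beta>' X Z" "adapted Z (\<lambda>z. s * \<theta> z) \<epsilon> H"
proof -
  have f: "framed (scl X) \<omega> G" using X by (simp add: adapted_def)
  then have \<mu>': "scl X \<noteq> 0" and sg: "sinh_gordon \<omega>" by (auto simp: framed_def)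
  \<comment> \<open>The shift corrects the sign in \<open>e\<close>; it is removed at the end by
    \<open>adapted_shift\<close>.\<close>
  define \<theta>' where "\<theta>' z = \<theta> z + \<i> * of_real pi" for z
  have bb': "bb_eqs (scl X) \<beta>' \<omega> \<theta>'"
    using bb_eqs_change[OF bb framed_smooth(1)[OF f] \<mu> \<mu>' e] by (simp add: \<theta>'_def[abs_def])
  define Z where "Z = CSurface (\<lambda>z. pos X z + G z *v ((\<epsilon> * inverse (sinh \<beta>')) *s bb_dir \<theta>' z)) (\<lambda>z. G z *v (s *s bb_nrm \<beta>' \<theta>' z)) (scl X)"
  have Z: "scl Z = scl X" "\<And>z. pos Z z = pos X z + G z *v ((\<epsilon> * inverse (sinh \<beta>')) *s bb_dir \<theta>' z)" "\<And>z. nrm Z z = G z *v (s *s bb_nrm \<beta>' \<theta>' z)"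
    by (simp_all add: Z_def)
  have B: "BB \<beta>' X Z" by (rule BB_intro[OF X \<epsilon> bb' S Z(1,2) s Z(3)])
  obtain H where "adapted Z (\<lambda>z. s * \<theta>' z) \<epsilon> H" using bb_adapted[OF X \<epsilon> bb' S Z(1,2) s Z(3)] by blast
  then have "\<exists>H. adapted Z (\<lambda>z. s * \<theta> z) \<epsilon> H"
    unfolding \<theta>'_def
    by (rule adapted_shift[OF _ s]) (use bb sinh_gordon_scale[OF sinh_gordon_bb[OF \<mu> sg bb] s] in \<open>simp_all add: bb_eqs_def\<close>)
  then show ?thesis using that B by blast
qed

text \<open>Association is defined up to rigid motion, so the composite on the right does not change
  when Y is moved rigidly, whereas \<open>BB\<close> compares actual positions. Hence the factor
  \<open>congruent\<close> on the left.\<close>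

theorem corollary3:
  fixes F \<phi> :: "complex \<Rightarrow> real^3" and \<omega> :: "complex \<Rightarrow> real" and \<beta> :: complex
  assumes "spherical_surface (real_surface F \<phi>) (\<lambda>z. complex_of_real (\<omega> z))"
    and "harmonic_into_sphere \<phi>" and "nowhere_conformal \<phi>"
    and "\<beta> \<notin> {\<i> * of_int n * of_real pi | n :: int. True}"
  shows "(BB \<beta> OO congruent) (real_surface F \<phi>) Y \<longleftrightarrow>
    (bonnet (\<beta> + \<i> * of_real pi / 2) OO BB (\<i> * of_real pi / 2)
       OO (bonnet (\<beta> + \<i> * of_real pi / 2))\<inverse>\<inverse>) (real_surface F \<phi>) Y"
proof -
  define X where "X = real_surface F \<phi>"
  define lam where "lam = exp (- (\<beta> + \<i> * of_real pi / 2))"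
  let ?\<gamma> = "\<i> * of_real pi / 2"
  have sclX: "scl X = 1" by (simp add: X_def real_surface_def)
  have lam: "lam \<noteq> 0" by (simp add: lam_def)
  have S: "sinh \<beta> \<noteq> 0" using assms(4) sinh_eq_zero_imp by blast
  have e2: "exp ?\<gamma> = \<i>" by (simp add: exp_eq_polar[symmetric] exp_Euler cis_conv_exp[symmetric] complex_eq_iff Re_exp Im_exp)
  have em: "exp (- ?\<gamma>) = - \<i>" unfolding exp_minus e2 by simp
  have S2: "sinh ?\<gamma> \<noteq> 0" "cosh ?\<gamma> = 0"
    unfolding sinh_field_def cosh_field_def e2 em by simp_all
  \<comment> \<open>\<lambda> exp \<beta> = exp (- i \<pi>/2) = - exp (i \<pi>/2): the sign that
    \<open>BB_change\<close> expects.\<close>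
  have e: "exp ?\<gamma> * 1 = - (exp \<beta> * lam)" "exp \<beta> * lam = - (exp ?\<gamma> * 1)"
  proof -
    have "exp \<beta> * lam = exp (- ?\<gamma>)" unfolding lam_def exp_add[symmetric] by simp
    then show "exp ?\<gamma> * 1 = - (exp \<beta> * lam)" "exp \<beta> * lam = - (exp ?\<gamma> * 1)" unfolding em e2 by simp_all
  qed
  have bon: "bonnet (\<beta> + ?\<gamma>) = associated lam" by (simp add: bonnet_def lam_def)
  \<comment> \<open>A real \<omega> has cosh \<omega> > 0, so the assumption of
    \<open>BB_elim\<close> holds for arbitrary \<beta>.\<close>
  have nd: "cdot (Px X z) (Px X z) \<noteq> 0" for z
  proof -
    have "cosh (complex_of_real (\<omega> z)) = of_real (cosh (\<omega> z))"
      by (simp add: cosh_field_def exp_of_real[symmetric])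
    then show ?thesis
      using assms(1) cosh_real_pos[of "\<omega> z"] unfolding X_def[symmetric] spherical_surface_def by auto
  qed
  show ?thesis
    unfolding X_def[symmetric] bon
  proof
    assume "(BB \<beta> OO congruent) X Y"
    then obtain Z where Z: "BB \<beta> X Z" "congruent Z Y" by blast
    obtain \<omega>' \<epsilon> G \<theta> s H where \<epsilon>: "\<epsilon> \<in> {1, -1}" and s: "s \<in> {1, -1}" and X: "adapted X \<omega>' \<epsilon> G"
      and bb: "bb_eqs (scl X) \<beta> \<omega>' \<theta>" and H: "adapted Z (\<lambda>z. s * \<theta> z) \<epsilon> H"
      by (rule BB_elim[OF Z(1) S]) (use nd that in blast)+
    have "sinh_gordon \<omega>'" using X by (simp add: adapted_def framed_def)
    \<comment> \<open>The associated surface, with the same \<omega> and the same sign as X, in the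
      coordinate of scale \<open>lam\<close>.\<close>
    then obtain U K where U: "adapted U \<omega>' \<epsilon> K" "scl U = lam" using adapted_exists[OF _ lam] by blast
    have XU: "associated lam X U" by (rule associatedI[OF X sclX U \<epsilon>])
    obtain V L where V: "BB ?\<gamma> U V" "adapted V (\<lambda>z. s * \<theta> z) \<epsilon> L"
      by (rule BB_change[OF U(1) \<epsilon> s S2(1) bb]) (use sclX U(2) e in auto)
    obtain M where M: "adapted Y (\<lambda>z. s * \<theta> z) \<epsilon> M" using congruent_adapted[OF Z(2) H] by blast
    have "scl Z = scl X" using Z(1) unfolding BB_def bianchi_baecklund_transform_def by blast
    then have "scl Y = 1" using Z(2) sclX by (simp add: congruent_def)
    moreover have "scl V = lam" using V(1) U(2) unfolding BB_def bianchi_baecklund_transform_def by auto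
    \<comment> \<open>Y and V have the same s \<theta> and \<epsilon>, at the scales 1 and
      \<open>lam\<close>.\<close>
    ultimately have "associated lam Y V" by (intro associatedI[OF M _ V(2) _ \<epsilon>])
    then show "(associated lam OO BB ?\<gamma> OO (associated lam)\<inverse>\<inverse>) X Y" using XU V(1) by blast
  next
    assume "(associated lam OO BB ?\<gamma> OO (associated lam)\<inverse>\<inverse>) X Y"
    then obtain U V where XU: "associated lam X U" and UV: "BB ?\<gamma> U V" and YV: "associated lam Y V" by blast
    have "scl U = lam * scl X" "scl V = lam * scl Y"
      using XU YV unfolding associated_def congruent_def by auto
    moreover have "scl V = scl U" using UV unfolding BB_def bianchi_baecklund_transform_def by blast
    ultimately have sclU: "scl U = lam" and sclY: "scl Y = 1" using lam sclX by simp_all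
    \<comment> \<open>For the parameter i \<pi>/2 the normals are orthogonal, and cosh = 0 meets the
      assumption of \<open>BB_elim\<close> for the complex surface U.\<close>
    obtain \<omega>' \<epsilon> G \<theta> s H where \<epsilon>: "\<epsilon> \<in> {1, -1}" and s: "s \<in> {1, -1}" and U: "adapted U \<omega>' \<epsilon> G"
      and bb: "bb_eqs (scl U) ?\<gamma> \<omega>' \<theta>" and H: "adapted V (\<lambda>z. s * \<theta> z) \<epsilon> H"
      by (rule BB_elim[OF UV S2(1)]) (use S2(2) that in blast)+
    obtain K where X: "adapted X \<omega>' \<epsilon> K" using associated_adapted[OF XU sclX] U by blast
    obtain M where Y: "adapted Y (\<lambda>z. s * \<theta> z) \<epsilon> M" using associated_adapted[OF YV sclY] H by blast
    \<comment> \<open>A transform of X itself with the data of Y and scale 1, hence congruent to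
      Y.\<close>
    obtain Z L where Z: "BB \<beta> X Z" "adapted Z (\<lambda>z. s * \<theta> z) \<epsilon> L"
      by (rule BB_change[OF X \<epsilon> s S bb]) (use sclX sclU lam e in auto)
    have "scl Z = scl X" using Z(1) unfolding BB_def bianchi_baecklund_transform_def by blast
    then have "congruent Z Y" by (intro adapted_congruent[OF Z(2) Y]) (simp add: sclX sclY)
    then show "(BB \<beta> OO congruent) X Y" using Z(1) by blast
  qed
qed

end
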